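(* Let $(G,P)$ be a quasi-lattice ordered group and $X$ a compactly aligned product system over $P$ of right Hilbert $A$--$A$-bimodules. Let $\sigma^N$ be the dynamics on $\mathcal{NT}(X)$ arising from a homomorphism $N:G\to(0,\infty)$ such that $N(r)\ge1$ for all $r\in P$, with equality only when $r=e$. Then $\phi\mapsto\phi\circ\Phi^\delta$ is an affine isomorphism from the set of states $\phi$ of $\mathcal F$ such that $\phi|_{B_s}=0$ for all $s\in P\setminus\{e\}$ onto the set of ground states of $(\mathcal{NT}(X),\sigma^N)$.
   Context: $A$ is a unital $C^*$-algebra. A right Hilbert $A$--$A$-bimodule is a right Hilbert $A$-module $Y$ (inner product $A$-valued, conjugate-linear in the first variable) with a $*$-homomorphism $\varphi:A\to\mathcal L(Y)$ (adjointable operators) giving the left action. $\theta_{\xi,\eta}(\zeta)=\xi\cdot\langle\eta,\zeta\rangle$ and $\mathcal K(Y)=\overline{\mathrm{span}}\{\theta_{\xi,\eta}\}$. The balanced tensor product $X\otimes_A Y$ has inner product $\langle\xi_1\otimes\eta_1,\xi_2\otimes\eta_2\rangle=\langle\langle\xi_2,\xi_1\rangle\cdot\eta_1,\eta_2\rangle$ and left action $a\mapsto\varphi(a)\otimes I$. $(G,P)$ is a quasi-lattice ordered group if $G$ is a discrete group, $P\subseteq G$ is a subsemigroup with $P\cap P^{-1}=\{e\}$, and, for the order $s\preceq r\Leftrightarrow s^{-1}r\in P$, any two elements $s,r\in G$ with a common upper bound in $P$ have a least upper bound $s\vee r\in P$ (written $s\vee r<\infty$; otherwise $s\vee r=\infty$).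 A product system over $P$ is $X=\bigsqcup_{s\in P}X_s$ where each $X_s$ is a right Hilbert $A$--$A$-bimodule (inner product $\langle\cdot,\cdot\rangle_s$, left action $\varphi_s$), $X_e={}_AA_A$ with $\langle a,b\rangle=a^*b$, and $X$ is a semigroup with $X_sX_r\subseteq X_{sr}$, such that for $s,r\neq e$ the product extends to an isomorphism $F^{s,r}:X_s\otimes_AX_r\to X_{sr}$ of right Hilbert $A$--$A$-bimodules, while products with elements of $X_e=A$ are given by the bimodule actions. For $S\in\mathcal L(X_s)$, $i_s^{sr}(S)=F^{s,r}(S\otimes_AI_r)(F^{s,r})^*\in\mathcal L(X_{sr})$; $i_e^r=\varphi_r$, $i_s^s=\mathrm{id}$. $X$ is compactly aligned if $i_s^{s\vee r}(S)i_r^{s\vee r}(T)\in\mathcal K(X_{s\vee r})$ whenever $s\vee r<\infty$, $S\in\mathcal K(X_s)$, $T\in\mathcal K(X_r)$. A Toeplitz representation $\psi:X\to C$ in a $C^*$-algebra $C$: $\psi_s=\psi|_{X_s}$ linear, $\psi_e$ a $*$-homomorphism, $\psi_s(\xi)\psi_r(\eta)=\psi_{sr}(\xi\eta)$, and $\psi_s(\xi)^*\psi_s(\eta)=\psi_e(\langle\xi,\eta\rangle_s)$. It induces $*$-homomorphisms $\psi^{(s)}:\mathcal K(X_s)\to C$, $\psi^{(s)}(\theta_{\xi,\eta})=\psi_s(\xi)\psi_s(\eta)^*$. It is Nica covariant if $\psi^{(s)}(S)\psi^{(r)}(T)$ equals $\psi^{(s\vee r)}(i_s^{s\vee r}(S)i_r^{s\vee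 r}(T))$ when $s\vee r<\infty$ and $0$ otherwise. $\mathcal{NT}(X)$ is the $C^*$-algebra generated by a universal Nica covariant Toeplitz representation $i_X$, with $i_s=i_X|_{X_s}$ and $i^{(s)}$ the induced homomorphism of $\mathcal K(X_s)$; it is the closed span of the elements $i_s(\xi)i_r(\eta)^*$. The core $\mathcal F$ is the closed span of the elements $i_s(\xi)i_s(\eta)^*$, $\xi,\eta\in X_s$, $s\in P$. For $s\in P$, $B_s=\{i^{(s)}(T):T\in\mathcal K(X_s)\}$, a $C^*$-subalgebra of $\mathcal F$. There is a conditional expectation $\Phi^\delta:\mathcal{NT}(X)\to\mathcal F$ with $\Phi^\delta(i_s(\xi)i_r(\eta)^* )=\delta_{s,r}\,i_s(\xi)i_s(\eta)^*$. For a homomorphism $N:G\to(0,\infty)$ (multiplicative), $\sigma^N:\mathbb R\to\mathrm{Aut}(\mathcal{NT}(X))$ is the dynamics with $\sigma^N_t(i_e(a))=i_e(a)$, $\sigma^N_t(i_s(\xi))=N(s)^{it}i_s(\xi)$. An element $c$ is $\sigma$-analytic if $t\mapsto\sigma_t(c)$ extends to an entire function. A state $\omega$ of $C$ is a ground state of $(C,\sigma)$ if for all $\sigma$-analytic $c,d\in C$ the entire function $z\mapsto\omega(c\sigma_z(d))$ is bounded on the upper half-plane (it suffices to check this on a set of analytic elements spanning a dense subspace). *)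

theory Defs
  imports "HOL-Analysis.Analysis" "HOL-Algebra.Group"
begin

section \<open>C*-algebras\<close>

text \<open>
  The fixed algebras (the coefficient algebra and the Nica-Toeplitz algebra) are types of the
  following class. No unit is required; a unital C*-algebra is a type of sort
  \<open>{cstar_algebra, monoid_mult}\<close>.
\<close>

class cstar_algebra = real_normed_algebra + complete_space +
  fixes scaleC :: "complex \<Rightarrow> 'a \<Rightarrow> 'a" (infixr "*\<^sub>C" 75)
    and adj :: "'a \<Rightarrow> 'a"
  assumes scaleC_add_right: "c *\<^sub>C (x + y) = c *\<^sub>C x + c *\<^sub>C y"
    and scaleC_add_left: "(c + d) *\<^sub>C x = c *\<^sub>C x + d *\<^sub>C x"
    and scaleC_scaleC: "c *\<^sub>C d *\<^sub>C x = (c * d) *\<^sub>C x"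
    and scaleC_of_real: "complex_of_real r *\<^sub>C x = r *\<^sub>R x"
    and mult_scaleC_left: "(c *\<^sub>C x) * y = c *\<^sub>C (x * y)"
    and mult_scaleC_right: "x * (c *\<^sub>C y) = c *\<^sub>C (x * y)"
    and norm_scaleC: "norm (c *\<^sub>C x) = cmod c * norm x"
    and adj_add: "adj (x + y) = adj x + adj y"
    and adj_scaleC: "adj (c *\<^sub>C x) = cnj c *\<^sub>C adj x"
    and adj_mult: "adj (x * y) = adj y * adj x"
    and adj_adj: "adj (adj x) = x"
    and cstar_identity: "norm (adj x * x) = (norm x)\<^sup>2"

text \<open>
  C*-algebras and modules that vary inside a statement are records with an explicit carrier.
\<close>

record 'v cvec = "'v partial_object" +
  vzero :: 'v
  vadd :: "'v \<Rightarrow> 'v \<Rightarrow> 'v"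
  vscale :: "complex \<Rightarrow> 'v \<Rightarrow> 'v"

definition vdiff :: "('v, 'm) cvec_scheme \<Rightarrow> 'v \<Rightarrow> 'v \<Rightarrow> 'v" where
  "vdiff V x y = vadd V x (vscale V (-1) y)"

locale complex_vec =
  fixes V :: "('v, 'm) cvec_scheme"
  assumes vzero_closed: "vzero V \<in> carrier V"
    and vadd_closed: "\<lbrakk>x \<in> carrier V; y \<in> carrier V\<rbrakk> \<Longrightarrow> vadd V x y \<in> carrier V"
    and vscale_closed: "x \<in> carrier V \<Longrightarrow> vscale V c x \<in> carrier V"
    and vadd_assoc: "\<lbrakk>x \<in> carrier V; y \<in> carrier V; z \<in> carrier V\<rbrakk>
      \<Longrightarrow> vadd V (vadd V x y) z = vadd V x (vadd V y z)"
    and vadd_comm: "\<lbrakk>x \<in> carrier V; y \<in> carrier V\<rbrakk> \<Longrightarrow> vadd V x y = vadd V y x"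
    and vadd_zero: "x \<in> carrier V \<Longrightarrow> vadd V (vzero V) x = x"
    and vadd_inverse: "x \<in> carrier V \<Longrightarrow> \<exists>y\<in>carrier V. vadd V x y = vzero V"
    and vscale_add_right: "\<lbrakk>x \<in> carrier V; y \<in> carrier V\<rbrakk>
      \<Longrightarrow> vscale V c (vadd V x y) = vadd V (vscale V c x) (vscale V c y)"
    and vscale_add_left: "x \<in> carrier V
      \<Longrightarrow> vscale V (c + d) x = vadd V (vscale V c x) (vscale V d x)"
    and vscale_vscale: "x \<in> carrier V \<Longrightarrow> vscale V c (vscale V d x) = vscale V (c * d) x"
    and vscale_one: "x \<in> carrier V \<Longrightarrow> vscale V 1 x = x"

definition linear_map ::
    "('v, 'm) cvec_scheme \<Rightarrow> ('w, 'n) cvec_scheme \<Rightarrow> ('v \<Rightarrow> 'w) \<Rightarrow> bool" where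
  "linear_map V W f \<longleftrightarrow>
     f \<in> carrier V \<rightarrow> carrier W \<and>
     (\<forall>x\<in>carrier V. \<forall>y\<in>carrier V. f (vadd V x y) = vadd W (f x) (f y)) \<and>
     (\<forall>c. \<forall>x\<in>carrier V. f (vscale V c x) = vscale W c (f x))"

inductive_set vspan :: "('v, 'm) cvec_scheme \<Rightarrow> 'v set \<Rightarrow> 'v set"
  for V :: "('v, 'm) cvec_scheme" and S :: "'v set"
  where
    zero: "vzero V \<in> vspan V S"
  | add: "\<lbrakk>x \<in> S; y \<in> vspan V S\<rbrakk> \<Longrightarrow> vadd V (vscale V c x) y \<in> vspan V S"

record 'a cstar_struct = "'a cvec" +
  cmult :: "'a \<Rightarrow> 'a \<Rightarrow> 'a"
  cadj :: "'a \<Rightarrow> 'a"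
  cnorm :: "'a \<Rightarrow> real"

locale cstar_alg = complex_vec D for D :: "('d, 'm) cstar_struct_scheme" +
  assumes cmult_closed: "\<lbrakk>x \<in> carrier D; y \<in> carrier D\<rbrakk> \<Longrightarrow> cmult D x y \<in> carrier D"
    and cmult_assoc: "\<lbrakk>x \<in> carrier D; y \<in> carrier D; z \<in> carrier D\<rbrakk>
      \<Longrightarrow> cmult D (cmult D x y) z = cmult D x (cmult D y z)"
    and cmult_add_left: "\<lbrakk>x \<in> carrier D; y \<in> carrier D; z \<in> carrier D\<rbrakk>
      \<Longrightarrow> cmult D (vadd D x y) z = vadd D (cmult D x z) (cmult D y z)"
    and cmult_add_right: "\<lbrakk>x \<in> carrier D; y \<in> carrier D; z \<in> carrier D\<rbrakk>
      \<Longrightarrow> cmult D x (vadd D y z) = vadd D (cmult D x y) (cmult D x z)"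
    and cmult_scale_left: "\<lbrakk>x \<in> carrier D; y \<in> carrier D\<rbrakk>
      \<Longrightarrow> cmult D (vscale D c x) y = vscale D c (cmult D x y)"
    and cmult_scale_right: "\<lbrakk>x \<in> carrier D; y \<in> carrier D\<rbrakk>
      \<Longrightarrow> cmult D x (vscale D c y) = vscale D c (cmult D x y)"
    and cadj_closed: "x \<in> carrier D \<Longrightarrow> cadj D x \<in> carrier D"
    and cadj_add: "\<lbrakk>x \<in> carrier D; y \<in> carrier D\<rbrakk>
      \<Longrightarrow> cadj D (vadd D x y) = vadd D (cadj D x) (cadj D y)"
    and cadj_scale: "x \<in> carrier D \<Longrightarrow> cadj D (vscale D c x) = vscale D (cnj c) (cadj D x)"
    and cadj_mult: "\<lbrakk>x \<in> carrier D; y \<in> carrier D\<rbrakk>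
      \<Longrightarrow> cadj D (cmult D x y) = cmult D (cadj D y) (cadj D x)"
    and cadj_cadj: "x \<in> carrier D \<Longrightarrow> cadj D (cadj D x) = x"
    and cnorm_nonneg: "x \<in> carrier D \<Longrightarrow> 0 \<le> cnorm D x"
    and cnorm_eq_zero: "x \<in> carrier D \<Longrightarrow> cnorm D x = 0 \<longleftrightarrow> x = vzero D"
    and cnorm_scale: "x \<in> carrier D \<Longrightarrow> cnorm D (vscale D c x) = cmod c * cnorm D x"
    and cnorm_triangle: "\<lbrakk>x \<in> carrier D; y \<in> carrier D\<rbrakk>
      \<Longrightarrow> cnorm D (vadd D x y) \<le> cnorm D x + cnorm D y"
    and cnorm_mult: "\<lbrakk>x \<in> carrier D; y \<in> carrier D\<rbrakk>
      \<Longrightarrow> cnorm D (cmult D x y) \<le> cnorm D x * cnorm D y"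
    and cnorm_cstar: "x \<in> carrier D \<Longrightarrow> cnorm D (cmult D (cadj D x) x) = (cnorm D x)\<^sup>2"
    and cnorm_complete: "\<lbrakk>\<And>n. f n \<in> carrier D;
        \<And>\<epsilon>. \<epsilon> > 0 \<Longrightarrow> \<exists>M. \<forall>m\<ge>M. \<forall>n\<ge>M. cnorm D (vdiff D (f m) (f n)) < \<epsilon>\<rbrakk>
      \<Longrightarrow> \<exists>l\<in>carrier D. (\<lambda>n. cnorm D (vdiff D (f n) l)) \<longlonglongrightarrow> 0"

definition cstar_of_type :: "'a::cstar_algebra cstar_struct" where
  "cstar_of_type = \<lparr>carrier = UNIV, vzero = 0, vadd = (+), vscale = scaleC,
     cmult = (*), cadj = adj, cnorm = norm\<rparr>"

lemma cstar_of_type_simps [simp]: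
  "carrier (cstar_of_type :: 'a::cstar_algebra cstar_struct) = UNIV"
  "vzero (cstar_of_type :: 'a cstar_struct) = 0"
  "vadd (cstar_of_type :: 'a cstar_struct) = (+)"
  "vscale (cstar_of_type :: 'a cstar_struct) = scaleC"
  "cmult (cstar_of_type :: 'a cstar_struct) = (*)"
  "cadj (cstar_of_type :: 'a cstar_struct) = adj"
  "cnorm (cstar_of_type :: 'a cstar_struct) = norm"
  by (simp_all add: cstar_of_type_def)

lemma scaleC_minus_one: "(-1) *\<^sub>C x = - (x :: 'a::cstar_algebra)"
  using scaleC_of_real[of "-1" x] by simp

lemma vdiff_cstar_of_type [simp]:
  "vdiff (cstar_of_type :: 'a::cstar_algebra cstar_struct) x y = x - y"
  by (simp add: vdiff_def scaleC_minus_one)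

lemma cstar_alg_cstar_of_type: "cstar_alg (cstar_of_type :: 'a::cstar_algebra cstar_struct)"
proof
  fix x :: 'a
  show "\<exists>y\<in>carrier cstar_of_type. vadd cstar_of_type x y = vzero cstar_of_type"
    by (auto intro: exI[of _ "- x"])
  show "vscale cstar_of_type 1 x = x"
    using scaleC_of_real[of 1 x] by simp
next
  fix f :: "nat \<Rightarrow> 'a"
  assume "\<And>\<epsilon>. \<epsilon> > 0 \<Longrightarrow>
    \<exists>M. \<forall>m\<ge>M. \<forall>n\<ge>M. cnorm cstar_of_type (vdiff cstar_of_type (f m) (f n)) < \<epsilon>"
  then have "Cauchy f"
    by (simp add: Cauchy_def dist_norm)
  then obtain l where "f \<longlonglongrightarrow> l"
    using Cauchy_convergent convergent_def by blast
  then show "\<exists>l\<in>carrier cstar_of_type.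
      (\<lambda>n. cnorm cstar_of_type (vdiff cstar_of_type (f n) l)) \<longlonglongrightarrow> 0"
    by (auto simp: tendsto_iff dist_norm)
qed (simp_all add: add.assoc add.commute scaleC_add_right scaleC_add_left scaleC_scaleC
    mult.assoc distrib_right distrib_left mult_scaleC_left mult_scaleC_right adj_add adj_scaleC
    adj_mult adj_adj norm_scaleC norm_triangle_ineq norm_mult_ineq cstar_identity)

definition star_hom ::
    "('a, 'm) cstar_struct_scheme \<Rightarrow> ('b, 'n) cstar_struct_scheme \<Rightarrow> ('a \<Rightarrow> 'b) \<Rightarrow> bool" where
  "star_hom A B f \<longleftrightarrow>
     linear_map A B f \<and>
     (\<forall>x\<in>carrier A. \<forall>y\<in>carrier A. f (cmult A x y) = cmult B (f x) (f y)) \<and>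
     (\<forall>x\<in>carrier A. f (cadj A x) = cadj B (f x))"

definition closed_star_subalgebra :: "'c::cstar_algebra set \<Rightarrow> bool" where
  "closed_star_subalgebra B \<longleftrightarrow>
     closed B \<and> 0 \<in> B \<and>
     (\<forall>x\<in>B. \<forall>y\<in>B. x + y \<in> B \<and> x * y \<in> B) \<and>
     (\<forall>x\<in>B. adj x \<in> B \<and> (\<forall>c. c *\<^sub>C x \<in> B))"


section \<open>Hilbert bimodules\<close>

record ('x, 'a) hbimod = "'x cvec" +
  hinner :: "'x \<Rightarrow> 'x \<Rightarrow> 'a"
  ract :: "'x \<Rightarrow> 'a \<Rightarrow> 'x"
  lact :: "'a \<Rightarrow> 'x \<Rightarrow> 'x"

definition hnorm :: "('x, 'a::cstar_algebra, 'm) hbimod_scheme \<Rightarrow> 'x \<Rightarrow> real" where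
  "hnorm X \<xi> = sqrt (norm (hinner X \<xi> \<xi>))"

locale hilbert_module = complex_vec X for X :: "('x, 'a::cstar_algebra, 'm) hbimod_scheme" +
  assumes ract_closed: "\<xi> \<in> carrier X \<Longrightarrow> ract X \<xi> a \<in> carrier X"
    and ract_add_left: "\<lbrakk>\<xi> \<in> carrier X; \<eta> \<in> carrier X\<rbrakk>
      \<Longrightarrow> ract X (vadd X \<xi> \<eta>) a = vadd X (ract X \<xi> a) (ract X \<eta> a)"
    and ract_add_right: "\<xi> \<in> carrier X
      \<Longrightarrow> ract X \<xi> (a + b) = vadd X (ract X \<xi> a) (ract X \<xi> b)"
    and ract_mult: "\<xi> \<in> carrier X \<Longrightarrow> ract X \<xi> (a * b) = ract X (ract X \<xi> a) b"
    and ract_scale_left: "\<xi> \<in> carrier X \<Longrightarrow> ract X (vscale X c \<xi>) a = vscale X c (ract X \<xi> a)"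
    and ract_scale_right: "\<xi> \<in> carrier X \<Longrightarrow> ract X \<xi> (c *\<^sub>C a) = vscale X c (ract X \<xi> a)"
    and hinner_add_right: "\<lbrakk>\<xi> \<in> carrier X; \<eta> \<in> carrier X; \<zeta> \<in> carrier X\<rbrakk>
      \<Longrightarrow> hinner X \<xi> (vadd X \<eta> \<zeta>) = hinner X \<xi> \<eta> + hinner X \<xi> \<zeta>"
    and hinner_scale_right: "\<lbrakk>\<xi> \<in> carrier X; \<eta> \<in> carrier X\<rbrakk>
      \<Longrightarrow> hinner X \<xi> (vscale X c \<eta>) = c *\<^sub>C hinner X \<xi> \<eta>"
    and hinner_ract: "\<lbrakk>\<xi> \<in> carrier X; \<eta> \<in> carrier X\<rbrakk>
      \<Longrightarrow> hinner X \<xi> (ract X \<eta> a) = hinner X \<xi> \<eta> * a"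
    and hinner_adj: "\<lbrakk>\<xi> \<in> carrier X; \<eta> \<in> carrier X\<rbrakk>
      \<Longrightarrow> adj (hinner X \<xi> \<eta>) = hinner X \<eta> \<xi>"
    and hinner_positive: "\<xi> \<in> carrier X \<Longrightarrow> \<exists>b. hinner X \<xi> \<xi> = adj b * b"
    and hinner_definite: "\<lbrakk>\<xi> \<in> carrier X; hinner X \<xi> \<xi> = 0\<rbrakk> \<Longrightarrow> \<xi> = vzero X"
    and hnorm_complete: "\<lbrakk>\<And>n. f n \<in> carrier X;
        \<And>\<epsilon>. \<epsilon> > 0 \<Longrightarrow> \<exists>M. \<forall>m\<ge>M. \<forall>n\<ge>M. hnorm X (vdiff X (f m) (f n)) < \<epsilon>\<rbrakk>
      \<Longrightarrow> \<exists>l\<in>carrier X. (\<lambda>n. hnorm X (vdiff X (f n) l)) \<longlonglongrightarrow> 0"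

definition is_adjoint ::
    "('x, 'a::cstar_algebra, 'm) hbimod_scheme \<Rightarrow> ('x \<Rightarrow> 'x) \<Rightarrow> ('x \<Rightarrow> 'x) \<Rightarrow> bool" where
  "is_adjoint X T S \<longleftrightarrow>
     S \<in> carrier X \<rightarrow>\<^sub>E carrier X \<and>
     (\<forall>\<xi>\<in>carrier X. \<forall>\<eta>\<in>carrier X. hinner X (T \<xi>) \<eta> = hinner X \<xi> (S \<eta>))"

text \<open>
  Operators are represented by extensional functions on the carrier. Adjointable operators are
  automatically linear and bounded; boundedness is recorded so that \<open>opnorm\<close> is visibly a
  supremum of a bounded set.
\<close>

definition adjointables :: "('x, 'a::cstar_algebra, 'm) hbimod_scheme \<Rightarrow> ('x \<Rightarrow> 'x) set" where
  "adjointables X =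
     {T \<in> carrier X \<rightarrow>\<^sub>E carrier X.
        (\<exists>S. is_adjoint X T S) \<and> (\<exists>M. \<forall>\<xi>\<in>carrier X. hnorm X (T \<xi>) \<le> M * hnorm X \<xi>)}"

definition opnorm :: "('x, 'a::cstar_algebra, 'm) hbimod_scheme \<Rightarrow> ('x \<Rightarrow> 'x) \<Rightarrow> real" where
  "opnorm X T = (SUP \<xi>\<in>{\<xi> \<in> carrier X. hnorm X \<xi> \<le> 1}. hnorm X (T \<xi>))"

definition L_alg :: "('x, 'a::cstar_algebra, 'm) hbimod_scheme \<Rightarrow> ('x \<Rightarrow> 'x) cstar_struct" where
  "L_alg X =
     \<lparr>carrier = adjointables X,
      vzero = (\<lambda>\<xi>\<in>carrier X. vzero X),
      vadd = (\<lambda>S T. \<lambda>\<xi>\<in>carrier X. vadd X (S \<xi>) (T \<xi>)),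
      vscale = (\<lambda>c T. \<lambda>\<xi>\<in>carrier X. vscale X c (T \<xi>)),
      cmult = (\<lambda>S T. compose (carrier X) S T),
      cadj = (\<lambda>T. THE S. is_adjoint X T S),
      cnorm = opnorm X\<rparr>"

definition rank_one :: "('x, 'a::cstar_algebra, 'm) hbimod_scheme \<Rightarrow> 'x \<Rightarrow> 'x \<Rightarrow> 'x \<Rightarrow> 'x" where
  "rank_one X \<xi> \<eta> = (\<lambda>\<zeta>\<in>carrier X. ract X \<xi> (hinner X \<eta> \<zeta>))"

definition compacts :: "('x, 'a::cstar_algebra, 'm) hbimod_scheme \<Rightarrow> ('x \<Rightarrow> 'x) set" where
  "compacts X =
     {T \<in> adjointables X. \<forall>\<epsilon>>0.
        \<exists>R\<in>vspan (L_alg X) {rank_one X \<xi> \<eta> |\<xi> \<eta>. \<xi> \<in> carrier X \<and> \<eta> \<in> carrier X}.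
          opnorm X (vdiff (L_alg X) T R) < \<epsilon>}"

definition K_alg :: "('x, 'a::cstar_algebra, 'm) hbimod_scheme \<Rightarrow> ('x \<Rightarrow> 'x) cstar_struct" where
  "K_alg X = (L_alg X)\<lparr>carrier := compacts X\<rparr>"

text \<open>
  \<open>lact X a\<close> is the operator by which \<open>a\<close> acts, hence extensional on the carrier. The left action
  is not assumed to be unital (nondegenerate).
\<close>

locale hilbert_bimodule = hilbert_module X for X :: "('x, 'a::cstar_algebra, 'm) hbimod_scheme" +
  assumes lact_star_hom: "star_hom cstar_of_type (L_alg X) (lact X)"

text \<open>
  \<open>is_tensor_product X Y Z \<tau>\<close>: the Hilbert bimodule \<open>Z\<close> with elementary tensors \<open>\<tau> \<xi> \<eta>\<close> is the
  (completed) balanced tensor product of \<open>X\<close> and \<open>Y\<close>. This determines \<open>(Z, \<tau>)\<close> up to a unique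
  isomorphism of bimodules, so a map \<open>\<mu> : X \<times> Y \<rightarrow> W\<close> extends to an isomorphism of the tensor
  product onto \<open>W\<close> exactly if \<open>is_tensor_product X Y W \<mu>\<close>.
\<close>

definition is_tensor_product ::
    "('x, 'a::cstar_algebra) hbimod \<Rightarrow> ('y, 'a) hbimod \<Rightarrow> ('z, 'a) hbimod
       \<Rightarrow> ('x \<Rightarrow> 'y \<Rightarrow> 'z) \<Rightarrow> bool" where
  "is_tensor_product X Y Z \<tau> \<longleftrightarrow>
     hilbert_bimodule Z \<and>
     (\<forall>\<xi>\<in>carrier X. linear_map Y Z (\<tau> \<xi>)) \<and>
     (\<forall>\<eta>\<in>carrier Y. linear_map X Z (\<lambda>\<xi>. \<tau> \<xi> \<eta>)) \<and>
     (\<forall>\<xi>\<in>carrier X. \<forall>\<eta>\<in>carrier Y. \<forall>a. \<tau> (ract X \<xi> a) \<eta> = \<tau> \<xi> (lact Y a \<eta>)) \<and>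
     (\<forall>\<xi>\<in>carrier X. \<forall>\<eta>\<in>carrier Y. \<forall>a. ract Z (\<tau> \<xi> \<eta>) a = \<tau> \<xi> (ract Y \<eta> a)) \<and>
     (\<forall>\<xi>\<in>carrier X. \<forall>\<eta>\<in>carrier Y. \<forall>a. lact Z a (\<tau> \<xi> \<eta>) = \<tau> (lact X a \<xi>) \<eta>) \<and>
     (\<forall>\<xi>\<^sub>1\<in>carrier X. \<forall>\<xi>\<^sub>2\<in>carrier X. \<forall>\<eta>\<^sub>1\<in>carrier Y. \<forall>\<eta>\<^sub>2\<in>carrier Y.
        hinner Z (\<tau> \<xi>\<^sub>1 \<eta>\<^sub>1) (\<tau> \<xi>\<^sub>2 \<eta>\<^sub>2) = hinner Y (lact Y (hinner X \<xi>\<^sub>2 \<xi>\<^sub>1) \<eta>\<^sub>1) \<eta>\<^sub>2) \<and>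
     (\<forall>\<zeta>\<in>carrier Z. \<forall>\<epsilon>>0.
        \<exists>\<omega>\<in>vspan Z {\<tau> \<xi> \<eta> |\<xi> \<eta>. \<xi> \<in> carrier X \<and> \<eta> \<in> carrier Y}.
          hnorm Z (vdiff Z \<zeta> \<omega>) < \<epsilon>)"


section \<open>Quasi-lattice ordered groups\<close>

definition ple :: "('g, 'm) monoid_scheme \<Rightarrow> 'g set \<Rightarrow> 'g \<Rightarrow> 'g \<Rightarrow> bool" where
  "ple G P s r \<longleftrightarrow> inv\<^bsub>G\<^esub> s \<otimes>\<^bsub>G\<^esub> r \<in> P"

definition joinable :: "('g, 'm) monoid_scheme \<Rightarrow> 'g set \<Rightarrow> 'g \<Rightarrow> 'g \<Rightarrow> bool" where
  "joinable G P s r \<longleftrightarrow> (\<exists>u\<in>P. ple G P s u \<and> ple G P r u)"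

definition is_join :: "('g, 'm) monoid_scheme \<Rightarrow> 'g set \<Rightarrow> 'g \<Rightarrow> 'g \<Rightarrow> 'g \<Rightarrow> bool" where
  "is_join G P s r t \<longleftrightarrow>
     t \<in> P \<and> ple G P s t \<and> ple G P r t \<and>
     (\<forall>u\<in>P. ple G P s u \<and> ple G P r u \<longrightarrow> ple G P t u)"

definition join :: "('g, 'm) monoid_scheme \<Rightarrow> 'g set \<Rightarrow> 'g \<Rightarrow> 'g \<Rightarrow> 'g" where
  "join G P s r = (THE t. is_join G P s r t)"

locale quasi_lattice_ordered = group G for G :: "('g, 'm) monoid_scheme" (structure) +
  fixes P :: "'g set"
  assumes P_subset: "P \<subseteq> carrier G"
    and P_mult: "\<lbrakk>s \<in> P; r \<in> P\<rbrakk> \<Longrightarrow> s \<otimes> r \<in> P"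
    and P_inv: "P \<inter> {inv s |s. s \<in> P} = {\<one>}"
    and join_exists: "\<lbrakk>s \<in> carrier G; r \<in> carrier G; joinable G P s r\<rbrakk>
      \<Longrightarrow> \<exists>t. is_join G P s r t"


section \<open>Product systems\<close>

text \<open>
  \<open>fib X s\<close> is the fibre over \<open>s\<close>, \<open>pmul X s r\<close> the product of the fibres over \<open>s\<close> and \<open>r\<close>, and
  \<open>emb X\<close> the identification of the coefficient algebra with the fibre over the unit.
\<close>

record ('g, 'x, 'a) prodsys =
  fib :: "'g \<Rightarrow> ('x, 'a) hbimod"
  pmul :: "'g \<Rightarrow> 'g \<Rightarrow> 'x \<Rightarrow> 'x \<Rightarrow> 'x"
  emb :: "'a \<Rightarrow> 'x"

locale product_system = quasi_lattice_ordered G P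
  for G :: "('g, 'm) monoid_scheme" (structure) and P :: "'g set" +
  fixes X :: "('g, 'x, 'a::cstar_algebra) prodsys"
  assumes fib_bimodule: "s \<in> P \<Longrightarrow> hilbert_bimodule (fib X s)"
    and emb_bij: "bij_betw (emb X) UNIV (carrier (fib X \<one>))"
    and emb_linear: "linear_map cstar_of_type (fib X \<one>) (emb X)"
    and emb_inner: "hinner (fib X \<one>) (emb X a) (emb X b) = adj a * b"
    and emb_ract: "ract (fib X \<one>) (emb X a) b = emb X (a * b)"
    and emb_lact: "lact (fib X \<one>) a (emb X b) = emb X (a * b)"
    and pmul_closed: "\<lbrakk>s \<in> P; r \<in> P; \<xi> \<in> carrier (fib X s); \<eta> \<in> carrier (fib X r)\<rbrakk>
      \<Longrightarrow> pmul X s r \<xi> \<eta> \<in> carrier (fib X (s \<otimes> r))"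
    and pmul_assoc: "\<lbrakk>s \<in> P; r \<in> P; q \<in> P;
        \<xi> \<in> carrier (fib X s); \<eta> \<in> carrier (fib X r); \<zeta> \<in> carrier (fib X q)\<rbrakk>
      \<Longrightarrow> pmul X (s \<otimes> r) q (pmul X s r \<xi> \<eta>) \<zeta> = pmul X s (r \<otimes> q) \<xi> (pmul X r q \<eta> \<zeta>)"
    and pmul_emb_left: "\<lbrakk>s \<in> P; \<xi> \<in> carrier (fib X s)\<rbrakk>
      \<Longrightarrow> pmul X \<one> s (emb X a) \<xi> = lact (fib X s) a \<xi>"
    and pmul_emb_right: "\<lbrakk>s \<in> P; \<xi> \<in> carrier (fib X s)\<rbrakk>
      \<Longrightarrow> pmul X s \<one> \<xi> (emb X a) = ract (fib X s) \<xi> a"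
    and pmul_tensor: "\<lbrakk>s \<in> P; r \<in> P; s \<noteq> \<one>; r \<noteq> \<one>\<rbrakk>
      \<Longrightarrow> is_tensor_product (fib X s) (fib X r) (fib X (s \<otimes> r)) (pmul X s r)"

text \<open>
  \<open>iota G X s t S\<close> is \<open>i\<^sub>s\<^sup>t(S)\<close> for \<open>t = s r\<close>. For \<open>s, r\<close> different from the unit,
  \<open>F(S \<otimes> I)F\<^sup>*\<close> is the adjointable operator with \<open>\<xi>\<eta> \<mapsto> (S\<xi>)\<eta>\<close>. An operator on the fibre over
  the unit is left multiplication by some \<open>a\<close>, which acts on the fibre over \<open>t\<close> by the left action.
\<close>

definition iota ::
    "('g, 'm) monoid_scheme \<Rightarrow> ('g, 'x, 'a::cstar_algebra) prodsys
       \<Rightarrow> 'g \<Rightarrow> 'g \<Rightarrow> ('x \<Rightarrow> 'x) \<Rightarrow> 'x \<Rightarrow> 'x" where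
  "iota G X s t S =
     (if t = s then S
      else if s = \<one>\<^bsub>G\<^esub> then lact (fib X t) (THE a. \<forall>b. S (emb X b) = emb X (a * b))
      else (THE R. R \<in> adjointables (fib X t) \<and>
        (\<forall>\<xi>\<in>carrier (fib X s). \<forall>\<eta>\<in>carrier (fib X (inv\<^bsub>G\<^esub> s \<otimes>\<^bsub>G\<^esub> t)).
           R (pmul X s (inv\<^bsub>G\<^esub> s \<otimes>\<^bsub>G\<^esub> t) \<xi> \<eta>) = pmul X s (inv\<^bsub>G\<^esub> s \<otimes>\<^bsub>G\<^esub> t) (S \<xi>) \<eta>)))"

definition iota_prod ::
    "('g, 'm) monoid_scheme \<Rightarrow> 'g set \<Rightarrow> ('g, 'x, 'a::cstar_algebra) prodsys
       \<Rightarrow> 'g \<Rightarrow> 'g \<Rightarrow> ('x \<Rightarrow> 'x) \<Rightarrow> ('x \<Rightarrow> 'x) \<Rightarrow> 'x \<Rightarrow> 'x" where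
  "iota_prod G P X s r S T =
     cmult (L_alg (fib X (join G P s r))) (iota G X s (join G P s r) S)
       (iota G X r (join G P s r) T)"

locale compactly_aligned_product_system = product_system G P X
  for G :: "('g, 'm) monoid_scheme" (structure) and P :: "'g set"
    and X :: "('g, 'x, 'a::cstar_algebra) prodsys" +
  assumes compactly_aligned: "\<lbrakk>s \<in> P; r \<in> P; joinable G P s r;
      S \<in> compacts (fib X s); T \<in> compacts (fib X r)\<rbrakk>
    \<Longrightarrow> iota_prod G P X s r S T \<in> compacts (fib X (join G P s r))"


section \<open>Nica covariant Toeplitz representations\<close>

definition toeplitz_rep ::
    "('g, 'm) monoid_scheme \<Rightarrow> 'g set \<Rightarrow> ('g, 'x, 'a::cstar_algebra) prodsys
       \<Rightarrow> 'd cstar_struct \<Rightarrow> ('g \<Rightarrow> 'x \<Rightarrow> 'd) \<Rightarrow> bool" where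
  "toeplitz_rep G P X D \<psi> \<longleftrightarrow>
     (\<forall>s\<in>P. linear_map (fib X s) D (\<psi> s)) \<and>
     star_hom cstar_of_type D (\<lambda>a. \<psi> \<one>\<^bsub>G\<^esub> (emb X a)) \<and>
     (\<forall>s\<in>P. \<forall>r\<in>P. \<forall>\<xi>\<in>carrier (fib X s). \<forall>\<eta>\<in>carrier (fib X r).
        cmult D (\<psi> s \<xi>) (\<psi> r \<eta>) = \<psi> (s \<otimes>\<^bsub>G\<^esub> r) (pmul X s r \<xi> \<eta>)) \<and>
     (\<forall>s\<in>P. \<forall>\<xi>\<in>carrier (fib X s). \<forall>\<eta>\<in>carrier (fib X s).
        cmult D (cadj D (\<psi> s \<xi>)) (\<psi> s \<eta>) = \<psi> \<one>\<^bsub>G\<^esub> (emb X (hinner (fib X s) \<xi> \<eta>)))"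

text \<open>
  Every Toeplitz representation \<open>\<psi>\<close> induces a unique *-homomorphism \<open>\<psi>\<^sup>(\<^sup>s\<^sup>)\<close> on the compact
  operators of each fibre. Its contractivity is automatic, as for all *-homomorphisms of C*-algebras;
  likewise the first condition in \<open>nica_covariant\<close> holds for every Toeplitz representation.
\<close>

definition is_induced ::
    "('g, 'x, 'a::cstar_algebra) prodsys \<Rightarrow> 'd cstar_struct \<Rightarrow> ('g \<Rightarrow> 'x \<Rightarrow> 'd)
       \<Rightarrow> 'g \<Rightarrow> (('x \<Rightarrow> 'x) \<Rightarrow> 'd) \<Rightarrow> bool" where
  "is_induced X D \<psi> s f \<longleftrightarrow>
     star_hom (K_alg (fib X s)) D f \<and>
     (\<forall>T\<in>compacts (fib X s). cnorm D (f T) \<le> opnorm (fib X s) T) \<and>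
     (\<forall>\<xi>\<in>carrier (fib X s). \<forall>\<eta>\<in>carrier (fib X s).
        f (rank_one (fib X s) \<xi> \<eta>) = cmult D (\<psi> s \<xi>) (cadj D (\<psi> s \<eta>)))"

definition induced_hom ::
    "('g, 'x, 'a::cstar_algebra) prodsys \<Rightarrow> 'd cstar_struct \<Rightarrow> ('g \<Rightarrow> 'x \<Rightarrow> 'd)
       \<Rightarrow> 'g \<Rightarrow> ('x \<Rightarrow> 'x) \<Rightarrow> 'd" where
  "induced_hom X D \<psi> s = (SOME f. is_induced X D \<psi> s f)"

definition nica_covariant ::
    "('g, 'm) monoid_scheme \<Rightarrow> 'g set \<Rightarrow> ('g, 'x, 'a::cstar_algebra) prodsys
       \<Rightarrow> 'd cstar_struct \<Rightarrow> ('g \<Rightarrow> 'x \<Rightarrow> 'd) \<Rightarrow> bool" where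
  "nica_covariant G P X D \<psi> \<longleftrightarrow>
     (\<forall>s\<in>P. \<exists>f. is_induced X D \<psi> s f) \<and>
     (\<forall>s\<in>P. \<forall>r\<in>P. \<forall>S\<in>compacts (fib X s). \<forall>T\<in>compacts (fib X r).
        cmult D (induced_hom X D \<psi> s S) (induced_hom X D \<psi> r T) =
          (if joinable G P s r
           then induced_hom X D \<psi> (join G P s r) (iota_prod G P X s r S T)
           else vzero D))"

text \<open>
  HOL cannot quantify over all types inside a formula, so the universal property below is stated
  for C*-algebras whose carrier is a set of elements of one sufficiently large type. If \<open>D\<close> is
  generated by a representation of a product system with index type \<open>'g\<close> and element type \<open>'x\<close>,
  each element of \<open>D\<close> is the limit of a sequence of *-polynomials in the represented elements;
  the flag in a letter says whether its adjoint is taken. Choosing one such sequence for each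
  element embeds \<open>D\<close> into the type \<open>universe\<close>. So no representation, in a C*-algebra over
  any type, is lost: replace its codomain by the C*-subalgebra it generates.
\<close>

type_synonym ('g, 'x) universe = "nat \<Rightarrow> (complex \<times> ('g \<times> 'x \<times> bool) list) list"

definition is_nica_toeplitz_algebra ::
    "('g, 'm) monoid_scheme \<Rightarrow> 'g set \<Rightarrow> ('g, 'x, 'a::cstar_algebra) prodsys
       \<Rightarrow> ('g \<Rightarrow> 'x \<Rightarrow> 'c::cstar_algebra) \<Rightarrow> bool" where
  "is_nica_toeplitz_algebra G P X i \<longleftrightarrow>
     toeplitz_rep G P X cstar_of_type i \<and>
     nica_covariant G P X cstar_of_type i \<and>
     (\<forall>B. closed_star_subalgebra B \<and> (\<forall>s\<in>P. \<forall>\<xi>\<in>carrier (fib X s). i s \<xi> \<in> B) \<longrightarrow> B = UNIV) \<and>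
     (\<forall>(D :: ('g, 'x) universe cstar_struct) \<psi>.
        cstar_alg D \<and> toeplitz_rep G P X D \<psi> \<and> nica_covariant G P X D \<psi> \<longrightarrow>
        (\<exists>\<pi>. star_hom cstar_of_type D \<pi> \<and>
           (\<forall>s\<in>P. \<forall>\<xi>\<in>carrier (fib X s). \<pi> (i s \<xi>) = \<psi> s \<xi>)))"

definition core ::
    "'g set \<Rightarrow> ('g, 'x, 'a::cstar_algebra) prodsys \<Rightarrow> ('g \<Rightarrow> 'x \<Rightarrow> 'c::cstar_algebra) \<Rightarrow> 'c set" where
  "core P X i = closure (vspan cstar_of_type
     {i s \<xi> * adj (i s \<eta>) |s \<xi> \<eta>. s \<in> P \<and> \<xi> \<in> carrier (fib X s) \<and> \<eta> \<in> carrier (fib X s)})"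

definition core_fibre ::
    "('g, 'x, 'a::cstar_algebra) prodsys \<Rightarrow> ('g \<Rightarrow> 'x \<Rightarrow> 'c::cstar_algebra) \<Rightarrow> 'g \<Rightarrow> 'c set" where
  "core_fibre X i s = induced_hom X cstar_of_type i s ` compacts (fib X s)"

definition conditional_expectation :: "'c::cstar_algebra set \<Rightarrow> ('c \<Rightarrow> 'c) \<Rightarrow> bool" where
  "conditional_expectation F \<Phi> \<longleftrightarrow>
     linear_map cstar_of_type cstar_of_type \<Phi> \<and>
     (\<forall>x. \<Phi> x \<in> F) \<and> (\<forall>x\<in>F. \<Phi> x = x) \<and>
     (\<forall>x. norm (\<Phi> x) \<le> norm x) \<and>
     (\<forall>x. \<exists>b\<in>F. \<Phi> (adj x * x) = adj b * b) \<and>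
     (\<forall>x. \<forall>a\<in>F. \<forall>b\<in>F. \<Phi> (a * x * b) = a * \<Phi> x * b)"

definition core_expectation ::
    "'g set \<Rightarrow> ('g, 'x, 'a::cstar_algebra) prodsys \<Rightarrow> ('g \<Rightarrow> 'x \<Rightarrow> 'c::cstar_algebra)
       \<Rightarrow> ('c \<Rightarrow> 'c) \<Rightarrow> bool" where
  "core_expectation P X i \<Phi> \<longleftrightarrow>
     conditional_expectation (core P X i) \<Phi> \<and>
     (\<forall>s\<in>P. \<forall>r\<in>P. \<forall>\<xi>\<in>carrier (fib X s). \<forall>\<eta>\<in>carrier (fib X r).
        \<Phi> (i s \<xi> * adj (i r \<eta>)) = (if s = r then i s \<xi> * adj (i r \<eta>) else 0))"


section \<open>Dynamics, states and ground states\<close>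

definition dynamics :: "(real \<Rightarrow> 'c::cstar_algebra \<Rightarrow> 'c) \<Rightarrow> bool" where
  "dynamics \<sigma> \<longleftrightarrow>
     (\<forall>t. star_hom cstar_of_type cstar_of_type (\<sigma> t) \<and> bij (\<sigma> t)) \<and>
     \<sigma> 0 = id \<and> (\<forall>s t. \<sigma> (s + t) = \<sigma> s \<circ> \<sigma> t) \<and>
     (\<forall>c. continuous_on UNIV (\<lambda>t. \<sigma> t c))"

definition gauge_dynamics ::
    "('g, 'm) monoid_scheme \<Rightarrow> 'g set \<Rightarrow> ('g, 'x, 'a::cstar_algebra) prodsys
       \<Rightarrow> ('g \<Rightarrow> 'x \<Rightarrow> 'c::cstar_algebra) \<Rightarrow> ('g \<Rightarrow> real) \<Rightarrow> (real \<Rightarrow> 'c \<Rightarrow> 'c) \<Rightarrow> bool" where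
  "gauge_dynamics G P X i N \<sigma> \<longleftrightarrow>
     dynamics \<sigma> \<and>
     (\<forall>t a. \<sigma> t (i \<one>\<^bsub>G\<^esub> (emb X a)) = i \<one>\<^bsub>G\<^esub> (emb X a)) \<and>
     (\<forall>t. \<forall>s\<in>P. \<forall>\<xi>\<in>carrier (fib X s).
        \<sigma> t (i s \<xi>) = (complex_of_real (N s) powr (\<i> * complex_of_real t)) *\<^sub>C i s \<xi>)"

definition entire_fun :: "(complex \<Rightarrow> 'c::cstar_algebra) \<Rightarrow> bool" where
  "entire_fun f \<longleftrightarrow> (\<forall>z. \<exists>l. ((\<lambda>h. inverse h *\<^sub>C (f (z + h) - f z)) \<longlongrightarrow> l) (at 0))"

text \<open>The entire extension of an orbit is unique; its value at \<open>z\<close> is written \<open>\<sigma>\<^sub>z(c)\<close>.\<close>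

definition is_entire_extension ::
    "(real \<Rightarrow> 'c::cstar_algebra \<Rightarrow> 'c) \<Rightarrow> 'c \<Rightarrow> (complex \<Rightarrow> 'c) \<Rightarrow> bool" where
  "is_entire_extension \<sigma> c f \<longleftrightarrow> entire_fun f \<and> (\<forall>t. f (complex_of_real t) = \<sigma> t c)"

definition analytic_element :: "(real \<Rightarrow> 'c::cstar_algebra \<Rightarrow> 'c) \<Rightarrow> 'c \<Rightarrow> bool" where
  "analytic_element \<sigma> c \<longleftrightarrow> (\<exists>f. is_entire_extension \<sigma> c f)"

text \<open>
  States of the C*-subalgebra \<open>F\<close>: positive linear functionals of norm exactly one. They are
  extensional functions, so that equality is equality of functionals on \<open>F\<close>.
\<close>

definition states :: "'c::cstar_algebra set \<Rightarrow> ('c \<Rightarrow> complex) set" where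
  "states F =
     {\<phi> \<in> extensional F.
        (\<forall>x\<in>F. \<forall>y\<in>F. \<phi> (x + y) = \<phi> x + \<phi> y) \<and>
        (\<forall>c. \<forall>x\<in>F. \<phi> (c *\<^sub>C x) = c * \<phi> x) \<and>
        (\<forall>x\<in>F. \<phi> (adj x * x) \<in> \<real>\<^sub>\<ge>\<^sub>0) \<and>
        (\<forall>x\<in>F. cmod (\<phi> x) \<le> norm x) \<and>
        (\<forall>k<1. \<exists>x\<in>F. norm x \<le> 1 \<and> k < cmod (\<phi> x))}"

definition ground_states ::
    "(real \<Rightarrow> 'c::cstar_algebra \<Rightarrow> 'c) \<Rightarrow> ('c \<Rightarrow> complex) set" where
  "ground_states \<sigma> =
     {\<omega> \<in> states UNIV.
        \<forall>c d f. analytic_element \<sigma> c \<and> is_entire_extension \<sigma> d f \<longrightarrow>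
          (\<exists>M. \<forall>z. Im z > 0 \<longrightarrow> cmod (\<omega> (c * f z)) \<le> M)}"

definition convex_comb ::
    "'c set \<Rightarrow> real \<Rightarrow> ('c \<Rightarrow> complex) \<Rightarrow> ('c \<Rightarrow> complex) \<Rightarrow> 'c \<Rightarrow> complex" where
  "convex_comb F t \<phi> \<phi>' = (\<lambda>x\<in>F. complex_of_real t * \<phi> x + complex_of_real (1 - t) * \<phi>' x)"

text \<open>
  \<open>S\<close> and \<open>S'\<close> are convex sets of functionals on \<open>F\<close> and \<open>F'\<close>, respectively, and \<open>h\<close> is an
  affine bijection between them.
\<close>

definition affine_isomorphism ::
    "'c set \<Rightarrow> ('c \<Rightarrow> complex) set \<Rightarrow> 'd set \<Rightarrow> ('d \<Rightarrow> complex) set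
       \<Rightarrow> (('c \<Rightarrow> complex) \<Rightarrow> 'd \<Rightarrow> complex) \<Rightarrow> bool" where
  "affine_isomorphism F S F' S' h \<longleftrightarrow>
     bij_betw h S S' \<and>
     (\<forall>t\<in>{0..1}. \<forall>\<phi>\<in>S. \<forall>\<phi>'\<in>S. convex_comb F t \<phi> \<phi>' \<in> S) \<and>
     (\<forall>t\<in>{0..1}. \<forall>\<omega>\<in>S'. \<forall>\<omega>'\<in>S'. convex_comb F' t \<omega> \<omega>' \<in> S') \<and>
     (\<forall>t\<in>{0..1}. \<forall>\<phi>\<in>S. \<forall>\<phi>'\<in>S.
        h (convex_comb F t \<phi> \<phi>') = convex_comb F' t (h \<phi>) (h \<phi>'))"

end

theory Submission
  imports Defs "HOL-Complex_Analysis.Conformal_Mappings"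
begin

text \<open>
  Nica covariance and compact alignment put \<open>i\<^sub>r(\<eta>)\<^sup>*i\<^sub>t(\<zeta>)\<close> into the closed span of the elements
  \<open>i\<^sub>u(\<alpha>)i\<^sub>v(\<beta>)\<^sup>*\<close> with \<open>ru = tv\<close>, because \<open>\<eta>\<close> is a limit of vectors \<open>\<theta>\<^sub>\<eta>\<^sub>,\<^sub>\<eta>(\<eta>')\<close>. Hence the elements
  \<open>i\<^sub>s(\<xi>)i\<^sub>r(\<eta>)\<^sup>*\<close> span a dense subspace, on which \<open>\<sigma>\<^sub>z\<close> multiplies by \<open>(N(s)/N(r))\<^sup>i\<^sup>z\<close>.
  If \<open>\<omega>\<close> is a ground state and \<open>r \<noteq> e\<close>, boundedness of \<open>z \<mapsto> \<omega>(i\<^sub>s(\<xi>)\<sigma>\<^sub>z(i\<^sub>r(\<eta>)\<^sup>*))\<close> forces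
  \<open>\<omega>(i\<^sub>s(\<xi>)i\<^sub>r(\<eta>)\<^sup>*) = 0\<close>; so \<open>\<omega>\<close> factors through the expectation and vanishes on \<open>B\<^sub>r\<close>. Conversely,
  if \<open>\<omega> = \<phi> \<circ> \<Phi>\<close> and \<open>\<phi>\<close> vanishes on \<open>B\<^sub>r\<close>, then the Cauchy-Schwarz inequality kills
  \<open>\<omega>(c i\<^sub>s(\<xi>)i\<^sub>r(\<eta>)\<^sup>*)\<close> for \<open>r \<noteq> e\<close>, and for \<open>r = e\<close> the factor \<open>N(s)\<^sup>i\<^sup>z\<close> is bounded on the upper half-plane.
  All states involved take the value \<open>1\<close> at \<open>i\<^sub>e(1)\<close>, which makes them convex sets although the algebra
  need not be unital.
\<close>

section \<open>Elementary C*-algebra theory\<close>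

text \<open>Three obstacles shape the proof. First, the approximation of \<open>\<eta>\<close> by
  \<open>\<theta>\<^sub>\<eta>\<^sub>,\<^sub>\<eta>(\<eta>')\<close>, the contractivity of
  *-homomorphisms and the bounds in Hilbert modules rest on the order of a possibly nonunital
  C*-algebra. Positivity is therefore a norm inequality in a unitization, and square roots come from
  an iteration; no spectrum occurs. Second, the ground state condition ranges over all analytic
  \<open>d\<close>, whereas \<open>\<sigma>\<^sub>z\<close> is explicit only on the span of the
  generators. Norm approximation of \<open>d\<close> controls the orbit on the real line but not
  above it; maximum modulus arguments on strips carry the estimate into the upper half-plane. Third,
  \<open>i\<^sub>e(1)\<close> is a projection and a right unit for every
  \<open>i\<^sub>s(\<xi>)\<close>, but the left action may be degenerate, so it need not be a left
  unit. Ground states do not see the difference, since they vanish on every spanning element outside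
  the unit fibre; together with norm one this forces the value 1 at
  \<open>i\<^sub>e(1)\<close>.\<close>

lemma scaleC_minus_right: "c *\<^sub>C (- x) = - (c *\<^sub>C (x :: 'a::cstar_algebra))"
  by (metis scaleC_minus_one scaleC_scaleC mult.commute)

lemma scaleC_diff_right: "c *\<^sub>C (x - y) = c *\<^sub>C x - c *\<^sub>C (y :: 'a::cstar_algebra)"
  by (metis diff_conv_add_uminus scaleC_add_right scaleC_minus_right)

lemma scaleC_one [simp]: "1 *\<^sub>C (x :: 'a::cstar_algebra) = x"
  using scaleC_of_real[of 1 x] by simp

lemma scaleC_zero_left [simp]: "0 *\<^sub>C (x :: 'a::cstar_algebra) = 0"
  using scaleC_of_real[of 0 x] by simp

lemma scaleC_zero_right [simp]: "c *\<^sub>C (0 :: 'a::cstar_algebra) = 0"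
  using scaleC_add_right[of c 0 0] by simp

lemma scaleC_minus_left: "(- c) *\<^sub>C x = - (c *\<^sub>C (x :: 'a::cstar_algebra))"
  by (metis mult_minus1 scaleC_minus_one scaleC_scaleC)

lemma scaleC_diff_left: "(c - d) *\<^sub>C x = c *\<^sub>C x - d *\<^sub>C (x :: 'a::cstar_algebra)"
  by (metis diff_conv_add_uminus scaleC_add_left scaleC_minus_left)

lemma scaleC_scaleR_commute: "c *\<^sub>C (r *\<^sub>R x) = r *\<^sub>R (c *\<^sub>C (x :: 'a::cstar_algebra))"
  by (metis mult.commute scaleC_of_real scaleC_scaleC)

lemma scaleC_scaleR_left: "(r *\<^sub>R c) *\<^sub>C x = r *\<^sub>R (c *\<^sub>C (x :: 'a::cstar_algebra))"
  by (metis scaleC_of_real scaleC_scaleC scaleR_conv_of_real)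

lemmas scaleC_simps = scaleC_add_left scaleC_add_right scaleC_diff_left scaleC_diff_right
  scaleC_minus_left scaleC_minus_right scaleC_scaleC mult_scaleC_left mult_scaleC_right
  scaleC_scaleR_commute scaleC_scaleR_left

lemma bounded_linear_scaleC: "bounded_linear (\<lambda>x :: 'a::cstar_algebra. c *\<^sub>C x)"
  by (rule bounded_linear_intro[where K = "cmod c"])
    (simp_all add: scaleC_add_right scaleC_scaleR_commute norm_scaleC mult.commute)

lemma adj_zero [simp]: "adj (0 :: 'a::cstar_algebra) = 0"
  using adj_add[of 0 0] by simp

lemma adj_minus: "adj (- x) = - adj (x :: 'a::cstar_algebra)"
  by (metis add.right_inverse adj_add adj_zero neg_eq_iff_add_eq_0)

lemma adj_diff: "adj (x - y) = adj x - adj (y :: 'a::cstar_algebra)"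
  by (metis adj_add adj_minus diff_conv_add_uminus)

lemma adj_scaleR: "adj (r *\<^sub>R x) = r *\<^sub>R adj (x :: 'a::cstar_algebra)"
  by (metis adj_scaleC complex_cnj_complex_of_real scaleC_of_real)

lemma norm_adj [simp]: "norm (adj x) = norm (x :: 'a::cstar_algebra)"
proof -
  have le: "norm y \<le> norm (adj y)" for y :: 'a
  proof (cases "y = 0")
    case False
    have "norm y * norm y \<le> norm (adj y) * norm y"
      using norm_mult_ineq[of "adj y" y] cstar_identity[of y] by (simp add: power2_eq_square)
    with False show ?thesis by simp
  qed simp
  from le[of x] le[of "adj x"] show ?thesis by (simp add: adj_adj)
qed

lemma bounded_linear_adj: "bounded_linear (adj :: 'a::cstar_algebra \<Rightarrow> 'a)"
  by (rule bounded_linear_intro[where K = 1]) (simp_all add: adj_add adj_scaleR)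

lemma adj_mult_self_eq_zero: "adj x * x = 0 \<longleftrightarrow> (x :: 'a::cstar_algebra) = 0"
  using cstar_identity[of x] by auto

lemma star_hom_cstarD:
  assumes "star_hom cstar_of_type cstar_of_type (f :: 'a::cstar_algebra \<Rightarrow> 'b::cstar_algebra)"
  shows "f (x + y) = f x + f y" "f (c *\<^sub>C x) = c *\<^sub>C f x" "f (x * y) = f x * f y"
    "f (adj x) = adj (f x)" "f 0 = 0" "f (r *\<^sub>R x) = r *\<^sub>R f x" "f (x - y) = f x - f y"
proof -
  show add: "f (x + y) = f x + f y" for x y using assms by (simp add: star_hom_def linear_map_def)
  show scale: "f (c *\<^sub>C x) = c *\<^sub>C f x" for c x using assms by (simp add: star_hom_def linear_map_def)
  show "f (x * y) = f x * f y" "f (adj x) = adj (f x)" using assms by (simp_all add: star_hom_def)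
  show "f 0 = 0" using scale[of 0 0] by simp
  show "f (r *\<^sub>R x) = r *\<^sub>R f x" by (metis scale scaleC_of_real)
  show "f (x - y) = f x - f y" by (metis add scale diff_conv_add_uminus scaleC_minus_one)
qed


subsection \<open>Square roots\<close>

text \<open>Fixed-point iteration for \<open>z = (y + z * z) / 2\<close>. The iterates are
  polynomials in \<open>y\<close> with nonnegative coefficients and no constant term: no unit is
  involved, and the same recursion run at the real number 1 majorises them in norm.\<close>

primrec sqrt_iter :: "'a::real_normed_algebra \<Rightarrow> nat \<Rightarrow> 'a" where
  "sqrt_iter y 0 = 0"
| "sqrt_iter y (Suc n) = (1/2) *\<^sub>R (y + sqrt_iter y n * sqrt_iter y n)"

lemma sqrt_iter_one_bounds: "0 \<le> sqrt_iter (1::real) n \<and> sqrt_iter (1::real) n \<le> 1"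
proof (induction n)
  case (Suc n)
  then have "sqrt_iter (1::real) n * sqrt_iter 1 n \<le> 1 * 1" by (intro mult_mono) auto
  with Suc show ?case by auto
qed simp

lemma sqrt_iter_commute:
  "x * y = y * x \<Longrightarrow> x * sqrt_iter y n = sqrt_iter y n * x"
proof (induction n)
  case (Suc n)
  have "x * (sqrt_iter y n * sqrt_iter y n) = sqrt_iter y n * sqrt_iter y n * x"
    by (metis Suc mult.assoc)
  with Suc show ?case by (simp add: algebra_simps)
qed simp

lemma sqrt_iter_norm:
  assumes "norm y \<le> 1"
  shows "norm (sqrt_iter y n) \<le> sqrt_iter 1 n"
proof (induction n)
  case (Suc n)
  have "norm (y + sqrt_iter y n * sqrt_iter y n) \<le> norm y + norm (sqrt_iter y n) * norm (sqrt_iter y n)"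
    by (meson norm_triangle_le norm_mult_ineq add_left_mono)
  also have "\<dots> \<le> 1 + sqrt_iter 1 n * sqrt_iter 1 n"
    using Suc assms sqrt_iter_one_bounds[of n] by (intro add_mono mult_mono) auto
  finally show ?case by simp
qed simp

text \<open>The iterates commute, so consecutive differences factor as
  \<open>(a + b) * (a - b) / 2\<close>. The scalar iterates factor in the same way, and the majorant
  passes from one difference to the next.\<close>

lemma sqrt_iter_diff_norm:
  assumes "norm y \<le> 1"
  shows "norm (sqrt_iter y (Suc n) - sqrt_iter y n) \<le> sqrt_iter 1 (Suc n) - sqrt_iter 1 n"
proof (induction n)
  case 0
  then show ?case using assms by simp
next
  case (Suc n)
  define a b where "a = sqrt_iter y (Suc n)" and "b = sqrt_iter y n"
  define p q where "p = sqrt_iter (1::real) (Suc n)" and "q = sqrt_iter (1::real) n"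
  have comm: "a * b = b * a"
    unfolding a_def b_def by (rule sqrt_iter_commute) (rule sqrt_iter_commute[symmetric], rule refl)
  have "sqrt_iter y (Suc (Suc n)) - a = (1/2) *\<^sub>R (y + a * a) - (1/2) *\<^sub>R (y + b * b)"
    by (simp add: a_def b_def)
  also have "\<dots> = (1/2) *\<^sub>R ((a + b) * (a - b))"
    by (simp add: algebra_simps comm)
  finally have "norm (sqrt_iter y (Suc (Suc n)) - a) = 1/2 * norm ((a + b) * (a - b))"
    by simp
  also have "\<dots> \<le> 1/2 * (norm (a + b) * norm (a - b))"
    by (intro mult_left_mono norm_mult_ineq) simp
  also have "\<dots> \<le> 1/2 * ((p + q) * (p - q))"
  proof -
    have "norm (a + b) \<le> p + q"
      unfolding a_def b_def p_def q_def
      by (intro norm_triangle_le add_mono sqrt_iter_norm assms)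
    moreover have "norm (a - b) \<le> p - q"
      using Suc by (simp only: a_def b_def p_def q_def)
    ultimately show ?thesis by (intro mult_left_mono mult_mono) (auto intro: order_trans[of 0 "norm (a + b)"])
  qed
  also have "\<dots> = sqrt_iter 1 (Suc (Suc n)) - p"
    unfolding sqrt_iter.simps(2)[of _ "Suc n"] p_def[symmetric]
    by (simp add: p_def q_def algebra_simps)
  finally show ?case by (simp only: a_def p_def)
qed

text \<open>The real iterates at 1 increase and stay below 1, hence converge; telescoping the
  majorant of the differences transfers the Cauchy property.\<close>

lemma sqrt_iter_Cauchy:
  fixes y :: "'a::real_normed_algebra"
  assumes "norm y \<le> 1"
  shows "Cauchy (sqrt_iter y)"
proof -
  let ?r = "sqrt_iter (1::real)"
  have inc: "incseq ?r"
  proof (rule incseq_SucI)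
    show "?r n \<le> ?r (Suc n)" for n
      using order_trans[OF norm_ge_zero sqrt_iter_diff_norm[of "1::real" n]] by simp
  qed
  have conv: "Cauchy ?r"
    by (intro convergent_Cauchy Bseq_monoseq_convergent BseqI'[where K = 1] incseq_imp_monoseq inc)
      (use sqrt_iter_one_bounds in \<open>simp add: abs_le_iff\<close>)
  have step: "norm (sqrt_iter y (n + k) - sqrt_iter y n) \<le> ?r (n + k) - ?r n" for n k
  proof (induction k)
    case (Suc k)
    have "norm (sqrt_iter y (n + Suc k) - sqrt_iter y n) \<le>
        norm (sqrt_iter y (Suc (n + k)) - sqrt_iter y (n + k)) + norm (sqrt_iter y (n + k) - sqrt_iter y n)"
      by (metis norm_triangle_ineq add_Suc_right diff_add_cancel add_diff_eq)
    then show ?case using Suc sqrt_iter_diff_norm[OF assms, of "n + k"] by simp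
  qed simp
  have bound: "norm (sqrt_iter y m - sqrt_iter y n) \<le> \<bar>?r m - ?r n\<bar>" for m n
  proof (cases "n \<le> m")
    case True
    then show ?thesis using step[of n "m - n"] by simp
  next
    case False
    then show ?thesis using step[of m "n - m"] by (simp add: norm_minus_commute)
  qed
  show ?thesis
    unfolding Cauchy_iff
  proof (intro allI impI)
    fix e :: real
    assume "0 < e"
    with conv obtain M where "\<And>m n. m \<ge> M \<Longrightarrow> n \<ge> M \<Longrightarrow> \<bar>?r m - ?r n\<bar> < e"
      unfolding Cauchy_iff real_norm_def by blast
    with bound show "\<exists>M. \<forall>m\<ge>M. \<forall>n\<ge>M. norm (sqrt_iter y m - sqrt_iter y n) < e"
      by (meson order_le_less_trans)
  qed
qed

text \<open>The element \<open>z\<close> plays the role of \<open>1 - sqrt (1 - y)\<close>, but needs no unit.\<close>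

lemma half_quadratic_solution:
  fixes y :: "'a::cstar_algebra"
  assumes "norm y \<le> 1" and "adj y = y"
  obtains z where "z + z = y + z * z" and "adj z = z" and "norm z \<le> 1"
    and "\<And>x. x * y = y * x \<Longrightarrow> x * z = z * x"
proof -
  obtain z where lim: "sqrt_iter y \<longlonglongrightarrow> z"
    using sqrt_iter_Cauchy[OF assms(1)] Cauchy_convergent convergent_def by blast
  have 1: "(\<lambda>n. sqrt_iter y (Suc n)) \<longlonglongrightarrow> (1/2) *\<^sub>R (y + z * z)"
    unfolding sqrt_iter.simps by (intro tendsto_intros lim)
  have "z = (1/2) *\<^sub>R (y + z * z)"
    using LIMSEQ_unique[OF LIMSEQ_Suc[OF lim] 1] .
  then have "2 *\<^sub>R z = 2 *\<^sub>R ((1/2) *\<^sub>R (y + z * z))" by (rule arg_cong)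
  then have quad: "z + z = y + z * z" by (simp add: scaleR_2)
  have sa: "adj (sqrt_iter y n) = sqrt_iter y n" for n
    by (induction n) (simp_all add: adj_scaleR adj_add adj_mult assms(2))
  have adjz: "adj z = z"
    using LIMSEQ_unique[OF bounded_linear.tendsto[OF bounded_linear_adj lim]] lim by (simp add: sa)
  have nz: "norm z \<le> 1"
  proof (rule LIMSEQ_le_const2[OF tendsto_norm[OF lim]], intro exI allI impI)
    show "norm (sqrt_iter y n) \<le> 1" for n
      using order_trans[OF sqrt_iter_norm[OF assms(1)]] sqrt_iter_one_bounds by blast
  qed
  have "x * z = z * x" if "x * y = y * x" for x
  proof -
    have 2: "(\<lambda>n. x * sqrt_iter y n) \<longlonglongrightarrow> x * z" "(\<lambda>n. sqrt_iter y n * x) \<longlonglongrightarrow> z * x"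
      by (intro tendsto_intros lim)+
    then show ?thesis by (intro LIMSEQ_unique[OF 2(1)]) (simp add: sqrt_iter_commute[OF that])
  qed
  with quad adjz nz show ?thesis by (rule that)
qed


subsection \<open>Unitization\<close>

text \<open>The coordinate \<open>uscal\<close> in the norm keeps it definite when the algebra is already unital.\<close>

datatype 'a unitization = Unitize (uscal: complex) (uelem: 'a)

lemma unitization_eqI: "uscal u = uscal v \<Longrightarrow> uelem u = uelem v \<Longrightarrow> u = v"
  by (cases u; cases v) simp

instantiation unitization :: (cstar_algebra) real_algebra_1
begin

definition "0 = Unitize 0 0"
definition "1 = Unitize 1 0"
definition "u + v = Unitize (uscal u + uscal v) (uelem u + uelem v)"
definition "u - v = Unitize (uscal u - uscal v) (uelem u - uelem v)"
definition "- u = Unitize (- uscal u) (- uelem u)"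
definition "u * v = Unitize (uscal u * uscal v)
  (uscal u *\<^sub>C uelem v + uscal v *\<^sub>C uelem u + uelem u * uelem v)"
definition "r *\<^sub>R u = Unitize (r *\<^sub>R uscal u) (r *\<^sub>R uelem u)"

lemma unitization_simps [simp]:
  "uscal (0 :: 'a unitization) = 0" "uelem (0 :: 'a unitization) = 0"
  "uscal (1 :: 'a unitization) = 1" "uelem (1 :: 'a unitization) = 0"
  "uscal (u + v :: 'a unitization) = uscal u + uscal v"
  "uelem (u + v :: 'a unitization) = uelem u + uelem v"
  "uscal (u - v :: 'a unitization) = uscal u - uscal v"
  "uelem (u - v :: 'a unitization) = uelem u - uelem v"
  "uscal (- u :: 'a unitization) = - uscal u" "uelem (- u :: 'a unitization) = - uelem u"
  "uscal (u * v :: 'a unitization) = uscal u * uscal v"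
  "uelem (u * v :: 'a unitization) =
     uscal u *\<^sub>C uelem v + uscal v *\<^sub>C uelem u + uelem u * uelem v"
  "uscal (r *\<^sub>R u :: 'a unitization) = r *\<^sub>R uscal u"
  "uelem (r *\<^sub>R u :: 'a unitization) = r *\<^sub>R uelem u"
  by (simp_all add: zero_unitization_def one_unitization_def plus_unitization_def
      minus_unitization_def uminus_unitization_def times_unitization_def scaleR_unitization_def)

instance
proof
  show "(0 :: 'a unitization) \<noteq> 1"
    by (simp add: zero_unitization_def one_unitization_def)
qed (rule unitization_eqI; simp add: algebra_simps scaleC_simps)+

end

text \<open>The unitization acting by left multiplication on the original algebra, viewed as an
  ideal. The operator norm of this action is the source of the C*-norm.\<close>

definition uact :: "'a::cstar_algebra unitization \<Rightarrow> 'a \<Rightarrow> 'a" where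
  "uact u x = uscal u *\<^sub>C x + uelem u * x"

lemma bounded_linear_uact: "bounded_linear (uact u)"
  unfolding uact_def
  by (intro bounded_linear_add bounded_linear_scaleC bounded_linear_mult_right)

lemma uact_simps:
  "uact (u + v) x = uact u x + uact v x" "uact (r *\<^sub>R u) x = r *\<^sub>R uact u x"
  "uact (u * v) x = uact u (uact v x)" "uact (- u) x = - uact u x"
  by (simp_all add: uact_def algebra_simps scaleC_simps)

lemma norm_uact_le: "norm (uact u x) \<le> onorm (uact u) * norm x"
  by (rule onorm[OF bounded_linear_uact])

text \<open>The inclusion of the original algebra is isometric: testing the action on
  \<open>adj (uelem u)\<close> gives the lower bound, by the C*-identity.\<close>

lemma onorm_uact_zero_scal:
  assumes "uscal u = 0"
  shows "onorm (uact u) = norm (uelem u)"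
proof (rule antisym)
  show "onorm (uact u) \<le> norm (uelem u)"
    by (rule onorm_bound) (simp_all add: uact_def assms norm_mult_ineq)
  show "norm (uelem u) \<le> onorm (uact u)"
  proof (cases "uelem u = 0")
    case True
    then show ?thesis using onorm_pos_le[OF bounded_linear_uact] by simp
  next
    case False
    have "norm (uelem u) * norm (uelem u) = norm (uact u (adj (uelem u)))"
      using cstar_identity[of "adj (uelem u)"] by (simp add: uact_def assms adj_adj power2_eq_square)
    also have "\<dots> \<le> onorm (uact u) * norm (uelem u)"
      using norm_uact_le[of u "adj (uelem u)"] by simp
    finally show ?thesis using False by simp
  qed
qed

instantiation unitization :: (cstar_algebra) real_normed_algebra_1
begin

definition "norm u = max (cmod (uscal u)) (onorm (uact u))"
definition "sgn u = u /\<^sub>R norm (u :: 'a unitization)"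
definition "dist u v = norm (u - v :: 'a unitization)"
definition "uniformity = (INF e\<in>{0<..}. principal {(u, v :: 'a unitization). dist u v < e})"
definition "open (U :: 'a unitization set) \<longleftrightarrow>
  (\<forall>u\<in>U. eventually (\<lambda>(u', v). u' = u \<longrightarrow> v \<in> U) uniformity)"

instance
proof
  fix u v :: "'a unitization" and r :: real
  show "norm u = 0 \<longleftrightarrow> u = 0"
  proof
    assume "norm u = 0"
    then have "uscal u = 0" and op: "onorm (uact u) \<le> 0"
      by (auto simp: norm_unitization_def max_def split: if_splits)
    with onorm_uact_zero_scal[of u] show "u = 0" by (intro unitization_eqI) auto
  next
    assume "u = 0"
    then have "uact u = (\<lambda>x. 0)" by (simp add: fun_eq_iff uact_def)
    with \<open>u = 0\<close> show "norm u = 0" by (simp add: norm_unitization_def onorm_zero)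
  qed
  have "onorm (uact (u + v)) \<le> onorm (uact u) + onorm (uact v)"
    using onorm_triangle[OF bounded_linear_uact bounded_linear_uact, of u v]
    by (simp add: uact_simps[abs_def])
  then show "norm (u + v) \<le> norm u + norm v"
    using norm_triangle_ineq[of "uscal u" "uscal v"] by (simp add: norm_unitization_def max_def)
  have "onorm (uact (r *\<^sub>R u)) = \<bar>r\<bar> * onorm (uact u)"
    using onorm_scaleR[OF bounded_linear_uact, of r u] by (simp add: uact_simps[abs_def])
  then show "norm (r *\<^sub>R u) = \<bar>r\<bar> * norm u"
    by (simp add: norm_unitization_def max_mult_distrib_left)
  have "onorm (uact (u * v)) \<le> onorm (uact u) * onorm (uact v)"
    using onorm_compose[OF bounded_linear_uact bounded_linear_uact, of u v]
    by (simp add: uact_simps[abs_def] o_def)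
  moreover have "onorm (uact u) * onorm (uact v) \<le> norm u * norm v"
    by (intro mult_mono) (auto simp: norm_unitization_def onorm_pos_le[OF bounded_linear_uact] max_def)
  moreover have "cmod (uscal u) * cmod (uscal v) \<le> norm u * norm v"
    by (intro mult_mono) (auto simp: norm_unitization_def max_def order_trans[OF norm_ge_zero])
  ultimately show "norm (u * v) \<le> norm u * norm v"
    by (simp add: norm_unitization_def[of "u * v"] norm_mult)
  have "onorm (uact (1 :: 'a unitization)) \<le> 1"
    by (rule onorm_bound) (simp_all add: uact_def)
  then show "norm (1 :: 'a unitization) = 1" by (simp add: norm_unitization_def)
qed (simp_all add: sgn_unitization_def dist_unitization_def uniformity_unitization_def
    open_unitization_def)

end

lemma norm_Unitize_zero [simp]: "norm (Unitize 0 x) = norm (x :: 'a::cstar_algebra)"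
  by (simp add: norm_unitization_def onorm_uact_zero_scal)

lemma uscal_norm_le: "cmod (uscal u) \<le> norm u"
  by (simp add: norm_unitization_def)

text \<open>Used for completeness of the unitization. The factor 2 counts \<open>u\<close> once and
  its scalar part, of norm at most \<open>norm u\<close>, once.\<close>

lemma uelem_norm_le: "norm (uelem u) \<le> 2 * norm (u :: 'a::cstar_algebra unitization)"
proof -
  have "Unitize 0 (uelem u) = u - Unitize (uscal u) 0"
    by (rule unitization_eqI) simp_all
  then have "norm (uelem u) \<le> norm u + norm (Unitize (uscal u) (0 :: 'a))"
    by (metis norm_Unitize_zero norm_triangle_ineq4)
  moreover have "norm (Unitize (uscal u) (0 :: 'a)) \<le> cmod (uscal u)"
    unfolding norm_unitization_def
    by (auto intro!: onorm_bound simp: uact_def norm_scaleC)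
  ultimately show ?thesis using uscal_norm_le[of u] by simp
qed

instantiation unitization :: (cstar_algebra) cstar_algebra
begin

definition "c *\<^sub>C u = Unitize (c * uscal u) (c *\<^sub>C uelem u)"
definition "adj u = Unitize (cnj (uscal u)) (adj (uelem u))"

instance
proof
  fix u v :: "'a unitization" and c d :: complex and r :: real
  show "c *\<^sub>C (u + v) = c *\<^sub>C u + c *\<^sub>C v" "(c + d) *\<^sub>C u = c *\<^sub>C u + d *\<^sub>C u"
    "c *\<^sub>C d *\<^sub>C u = (c * d) *\<^sub>C u" "complex_of_real r *\<^sub>C u = r *\<^sub>R u"
    "(c *\<^sub>C u) * v = c *\<^sub>C (u * v)" "u * (c *\<^sub>C v) = c *\<^sub>C (u * v)"
    "adj (u + v) = adj u + adj v" "adj (c *\<^sub>C u) = cnj c *\<^sub>C adj u" "adj (adj u) = u"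
    "adj (u * v) = adj v * adj u"
    by (rule unitization_eqI; simp add: scaleC_unitization_def adj_unitization_def algebra_simps
        scaleC_simps adj_add adj_scaleC adj_mult adj_adj scaleC_of_real scaleR_conv_of_real[where 'a = complex])+
  have "onorm (uact (c *\<^sub>C u)) \<le> cmod c * onorm (uact u)" for c :: complex and u :: "'a unitization"
  proof (rule onorm_bound)
    show "norm (uact (c *\<^sub>C u) x) \<le> cmod c * onorm (uact u) * norm x" for x
    proof -
      have "uact (c *\<^sub>C u) x = c *\<^sub>C uact u x"
        by (simp add: uact_def scaleC_unitization_def scaleC_simps)
      then show ?thesis
        using mult_left_mono[OF norm_uact_le[of u x], of "cmod c"] by (simp add: norm_scaleC mult.assoc)
    qed
  qed (simp add: onorm_pos_le[OF bounded_linear_uact])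
  then have le: "norm (c *\<^sub>C u) \<le> cmod c * norm u" for c :: complex and u :: "'a unitization"
    using max.mono[OF order_refl, of _ _ "cmod (c * uscal u)"]
    by (simp add: norm_unitization_def[of u] norm_unitization_def[of "c *\<^sub>C u"] max_mult_distrib_left
        scaleC_unitization_def[THEN arg_cong[where f = uscal]] norm_mult)
  show "norm (c *\<^sub>C u) = cmod c * norm u"
  proof (cases "c = 0")
    case True
    then show ?thesis using le[of 0 u] by simp
  next
    case False
    have "norm u = norm (inverse c *\<^sub>C c *\<^sub>C u)"
      using False by (intro arg_cong[where f = norm] unitization_eqI)
        (simp_all add: scaleC_unitization_def scaleC_scaleC)
    also have "\<dots> \<le> cmod (inverse c) * norm (c *\<^sub>C u)" by (rule le)
    finally have "cmod c * norm u \<le> norm (c *\<^sub>C u)"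
      using False by (simp add: norm_divide field_simps)
    with le[of c u] show ?thesis by simp
  qed
  \<comment> \<open>\<open>(u x)\<^sup>* (u x) = x\<^sup>* (u\<^sup>* u x)\<close> is an equation in
    the original algebra, where the C*-identity is available; it yields one half of the identity for
    the operator norm.\<close>
  have star: "(onorm (uact u))\<^sup>2 \<le> onorm (uact (adj u * u))" for u :: "'a unitization"
  proof -
    let ?K = "onorm (uact (adj u * u))"
    have K: "0 \<le> ?K" by (rule onorm_pos_le[OF bounded_linear_uact])
    have "norm (uact u x) \<le> sqrt ?K * norm x" for x
    proof -
      have "(norm (uact u x))\<^sup>2 = norm (adj x * uact (adj u * u) x)"
        unfolding cstar_identity[symmetric]
        by (simp add: uact_def adj_unitization_def adj_add adj_mult adj_scaleC algebra_simps
            scaleC_simps)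
      also have "\<dots> \<le> norm x * (?K * norm x)"
        using norm_mult_ineq[of "adj x" "uact (adj u * u) x"]
          mult_left_mono[OF norm_uact_le[of "adj u * u" x] norm_ge_zero[of x]] by simp
      also have "\<dots> = (sqrt ?K * norm x)\<^sup>2" using K by (simp add: power2_eq_square)
      finally show ?thesis by (rule power2_le_imp_le) (use K in simp)
    qed
    then have "onorm (uact u) \<le> sqrt ?K" by (intro onorm_bound) (use K in auto)
    then have "(onorm (uact u))\<^sup>2 \<le> (sqrt ?K)\<^sup>2"
      by (intro power_mono onorm_pos_le[OF bounded_linear_uact])
    with K show ?thesis by simp
  qed
  have le2: "(norm u)\<^sup>2 \<le> norm (adj u * u)" for u :: "'a unitization"
    using star[of u]
    by (auto simp: norm_unitization_def adj_unitization_def norm_mult power2_eq_square max_def)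
  \<comment> \<open>Submultiplicativity and the half already shown make the involution isometric,
    and this gives the other half.\<close>
  have adj_le: "norm u \<le> norm (adj u)" for u :: "'a unitization"
  proof (cases "u = 0")
    case False
    have "norm u * norm u \<le> norm (adj u) * norm u"
      using le2[of u] norm_mult_ineq[of "adj u" u] by (simp add: power2_eq_square)
    with False show ?thesis by simp
  qed simp
  have "norm (adj u) = norm u"
    using adj_le[of u] adj_le[of "adj u"] by (simp add: adj_unitization_def adj_adj)
  then show "norm (adj u * u) = (norm u)\<^sup>2"
    using le2[of u] norm_mult_ineq[of "adj u" u] by (simp add: power2_eq_square)
next
  fix U :: "nat \<Rightarrow> 'a unitization"
  assume U: "Cauchy U"
  have bl: "bounded_linear (uscal :: 'a unitization \<Rightarrow> complex)"
    "bounded_linear (uelem :: 'a unitization \<Rightarrow> 'a)"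
    by (rule bounded_linear_intro[where K = 1]; simp add: uscal_norm_le)
      (rule bounded_linear_intro[where K = 2]; simp add: uelem_norm_le mult.commute[of _ 2])
  obtain l where l: "(\<lambda>n. uscal (U n)) \<longlonglongrightarrow> l"
    using bounded_linear.Cauchy[OF bl(1) U] unfolding Cauchy_convergent_iff convergent_def by blast
  obtain x where x: "(\<lambda>n. uelem (U n)) \<longlonglongrightarrow> x"
    using bounded_linear.Cauchy[OF bl(2) U] unfolding Cauchy_convergent_iff convergent_def by blast
  have le: "norm (U n - Unitize l x) \<le> cmod (uscal (U n) - l) + norm (uelem (U n) - x)" for n
    unfolding norm_unitization_def[of "U n - Unitize l x"]
  proof (rule max.boundedI)
    show "onorm (uact (U n - Unitize l x)) \<le> cmod (uscal (U n) - l) + norm (uelem (U n) - x)"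
    proof (rule onorm_bound)
      show "norm (uact (U n - Unitize l x) y)
        \<le> (cmod (uscal (U n) - l) + norm (uelem (U n) - x)) * norm y" for y
        using norm_mult_ineq[of "uelem (U n) - x" y]
        by (auto simp: uact_def norm_scaleC distrib_right intro!: norm_triangle_le)
    qed simp
  qed simp
  have null: "(\<lambda>n. cmod (uscal (U n) - l) + norm (uelem (U n) - x)) \<longlonglongrightarrow> 0"
    using tendsto_add[OF tendsto_norm[OF LIM_zero[OF l]] tendsto_norm[OF LIM_zero[OF x]]] by simp
  have "(\<lambda>n. U n - Unitize l x) \<longlonglongrightarrow> 0"
    by (rule Lim_null_comparison[OF always_eventually null]) (rule allI, rule le)
  then have "U \<longlonglongrightarrow> Unitize l x" by (rule LIM_zero_cancel)
  then show "convergent U" by (rule convergentI)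
qed

end

lemma Unitize_zero_star_hom:
  "Unitize 0 (x + y) = Unitize 0 x + Unitize 0 (y :: 'a::cstar_algebra)"
  "Unitize 0 (x - y) = Unitize 0 x - Unitize 0 y"
  "Unitize 0 (x * y) = Unitize 0 x * Unitize 0 y"
  "Unitize 0 (adj x) = adj (Unitize 0 x)"
  by (rule unitization_eqI; simp add: adj_unitization_def)+


subsection \<open>Positive elements\<close>

text \<open>Positivity in terms of the norm, which makes sums of positive elements positive without spectra.\<close>

definition npos :: "'a::{cstar_algebra, real_normed_algebra_1} \<Rightarrow> bool" where
  "npos h \<longleftrightarrow> adj h = h \<and> (\<exists>t. norm (t *\<^sub>R 1 - h) \<le> t)"

lemma adj_one [simp]: "adj (1 :: 'a::{cstar_algebra, real_normed_algebra_1}) = 1"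
  by (metis adj_adj adj_mult mult_1_left mult_1_right)

lemma npos_zero: "npos 0"
  by (auto simp: npos_def intro: exI[of _ 0])

lemma npos_add:
  assumes "npos h" and "npos k"
  shows "npos (h + k)"
proof -
  from assms obtain s t where st: "norm (s *\<^sub>R 1 - h) \<le> s" "norm (t *\<^sub>R 1 - k) \<le> t"
    by (auto simp: npos_def)
  have "(s + t) *\<^sub>R 1 - (h + k) = (s *\<^sub>R 1 - h) + (t *\<^sub>R 1 - k)" by (simp add: algebra_simps)
  with st have "norm ((s + t) *\<^sub>R 1 - (h + k)) \<le> s + t" by (metis norm_triangle_mono)
  with assms show ?thesis by (auto simp: npos_def adj_add)
qed

lemma npos_scaleR:
  assumes "npos h" and "0 \<le> r"
  shows "npos (r *\<^sub>R h)"
proof -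
  from assms obtain t where "norm (t *\<^sub>R 1 - h) \<le> t" by (auto simp: npos_def)
  then have "r * norm (t *\<^sub>R 1 - h) \<le> r * t" using assms(2) by (rule mult_left_mono)
  moreover have "(r * t) *\<^sub>R 1 - r *\<^sub>R h = r *\<^sub>R (t *\<^sub>R 1 - h)" by (simp add: algebra_simps)
  ultimately have "norm ((r * t) *\<^sub>R 1 - r *\<^sub>R h) \<le> r * t" using assms(2) by simp
  with assms(1) show ?thesis by (auto simp: npos_def adj_scaleR)
qed

lemma npos_bound:
  assumes "npos h"
  obtains t where "0 < t" and "norm (t *\<^sub>R 1 - h) \<le> t"
proof -
  from assms obtain t where t: "norm (t *\<^sub>R 1 - h) \<le> t" by (auto simp: npos_def)
  \<comment> \<open>Raising \<open>t\<close> by 1 keeps the inequality and makes the radius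
    positive, so that one can divide by it.\<close>
  have "(t + 1) *\<^sub>R 1 - h = (t *\<^sub>R 1 - h) + 1" by (simp add: algebra_simps)
  then have "norm ((t + 1) *\<^sub>R 1 - h) \<le> t + 1"
    using t norm_triangle_ineq[of "t *\<^sub>R 1 - h" 1] by (simp only: norm_one)
  moreover have "0 < t + 1" using t norm_ge_zero[of "t *\<^sub>R 1 - h"] by linarith
  ultimately show ?thesis by (rule that[rotated])
qed

text \<open>Divided by \<open>t\<close>, the element \<open>h\<close> becomes \<open>1 - y\<close>
  with \<open>norm y \<le> 1\<close>, and \<open>1 - z\<close> is a root of it. That the root
  commutes with whatever commutes with \<open>h\<close> is what later makes pairs of roots eligible
  for \<open>norm_square_le_of_sum\<close>.\<close>

lemma npos_sqrt:
  fixes h :: "'a::{cstar_algebra, real_normed_algebra_1}"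
  assumes "npos h"
  obtains w where "w * w = h" and "adj w = w" and "npos w"
    and "\<And>x. x * h = h * x \<Longrightarrow> x * w = w * x"
proof -
  obtain t where t: "0 < t" "norm (t *\<^sub>R 1 - h) \<le> t" using npos_bound[OF assms] .
  define y where "y = 1 - (1 / t) *\<^sub>R h"
  have "y = (1 / t) *\<^sub>R (t *\<^sub>R 1 - h)" using t by (simp add: y_def algebra_simps)
  then have "norm y \<le> 1" using t by simp
  moreover have "adj y = y"
    using assms by (simp add: y_def adj_diff adj_scaleR npos_def)
  ultimately obtain z where z: "z + z = y + z * z" "adj z = z" "norm z \<le> 1"
      "\<And>x. x * y = y * x \<Longrightarrow> x * z = z * x"
    using half_quadratic_solution by metis
  have "(1 - z) * (1 - z) = 1 + z * z - (z + z)" by (simp add: algebra_simps)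
  also have "\<dots> = (1 / t) *\<^sub>R h" by (simp add: z(1)) (simp add: y_def)
  finally have sq: "(1 - z) * (1 - z) = (1 / t) *\<^sub>R h" .
  define w where "w = sqrt t *\<^sub>R (1 - z)"
  show ?thesis
  proof
    show "w * w = h" using t by (simp add: w_def sq)
    show "adj w = w" by (simp add: w_def adj_scaleR adj_diff z)
    have "npos (1 - z)" using z(2,3) by (auto simp: npos_def adj_diff intro: exI[of _ 1])
    then show "npos w" using t by (simp add: w_def npos_scaleR)
    fix x assume "x * h = h * x"
    then have "x * y = y * x" by (simp add: y_def algebra_simps)
    from z(4)[OF this] show "x * w = w * x" by (simp add: w_def algebra_simps)
  qed
qed

text \<open>The elements \<open>w + \<i>v\<close> and \<open>w - \<i>v\<close> are \<open>sqrt r\<close> times unitaries.\<close>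

lemma norm_square_le_of_sum:
  fixes w v :: "'a::{cstar_algebra, real_normed_algebra_1}"
  assumes "adj w = w" and "adj v = v" and "w * v = v * w" and "w * w + v * v = r *\<^sub>R 1" and "0 \<le> r"
  shows "norm (w * w) \<le> r"
proof -
  have bound: "norm (w + c *\<^sub>C v) \<le> sqrt r" if "cnj c = - c" "c * c = -1" for c
  proof -
    have "adj (w + c *\<^sub>C v) * (w + c *\<^sub>C v) = w * w - (c * c) *\<^sub>C (v * v)"
      using that(1) by (simp add: adj_add adj_scaleC assms algebra_simps scaleC_simps)
    also have "\<dots> = r *\<^sub>R 1" using assms(4) that(2) by (simp add: scaleC_minus_one)
    finally have "(norm (w + c *\<^sub>C v))\<^sup>2 = r"
      using assms(5) cstar_identity[of "w + c *\<^sub>C v"] by simp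
    then show ?thesis by (simp add: real_le_rsqrt)
  qed
  have "2 *\<^sub>R w = (w + \<i> *\<^sub>C v) + (w + (- \<i>) *\<^sub>C v)"
    by (simp add: scaleR_2 scaleC_simps)
  then have "2 * norm w \<le> norm (w + \<i> *\<^sub>C v) + norm (w + (- \<i>) *\<^sub>C v)"
    by (metis norm_triangle_ineq norm_scaleR abs_numeral)
  also have "\<dots> \<le> sqrt r + sqrt r" by (intro add_mono bound) auto
  finally have "norm w \<le> sqrt r" by simp
  then have "norm w * norm w \<le> sqrt r * sqrt r" by (intro mult_mono) (use assms(5) in auto)
  then show ?thesis using norm_mult_ineq[of w w] assms(5) by simp
qed

text \<open>For \<open>s = w / norm w\<close>, the norm of \<open>s * s\<close> shows at first only
  that \<open>1 - s * s\<close> is positive. Its root \<open>v\<close> satisfies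
  \<open>s * s + v * v = 1\<close>, hence \<open>norm (v * v) \<le> 1\<close>; this says
  \<open>norm (1 - s * s) \<le> 1\<close>, which is positivity of \<open>s * s\<close> with
  \<open>t = 1\<close>.\<close>

lemma npos_square:
  fixes w :: "'a::{cstar_algebra, real_normed_algebra_1}"
  assumes "adj w = w"
  shows "npos (w * w)"
proof (cases "w = 0")
  case False
  define s where "s = (1 / norm w) *\<^sub>R w"
  have s: "adj s = s" "norm s = 1" using False by (simp_all add: s_def adj_scaleR assms)
  have "norm (s * s) \<le> 1" using norm_mult_ineq[of s s] s(2) by simp
  then have "npos (1 - s * s)"
    using s(1) by (auto simp: npos_def adj_diff adj_mult intro: exI[of _ 1])
  then obtain v where v: "v * v = 1 - s * s" "adj v = v"
      "\<And>x. x * (1 - s * s) = (1 - s * s) * x \<Longrightarrow> x * v = v * x"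
    using npos_sqrt by metis
  have sv: "s * v = v * s" by (rule v(3)) (simp add: algebra_simps)
  have "norm (v * v) \<le> 1"
    by (rule norm_square_le_of_sum[where v = s]) (simp_all add: v(1,2) s(1) sv)
  then have "npos (s * s)" using v(1) s(1) by (auto simp: npos_def adj_mult intro: exI[of _ 1])
  then have "npos ((norm w)\<^sup>2 *\<^sub>R (s * s))" by (rule npos_scaleR) simp
  then show ?thesis using False by (simp add: s_def power2_eq_square)
qed (simp add: npos_zero)

text \<open>Commuting roots of \<open>h\<close> and \<open>- h\<close> have squares with sum 0, so
  \<open>norm_square_le_of_sum\<close> applies with \<open>r = 0\<close>.\<close>

lemma npos_antisym:
  fixes h :: "'a::{cstar_algebra, real_normed_algebra_1}"
  assumes "npos h" and "npos (- h)"
  shows "h = 0"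
proof -
  obtain w where w: "w * w = h" "adj w = w" using npos_sqrt[OF assms(1)] by metis
  obtain v where v: "v * v = - h" "adj v = v" "\<And>x. x * (- h) = (- h) * x \<Longrightarrow> x * v = v * x"
    using npos_sqrt[OF assms(2)] by metis
  have wv: "w * v = v * w" by (rule v(3)) (simp add: w(1)[symmetric] mult.assoc)
  have "norm (w * w) \<le> 0"
    by (rule norm_square_le_of_sum[where v = v]) (simp_all add: w v(1,2) wv)
  with w(1) show ?thesis by simp
qed

text \<open>With \<open>R = norm (a + c)\<close>, the element
  \<open>R - a = (R - (a + c)) + c\<close> is positive, and commuting roots of \<open>a\<close> and
  \<open>R - a\<close> have squares with sum \<open>R\<close>.\<close>

lemma npos_norm_mono:
  fixes a :: "'a::{cstar_algebra, real_normed_algebra_1}"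
  assumes "npos a" and "npos c"
  shows "norm a \<le> norm (a + c)"
proof -
  let ?R = "norm (a + c)"
  obtain w where w: "w * w = a" "adj w = w" "\<And>x. x * a = a * x \<Longrightarrow> x * w = w * x"
    using npos_sqrt[OF assms(1)] by metis
  have "npos (?R *\<^sub>R 1 - (a + c))"
    using assms by (auto simp: npos_def adj_diff adj_add adj_scaleR add.commute intro!: exI[of _ ?R])
  from npos_add[OF this assms(2)] have "npos (?R *\<^sub>R 1 - a)" by (simp add: algebra_simps)
  then obtain v where v: "v * v = ?R *\<^sub>R 1 - a" "adj v = v"
      "\<And>x. x * (?R *\<^sub>R 1 - a) = (?R *\<^sub>R 1 - a) * x \<Longrightarrow> x * v = v * x"
    using npos_sqrt by metis
  have "w * v = v * w" by (rule v(3)) (simp add: w(1)[symmetric] algebra_simps)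
  then have "norm (w * w) \<le> ?R"
    by (intro norm_square_le_of_sum[where v = v]) (simp_all add: v(1,2) w(1,2))
  with w(1) show ?thesis by simp
qed

text \<open>The C*-identity doubles the exponent, hence the powers of two. This replaces the
  spectral radius formula for selfadjoint elements.\<close>

lemma selfadjoint_norm_power:
  fixes s :: "'a::{cstar_algebra, real_normed_algebra_1}"
  assumes "adj s = s"
  shows "norm (s ^ 2 ^ k) = norm s ^ 2 ^ k"
proof (induction k)
  case (Suc k)
  have "adj (s ^ n) = s ^ n" for n
    by (induction n) (simp_all add: adj_mult assms power_commutes)
  then have "norm (s ^ 2 ^ k * s ^ 2 ^ k) = (norm (s ^ 2 ^ k))\<^sup>2"
    using cstar_identity[of "s ^ 2 ^ k"] by simp
  also have "\<dots> = norm s ^ 2 ^ Suc k" by (simp add: Suc mult.commute flip: power_mult)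
  finally show ?case by (simp add: power_add[symmetric] mult_2)
qed simp

text \<open>
  Stands in for the equality of the nonzero spectra of \<open>x\<^sup>*x\<close> and \<open>xx\<^sup>*\<close>: powers of
  \<open>t + xx\<^sup>*\<close> grow at most like \<open>m t\<^sup>m\<close>.
\<close>

lemma npos_minus_adj_mult_swap:
  fixes x :: "'a::{cstar_algebra, real_normed_algebra_1}"
  assumes "npos (- (adj x * x))"
  shows "npos (- (x * adj x))"
proof -
  obtain t where t: "0 < t" "norm (t *\<^sub>R 1 - (- (adj x * x))) \<le> t" using npos_bound[OF assms] .
  define S where "S = t *\<^sub>R 1 + adj x * x"
  define S' where "S' = t *\<^sub>R 1 + x * adj x"
  have S: "norm S \<le> t" using t(2) by (simp add: S_def)
  have comm: "S' ^ n * x = x * S ^ n" for n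
  proof (induction n)
    case (Suc n)
    have "S' * x = x * S" by (simp add: S_def S'_def algebra_simps)
    then show ?case by (metis Suc mult.assoc power_Suc)
  qed simp
  have growth: "norm (S' ^ n) \<le> t ^ n + n * ((norm x)\<^sup>2 / t) * t ^ n" for n
  proof (induction n)
    case (Suc n)
    have "S' ^ Suc n = S' ^ n * S'" by (rule power_Suc2)
    \<comment> \<open>Moving \<open>x\<close> across by \<open>comm\<close> turns powers of
      \<open>S'\<close> into powers of \<open>S\<close>, whose norms are at most
      \<open>t ^ n\<close>; so each induction step adds only one more summand of that order.\<close>
    also have "\<dots> = t *\<^sub>R S' ^ n + x * S ^ n * adj x"
      by (simp add: S'_def[THEN arg_cong[where f = "\<lambda>u. _ * u"]] distrib_left comm[symmetric] mult.assoc)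
    finally have "norm (S' ^ Suc n) \<le> t * norm (S' ^ n) + norm (x * S ^ n * adj x)"
      using norm_triangle_ineq t(1) by (metis abs_of_pos norm_scaleR)
    also have "norm (x * S ^ n * adj x) \<le> norm x * norm (S ^ n) * norm x"
      using order_trans[OF norm_mult_ineq mult_right_mono[OF norm_mult_ineq norm_ge_zero]] norm_adj
      by metis
    also have "\<dots> \<le> norm x * t ^ n * norm x"
    proof -
      have "norm (S ^ n) \<le> t ^ n" by (meson S norm_ge_zero norm_power_ineq order_trans power_mono)
      then show ?thesis by (intro mult_right_mono mult_left_mono) auto
    qed
    also have "t * norm (S' ^ n) \<le> t * (t ^ n + n * ((norm x)\<^sup>2 / t) * t ^ n)"
      using Suc t(1) by simp
    finally show ?case using t(1) by (simp add: field_simps power2_eq_square)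
  qed simp
  have sa: "adj S' = S'" by (simp add: S'_def adj_add adj_scaleR adj_mult adj_adj)
  have "norm S' \<le> t"
  proof (rule ccontr)
    assume "\<not> norm S' \<le> t"
    \<comment> \<open>If \<open>norm S' > t\<close>, the powers along \<open>m = 2 ^ k\<close> have
      norm \<open>(1 + e) ^ m * t ^ m\<close>, and exponential growth beats the factor
      \<open>1 + m * K\<close>.\<close>
    define e where "e = norm S' / t - 1"
    define K where "K = (norm x)\<^sup>2 / t"
    have e: "0 < e" and S': "norm S' = (1 + e) * t"
      using \<open>\<not> norm S' \<le> t\<close> t(1) by (simp_all add: e_def field_simps)
    have main: "(1 + e) ^ m \<le> 1 + m * K" if "m = 2 ^ k" for m k :: nat
    proof -
      have "(1 + e) ^ m * t ^ m = norm (S' ^ m)"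
        by (simp add: selfadjoint_norm_power[OF sa] that S' power_mult_distrib)
      also have "\<dots> \<le> (1 + m * K) * t ^ m" using growth[of m] by (simp add: K_def algebra_simps)
      finally show ?thesis using t(1) by simp
    qed
    have "(\<lambda>m. of_nat m * (1 / (1 + e)) ^ m) \<longlonglongrightarrow> (0::real)"
      by (rule powser_times_n_limit_0) (use e in simp)
    moreover have "(\<lambda>m. (1 / (1 + e)) ^ m) \<longlonglongrightarrow> (0::real)"
      by (rule LIMSEQ_power_zero) (use e in \<open>simp add: norm_divide\<close>)
    ultimately have "(\<lambda>m. (1 / (1 + e)) ^ m + K * (of_nat m * (1 / (1 + e)) ^ m)) \<longlonglongrightarrow> 0 + K * 0"
      by (intro tendsto_add tendsto_mult tendsto_const)
    then have "\<forall>\<^sub>F m in sequentially. (1 / (1 + e)) ^ m + K * (of_nat m * (1 / (1 + e)) ^ m) < 1"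
      by (rule order_tendstoD) simp
    then obtain M where M: "\<And>m. m \<ge> M \<Longrightarrow> (1 / (1 + e)) ^ m + K * (of_nat m * (1 / (1 + e)) ^ m) < 1"
      by (auto simp: eventually_sequentially)
    \<comment> \<open>The contradiction needs an exponent beyond the threshold \<open>M\<close> that
      is also a power of two.\<close>
    have "M \<le> 2 ^ M" by (simp add: less_imp_le)
    from M[OF this] main[OF refl, of M] e show False
      by (simp add: field_simps)
  qed
  then show ?thesis using sa by (auto simp: npos_def S'_def adj_minus adj_mult adj_adj intro!: exI[of _ t])
qed

text \<open>Up to sign, \<open>h\<close> and \<open>k\<close> are twice the real and imaginary parts
  of \<open>x\<close>; in \<open>h * h + k * k\<close> the terms \<open>x * x\<close> and
  \<open>adj x * adj x\<close> cancel.\<close>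

lemma npos_adj_mult_add_swap:
  fixes x :: "'a::{cstar_algebra, real_normed_algebra_1}"
  shows "npos (adj x * x + x * adj x)"
proof -
  define h k where "h = x + adj x" and "k = \<i> *\<^sub>C (x - adj x)"
  have "adj h = h" "adj k = k"
    by (simp_all add: h_def k_def adj_add adj_adj adj_scaleC adj_diff scaleC_simps)
  then have "npos ((1/2) *\<^sub>R (h * h + k * k))"
    by (intro npos_scaleR npos_add npos_square) simp_all
  also have "h * h + k * k = 2 *\<^sub>R (adj x * x + x * adj x)"
    by (simp add: h_def k_def algebra_simps scaleC_simps scaleR_2 scaleC_minus_one)
  finally show ?thesis by simp
qed

text \<open>Here \<open>g\<close> is the absolute value of \<open>h\<close> and \<open>n\<close> is
  twice its negative part. For \<open>x = b * n\<close> the element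
  \<open>adj x * x = n * h * n\<close> is negative, hence so is \<open>x * adj x\<close>; as their
  sum is positive, \<open>adj x * x\<close> is also positive, so it is 0, and this forces
  \<open>n = 0\<close>.\<close>

theorem npos_adj_mult_self:
  fixes b :: "'a::{cstar_algebra, real_normed_algebra_1}"
  shows "npos (adj b * b)"
proof -
  define h where "h = adj b * b"
  have sah: "adj h = h" by (simp add: h_def adj_mult adj_adj)
  obtain g where g: "g * g = h * h" "adj g = g" "npos g"
      "\<And>x. x * (h * h) = (h * h) * x \<Longrightarrow> x * g = g * x"
    using npos_sqrt[OF npos_square[OF sah]] by metis
  have hg: "h * g = g * h" by (rule g(4)) (simp add: mult.assoc)
  define n where "n = g - h"
  have nh: "n * h = - (g * n)" by (simp add: n_def algebra_simps g(1) hg)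
  obtain s where s: "s * s = g" "adj s = s" "\<And>x. x * g = g * x \<Longrightarrow> x * s = s * x"
    using npos_sqrt[OF g(3)] by metis
  have ns: "n * s = s * n" by (rule s(3)) (simp add: n_def algebra_simps hg)
  have san: "adj n = n" by (simp add: n_def adj_diff g(2) sah)
  have sasn: "adj (s * n) = s * n" by (simp add: adj_mult s(2) san ns)
  define x where "x = b * n"
  have "adj x * x = n * h * n" by (simp add: x_def adj_mult san h_def mult.assoc)
  also have "\<dots> = - ((s * n) * (s * n))"
    by (simp add: nh) (metis ns s(1) mult.assoc)
  finally have xx: "adj x * x = - ((s * n) * (s * n))" .
  then have "npos (- (adj x * x))" using npos_square[OF sasn] by simp
  then have "npos (- (x * adj x))" by (rule npos_minus_adj_mult_swap)
  from npos_add[OF npos_adj_mult_add_swap[of x] this] have "npos (adj x * x)" by simp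
  with \<open>npos (- (adj x * x))\<close> have "adj x * x = 0" by (rule npos_antisym[rotated])
  then have "(s * n) * (s * n) = 0" using xx by simp
  then have "s * n = 0" using adj_mult_self_eq_zero[of "s * n"] sasn by simp
  then have gn: "g * n = 0" by (metis s(1) mult.assoc mult_zero_right)
  have "n * g = 0" using gn by (simp add: n_def algebra_simps hg)
  then have "n * n = 0" using nh gn by (simp add: n_def[THEN arg_cong[where f = "\<lambda>u. _ * u"]] right_diff_distrib)
  then have "n = 0" using adj_mult_self_eq_zero[of n] san by simp
  then have "g = h" by (simp add: n_def)
  with g(3) show ?thesis by (simp add: h_def)
qed

section \<open>Consequences of positivity in algebras without a unit\<close>

lemma norm_adj_mult_self_mono:
  fixes p q :: "'a::cstar_algebra"
  shows "norm (adj p * p) \<le> norm (adj p * p + adj q * q)"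
proof -
  have "norm (Unitize 0 (adj p * p)) \<le> norm (Unitize 0 (adj p * p) + Unitize 0 (adj q * q))"
    unfolding Unitize_zero_star_hom by (intro npos_norm_mono npos_adj_mult_self)
  then show ?thesis by (simp flip: Unitize_zero_star_hom)
qed

text \<open>Since \<open>f\<close> need not preserve units, it is the unit-free quadratic equation
  for \<open>z = 1 - sqrt (1 - adj b * b)\<close> that is transported along \<open>f\<close>. In the
  unitization of the target it reads \<open>adj B * B + adj (1 - Z) * (1 - Z) = 1\<close>, and
  monotonicity of the norm bounds \<open>B\<close>.\<close>

lemma star_hom_contractive:
  fixes f :: "'a::cstar_algebra \<Rightarrow> 'b::cstar_algebra"
  assumes "star_hom cstar_of_type cstar_of_type f"
  shows "norm (f b) \<le> norm b"
proof -
  note f = star_hom_cstarD[OF assms]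
  have contr: "norm (f b) \<le> 1" if "norm b \<le> 1" for b
  proof -
    have "norm (adj b * b) \<le> 1" using that by (simp add: cstar_identity power_le_one)
    moreover have "adj (adj b * b) = adj b * b" by (simp add: adj_mult adj_adj)
    ultimately obtain z where z: "z + z = adj b * b + z * z" "adj z = z"
      by (rule half_quadratic_solution)
    define B Z where "B = Unitize 0 (f b)" and "Z = Unitize 0 (f z)"
    have "Z + Z = Unitize 0 (f (z + z))" by (simp add: Z_def f Unitize_zero_star_hom)
    also have "\<dots> = adj B * B + Z * Z"
      unfolding z(1) by (simp add: B_def Z_def f Unitize_zero_star_hom)
    finally have "Z + Z = adj B * B + Z * Z" .
    moreover have "adj Z = Z" by (simp add: Z_def z(2) flip: Unitize_zero_star_hom f)
    ultimately have "adj B * B + adj (1 - Z) * (1 - Z) = 1 + (Z + Z) - (Z + Z)"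
      by (simp only: adj_diff adj_one) (simp add: algebra_simps)
    then have eq: "adj B * B + adj (1 - Z) * (1 - Z) = 1" by simp
    have "(norm B)\<^sup>2 \<le> 1"
      using norm_adj_mult_self_mono[of B "1 - Z"] by (simp only: eq cstar_identity norm_one)
    then show ?thesis by (simp add: B_def abs_square_le_1)
  qed
  show ?thesis
  proof (cases "b = 0")
    case False
    then have "norm (f ((1 / norm b) *\<^sub>R b)) \<le> 1" by (intro contr) simp
    then show ?thesis using False by (simp add: f field_simps)
  qed (simp add: f)
qed

text \<open>For a real number \<open>h\<close> in \<open>[0, 1]\<close>,
  \<open>n h (1 - h)^n\<close> is at most the geometric sum of the terms \<open>h (1 - h)^j\<close>
  with \<open>j < n\<close>, which is \<open>1 - (1 - h)^n\<close>. The operator version is an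
  induction with the positive increment \<open>(n + 1) h (1 - h)^n h\<close>.\<close>

lemma npos_mult_power_bound:
  fixes b :: "'a::{cstar_algebra, real_normed_algebra_1}"
  defines "h \<equiv> adj b * b"
  assumes "norm h \<le> 1"
  shows "real n * norm (h * (1 - h) ^ n) \<le> 1"
proof -
  let ?k = "1 - h"
  have sah: "adj h = h" by (simp add: h_def adj_mult adj_adj)
  have "npos ?k" using assms(2) sah by (auto simp: npos_def adj_diff intro: exI[of _ 1])
  then obtain v where v: "v * v = ?k" "adj v = v" "\<And>x. x * ?k = ?k * x \<Longrightarrow> x * v = v * x"
    using npos_sqrt by metis
  have hv: "h * v = v * h" by (rule v(3)) (simp add: algebra_simps)
  have hvn: "h * v ^ n = v ^ n * h" for n 
    by (rule power_commuting_commutes[OF hv[symmetric], symmetric])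
  have savn: "adj (v ^ n) = v ^ n" for n by (induction n) (simp_all add: adj_mult v(2) power_commutes)
  have kn: "?k ^ n = v ^ n * v ^ n" for n
    by (simp add: power_mult_distrib[symmetric] v(1)[symmetric] power2_eq_square[symmetric] flip: power_mult)
      (simp add: mult.commute mult_2 power_add)
  have pos_k: "npos (?k ^ n)" for n
    unfolding kn using npos_square[OF savn] .
  \<comment> \<open>Positivity of products of commuting positive elements is obtained by writing
    them as \<open>adj c * c\<close>, here with \<open>c = b * v ^ n\<close>.\<close>
  have pos_hk: "npos (h * ?k ^ n)" for n
    using npos_adj_mult_self[of "b * v ^ n"]
    by (simp add: adj_mult savn kn h_def[symmetric] mult.assoc[symmetric] hvn)
      (metis h_def hvn mult.assoc)
  have pos_hkh: "npos (h * ?k ^ n * h)" for n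
    using npos_adj_mult_self[of "v ^ n * h"]
    by (simp add: adj_mult savn sah kn mult.assoc)
  have hk: "h * ?k ^ n = ?k ^ n * h" for n
    unfolding kn by (metis hvn mult.assoc)
  have hk': "h * (?k ^ n * x) = ?k ^ n * (h * x)" for n x
    by (metis hk mult.assoc)
  have pos: "npos (1 - ?k ^ n - real n *\<^sub>R (h * ?k ^ n))" for n
  proof (induction n)
    case (Suc n)
    have "1 - ?k ^ Suc n - real (Suc n) *\<^sub>R (h * ?k ^ Suc n) =
        (1 - ?k ^ n - real n *\<^sub>R (h * ?k ^ n)) + real (Suc n) *\<^sub>R (h * ?k ^ n * h)"
      unfolding power_Suc2 by (simp add: algebra_simps hk hk')
    also have "npos \<dots>" by (intro npos_add npos_scaleR Suc pos_hkh) simp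
    finally show ?case .
  qed (simp add: npos_zero)
  have "norm (real n *\<^sub>R (h * ?k ^ n)) \<le>
      norm (real n *\<^sub>R (h * ?k ^ n) + (?k ^ n + (1 - ?k ^ n - real n *\<^sub>R (h * ?k ^ n))))"
    by (intro npos_norm_mono npos_add npos_scaleR pos_hk pos_k pos) simp
  then show ?thesis by simp
qed

text \<open>The unit of the algebra is not the unit of its unitization, but
  \<open>h * (1 - h) ^ n\<close> is a polynomial in \<open>h\<close> without constant term and may
  be computed with either. The detour covers the zero algebra, in which \<open>norm 1 = 1\<close>
  fails.\<close>

lemma adj_mult_self_power_bound:
  fixes b :: "'a::{cstar_algebra, monoid_mult}"
  defines "h \<equiv> adj b * b"
  assumes "norm h \<le> 1"
  shows "real n * norm (h * (1 - h) ^ n) \<le> 1"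
proof -
  have "Unitize 0 (h * (1 - h) ^ n) = Unitize 0 h * (1 - Unitize 0 h) ^ n"
  proof (induction n)
    case (Suc n)
    have step: "Unitize 0 (a - a * h) = Unitize 0 a - Unitize 0 a * Unitize 0 h" for a
      by (simp only: Unitize_zero_star_hom)
    have "Unitize 0 (h * (1 - h) ^ Suc n) = Unitize 0 (h * (1 - h) ^ n - h * (1 - h) ^ n * h)"
      unfolding power_Suc2 by (simp add: right_diff_distrib mult.assoc)
    also have "\<dots> = Unitize 0 h * (1 - Unitize 0 h) ^ Suc n"
      unfolding power_Suc2 step Suc by (simp add: right_diff_distrib mult.assoc)
    finally show ?case .
  qed simp
  then show ?thesis
    using npos_mult_power_bound[of "Unitize 0 b" n] assms(2)
    by (metis Unitize_zero_star_hom(3,4) h_def norm_Unitize_zero)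
qed


section \<open>Entire functions on the upper half-plane\<close>

text \<open>Division by \<open>q w = 1 - \<i> * d * w\<close> does not enlarge \<open>h\<close>,
  since \<open>cmod (q w) \<ge> 1\<close>, and makes it small far out, since
  \<open>cmod (q w) \<ge> d * \<bar>Re w\<bar>\<close>. The maximum principle on a rectangle then
  applies, and \<open>d\<close> tends to 0.\<close>

lemma strip_maximum_modulus:
  fixes h :: "complex \<Rightarrow> complex"
  assumes hol: "h holomorphic_on UNIV"
    and bd: "\<And>w. 0 \<le> Im w \<Longrightarrow> Im w \<le> Y \<Longrightarrow> cmod (h w) \<le> K"
    and B: "0 < B"
    and lines: "\<And>w. Im w = 0 \<or> Im w = Y \<Longrightarrow> cmod (h w) \<le> B"
    and z: "0 \<le> Im z" "Im z \<le> Y"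
  shows "cmod (h z) \<le> B"
proof -
  have K: "0 \<le> K" using order_trans[OF norm_ge_zero bd[OF z]] .
  have key: "cmod (h z) \<le> B + d * (B * cmod z)" if d: "0 < d" for d
  proof -
    define q where "q w = 1 - \<i> * complex_of_real d * w" for w
    have q1: "1 \<le> cmod (q w)" if "0 \<le> Im w" for w
      using complex_Re_le_cmod[of "q w"] that d by (simp add: q_def) (smt (verit) mult_nonneg_nonneg)
    have q2: "d * \<bar>Re w\<bar> \<le> cmod (q w)" for w
      using abs_Im_le_cmod[of "q w"] d by (simp add: q_def abs_mult)
    \<comment> \<open>Wide enough for the rectangle to contain \<open>z\<close> and for
      \<open>K / (d * R)\<close> to be at most \<open>B\<close> on its vertical sides.\<close>
    define R where "R = max (\<bar>Re z\<bar> + 1) (K / (d * B))"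
    have R: "\<bar>Re z\<bar> \<le> R" "K \<le> B * (d * R)"
    proof -
      show "\<bar>Re z\<bar> \<le> R" by (simp add: R_def)
      have "K / (d * B) \<le> R" by (simp add: R_def)
      then show "K \<le> B * (d * R)" using d B by (simp add: field_simps)
    qed
    let ?S = "cbox (Complex (- R) 0) (Complex R Y)"
    have holq: "(\<lambda>w. h w / q w) holomorphic_on ?S"
    proof (intro holomorphic_intros holomorphic_on_subset[OF hol])
      show "q holomorphic_on ?S" unfolding q_def by (intro holomorphic_intros)
      show "q w \<noteq> 0" if "w \<in> ?S" for w
        using q1[of w] that by (auto simp: in_cbox_complex_iff)
    qed simp
    have "cmod (h z / q z) \<le> B"
    proof (rule maximum_modulus_frontier[where S = ?S and f = "\<lambda>w. h w / q w"])
      show "(\<lambda>w. h w / q w) holomorphic_on interior ?S"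
        using holq interior_subset by (rule holomorphic_on_subset)
      show "continuous_on (closure ?S) (\<lambda>w. h w / q w)"
        using holomorphic_on_imp_continuous_on[OF holq] by simp
      show "z \<in> ?S" using z R(1) by (auto simp: in_cbox_complex_iff)
      fix w assume "w \<in> frontier ?S"
      then have w: "w \<in> ?S" "w \<notin> box (Complex (- R) 0) (Complex R Y)"
        by (auto simp: frontier_cbox)
      then have Im: "0 \<le> Im w" "Im w \<le> Y" by (auto simp: in_cbox_complex_iff)
      from w consider "Im w = 0 \<or> Im w = Y" | "\<bar>Re w\<bar> = R"
        by (force simp: in_cbox_complex_iff in_box_complex_iff)
      then have "cmod (h w) \<le> B * cmod (q w)"
      proof cases
        case 1
        have "B * 1 \<le> B * cmod (q w)" using q1[OF Im(1)] B by (intro mult_left_mono) auto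
        with lines[OF 1] show ?thesis by simp
      next
        case 2
        have "cmod (h w) \<le> B * (d * R)" using bd[OF Im] R(2) by simp
        also have "\<dots> \<le> B * cmod (q w)" using q2[of w] 2 B by (intro mult_left_mono) auto
        finally show ?thesis .
      qed
      moreover have "0 < cmod (q w)" using q1[OF Im(1)] by linarith
      ultimately show "cmod (h w / q w) \<le> B" by (simp add: norm_divide field_simps)
    qed (rule bounded_cbox)
    moreover have "0 < cmod (q z)" using q1[OF z(1)] by linarith
    ultimately have "cmod (h z) \<le> B * cmod (q z)" by (simp add: norm_divide field_simps)
    also have "cmod (q z) \<le> 1 + d * cmod z"
      using norm_triangle_ineq4[of 1 "\<i> * complex_of_real d * z"] d by (simp add: q_def norm_mult)
    finally show ?thesis using B by (simp add: algebra_simps)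
  qed
  have "((\<lambda>d. B + d * (B * cmod z)) \<longlongrightarrow> B + 0 * (B * cmod z)) (at_right 0)"
    by (intro tendsto_intros)
  then show ?thesis
    using key by (intro tendsto_lowerbound[where F = "at_right 0"])
      (auto simp: eventually_at_right_less intro: eventually_mono[OF eventually_at_right_less])
qed

lemma norm_exp_ii_times: "cmod (exp (\<i> * complex_of_real l * z)) = exp (- l * Im z)"
  by (simp add: norm_exp_eq_Re)

text \<open>The weight \<open>exp (\<i> * l * w)\<close> has modulus \<open>exp (- l * Im w)\<close>
  and presses the a priori bound \<open>K\<close> below \<open>B\<close> on a line high enough,
  which reduces the claim to a strip; then \<open>l\<close> tends to 0.\<close>

lemma half_plane_maximum_modulus:
  fixes g :: "complex \<Rightarrow> complex"
  assumes hol: "g holomorphic_on UNIV"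
    and bd: "\<And>w. 0 \<le> Im w \<Longrightarrow> cmod (g w) \<le> K"
    and B: "0 < B"
    and line: "\<And>w. Im w = 0 \<Longrightarrow> cmod (g w) \<le> B"
    and z: "0 \<le> Im z"
  shows "cmod (g z) \<le> B"
proof -
  have K: "0 \<le> K" using order_trans[OF norm_ge_zero bd[OF z]] .
  have key: "cmod (g z) \<le> B * exp (l * Im z)" if l: "0 < l" for l
  proof -
    define Y where "Y = max (Im z) (K / (l * B))"
    have "K / (l * B) \<le> Y" by (simp add: Y_def)
    then have "K \<le> B * (l * Y)" using l B by (simp add: field_simps)
    also have "\<dots> \<le> B * exp (l * Y)"
      using B exp_ge_add_one_self[of "l * Y"] by (intro mult_left_mono) linarith+
    finally have KY: "K * exp (- l * Y) \<le> B" by (simp add: exp_minus field_simps)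
    have "cmod (g z * exp (\<i> * complex_of_real l * z)) \<le> B"
    proof (rule strip_maximum_modulus[where Y = Y and K = K and z = z
          and h = "\<lambda>w. g w * exp (\<i> * complex_of_real l * w)"])
      show "(\<lambda>w. g w * exp (\<i> * complex_of_real l * w)) holomorphic_on UNIV"
        by (intro holomorphic_intros hol)
      fix w
      show "cmod (g w * exp (\<i> * complex_of_real l * w)) \<le> K" if "0 \<le> Im w" "Im w \<le> Y"
      proof -
        have "cmod (g w) * exp (- l * Im w) \<le> K * 1"
          using that(1) l K bd by (intro mult_mono) auto
        then show ?thesis by (simp only: norm_mult norm_exp_ii_times)
      qed
      show "cmod (g w * exp (\<i> * complex_of_real l * w)) \<le> B" if "Im w = 0 \<or> Im w = Y"
      proof (cases "Im w = 0")
        case True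
        then show ?thesis using line by (simp add: norm_mult norm_exp_ii_times)
      next
        case False
        with that have "Im w = Y" by simp
        then have "cmod (g w) \<le> K" using z by (intro bd) (simp add: Y_def)
        then have "cmod (g w) * exp (- l * Im w) \<le> K * exp (- l * Y)"
          using \<open>Im w = Y\<close> by simp
        then show ?thesis using KY by (simp only: norm_mult norm_exp_ii_times)
      qed
    qed (use z B in \<open>auto simp: Y_def\<close>)
    then have "cmod (g z) * exp (- l * Im z) \<le> B" by (simp only: norm_mult norm_exp_ii_times)
    then show ?thesis by (simp add: exp_minus field_simps)
  qed
  have "((\<lambda>l. B * exp (l * Im z)) \<longlongrightarrow> B * exp (0 * Im z)) (at_right 0)"
    by (intro tendsto_intros)
  then show ?thesis
    using key by (intro tendsto_lowerbound[where F = "at_right 0"])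
      (auto simp: eventually_at_right_less intro: eventually_mono[OF eventually_at_right_less])
qed

text \<open>
  A three lines argument on the strip of height \<open>Im z + 1\<close>: the weight \<open>exp (\<i>Cw)\<close> turns a
  sufficiently good approximation on the real line into an approximation at \<open>z\<close> up to \<open>1\<close>.
\<close>

lemma bounded_upper_half_plane_of_approximation:
  fixes F :: "complex \<Rightarrow> complex"
  assumes hol: "F holomorphic_on UNIV"
    and strips: "\<And>Y. \<exists>K. \<forall>w. 0 \<le> Im w \<and> Im w \<le> Y \<longrightarrow> cmod (F w) \<le> K"
    and line: "\<And>w. Im w = 0 \<Longrightarrow> cmod (F w) \<le> M"
    and approx: "\<And>\<epsilon>. 0 < \<epsilon> \<Longrightarrow> \<exists>g K. g holomorphic_on UNIV \<and>
      (\<forall>w. 0 \<le> Im w \<longrightarrow> cmod (g w) \<le> K) \<and> (\<forall>w. Im w = 0 \<longrightarrow> cmod (F w - g w) \<le> \<epsilon>)"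
    and z: "0 \<le> Im z"
  shows "cmod (F z) \<le> M + 2"
proof -
  have M: "0 \<le> M" using order_trans[OF norm_ge_zero line[of 0]] by simp
  define Y where "Y = Im z + 1"
  obtain K where K: "\<And>w. 0 \<le> Im w \<Longrightarrow> Im w \<le> Y \<Longrightarrow> cmod (F w) \<le> K"
    using strips[of Y] by blast
  have K0: "0 \<le> K" using order_trans[OF norm_ge_zero K[of 0]] z by (simp add: Y_def)
  \<comment> \<open>A bound for \<open>F - g\<close> on the strip: \<open>K\<close> for
    \<open>F\<close> and \<open>M + 1\<close> for \<open>g\<close>. It is fixed before
    \<open>g\<close> is chosen.\<close>
  define C where "C = K + M + 1"
  have C: "0 < C" using K0 M by (simp add: C_def)
  have C1: "C * exp (- C) \<le> 1"
    using exp_ge_add_one_self[of C] by (simp add: exp_minus field_simps)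
  \<comment> \<open>On the top edge the weight has modulus \<open>exp (- C * Y)\<close>, so the
    weighted difference has the same bound \<open>\<epsilon>\<close> on both edges. Removing the
    weight at \<open>z\<close>, at distance 1 below that edge, leaves
    \<open>C * exp (- C) \<le> 1\<close>.\<close>
  define \<epsilon> where "\<epsilon> = C * exp (- C * Y)"
  have eps: "0 < \<epsilon>" using C by (simp add: \<epsilon>_def)
  have "\<epsilon> \<le> C * exp (- C)" using C z by (simp add: \<epsilon>_def Y_def)
  with C1 have eps1: "\<epsilon> \<le> 1" by simp
  obtain g K' where g: "g holomorphic_on UNIV" "\<And>w. 0 \<le> Im w \<Longrightarrow> cmod (g w) \<le> K'"
      "\<And>w. Im w = 0 \<Longrightarrow> cmod (F w - g w) \<le> \<epsilon>"
    using approx[OF eps] by blast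
  have M1: "0 < M + 1" using M by linarith
  \<comment> \<open>The bound \<open>K'\<close> may depend on the approximation; the maximum modulus
    principle replaces it by one that does not.\<close>
  have gM: "cmod (g w) \<le> M + 1" if "0 \<le> Im w" for w
  proof (rule half_plane_maximum_modulus[OF g(1,2) M1 _ that])
    fix w :: complex assume "Im w = 0"
    then show "cmod (g w) \<le> M + 1"
      using line[of w] g(3)[of w] eps1 norm_triangle_ineq2[of "g w" "F w"]
      by (simp add: norm_minus_commute)
  qed
  have FgC: "cmod (F w - g w) \<le> C" if "0 \<le> Im w" "Im w \<le> Y" for w
    using K[OF that] gM[OF that(1)] norm_triangle_ineq4[of "F w" "g w"] by (simp add: C_def)
  have "cmod ((F z - g z) * exp (\<i> * complex_of_real C * z)) \<le> \<epsilon>"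
  proof (rule strip_maximum_modulus[where Y = Y and K = C and z = z
        and h = "\<lambda>w. (F w - g w) * exp (\<i> * complex_of_real C * w)"])
    show "(\<lambda>w. (F w - g w) * exp (\<i> * complex_of_real C * w)) holomorphic_on UNIV"
      by (intro holomorphic_intros hol g)
    fix w
    show "cmod ((F w - g w) * exp (\<i> * complex_of_real C * w)) \<le> C" if "0 \<le> Im w" "Im w \<le> Y"
    proof -
      have "cmod (F w - g w) * exp (- C * Im w) \<le> C * 1"
        using that C FgC by (intro mult_mono) auto
      then show ?thesis by (simp only: norm_mult norm_exp_ii_times)
    qed
    show "cmod ((F w - g w) * exp (\<i> * complex_of_real C * w)) \<le> \<epsilon>" if "Im w = 0 \<or> Im w = Y"
    proof (cases "Im w = 0")
      case True
      then show ?thesis using g(3) by (simp add: norm_mult norm_exp_ii_times)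
    next
      case False
      with that have w: "Im w = Y" by simp
      then have "cmod (F w - g w) \<le> C" using z by (intro FgC) (simp_all add: Y_def)
      then have "cmod (F w - g w) * exp (- C * Im w) \<le> C * exp (- C * Y)" using w by simp
      then show ?thesis by (simp only: norm_mult norm_exp_ii_times \<epsilon>_def)
    qed
  qed (use z eps in \<open>auto simp: Y_def\<close>)
  then have "cmod (F z - g z) * exp (- C * Im z) \<le> C * exp (- C) * exp (- C * Im z)"
    by (simp only: norm_mult norm_exp_ii_times \<epsilon>_def Y_def mult.assoc flip: exp_add)
      (simp add: algebra_simps)
  then have "cmod (F z - g z) \<le> C * exp (- C)" by simp
  with C1 gM[OF z] show ?thesis
    using norm_triangle_ineq2[of "F z" "g z"] by linarith
qed

section \<open>Entire functions with values in a C*-algebra\<close>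

lemma entire_fun_isCont:
  assumes "entire_fun f"
  shows "isCont f z"
proof -
  obtain l where "((\<lambda>h. inverse h *\<^sub>C (f (z + h) - f z)) \<longlongrightarrow> l) (at 0)"
    using assms by (auto simp: entire_fun_def)
  then have "((\<lambda>h. cmod h * norm (inverse h *\<^sub>C (f (z + h) - f z))) \<longlongrightarrow> cmod 0 * norm l) (at 0)"
    by (intro tendsto_intros)
  moreover have "\<forall>\<^sub>F h in at 0. cmod h * norm (inverse h *\<^sub>C (f (z + h) - f z)) = norm (f (z + h) - f z)"
    unfolding eventually_at_filter
    by (rule always_eventually) (simp add: norm_scaleC norm_inverse)
  ultimately have "((\<lambda>h. norm (f (z + h) - f z)) \<longlongrightarrow> 0) (at 0)"
    by (simp add: tendsto_cong)
  then have "((\<lambda>h. f (z + h) - f z) \<longlongrightarrow> 0) (at 0)" by (rule tendsto_norm_zero_cancel)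
  then have "((\<lambda>h. f (z + h)) \<longlongrightarrow> f z) (at 0)" by (rule LIM_zero_cancel)
  then show ?thesis by (simp add: isCont_iff)
qed

text \<open>Reduces the complex analysis to scalar functions: a bounded complex-linear functional
  carries limits of difference quotients in norm to derivatives.\<close>

lemma entire_fun_linear_functional:
  assumes "entire_fun f"
    and add: "\<And>x y. L (x + y) = L x + L y" and scale: "\<And>c x. L (c *\<^sub>C x) = c * L x"
    and bd: "\<And>x. cmod (L x) \<le> norm x * K"
  shows "(\<lambda>z. L (f z)) holomorphic_on UNIV"
proof -
  have diff: "L (x - y) = L x - L y" for x y using add[of "x - y" y] by simp
  have bl: "bounded_linear L"
    by (rule bounded_linear_intro[where K = K]) (simp_all add: add bd scaleR_conv_of_real scale flip: scaleC_of_real)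
  have "\<exists>D. ((\<lambda>z. L (f z)) has_field_derivative D) (at z)" for z
  proof -
    obtain l where "((\<lambda>h. inverse h *\<^sub>C (f (z + h) - f z)) \<longlongrightarrow> l) (at 0)"
      using assms(1) by (auto simp: entire_fun_def)
    from bounded_linear.tendsto[OF bl this]
    have "((\<lambda>h. (L (f (z + h)) - L (f z)) / h) \<longlongrightarrow> L l) (at 0)"
      by (simp add: scale diff field_simps)
    then show ?thesis by (auto simp: DERIV_def)
  qed
  then show ?thesis by (auto simp: holomorphic_on_def field_differentiable_def)
qed


section \<open>Complex linear spans\<close>

context complex_vec
begin

lemma vadd_left_comm:
  "\<lbrakk>x \<in> carrier V; y \<in> carrier V; z \<in> carrier V\<rbrakk>
    \<Longrightarrow> vadd V x (vadd V y z) = vadd V y (vadd V x z)"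
  using vadd_assoc[of x y z] vadd_assoc[of y x z] vadd_comm[of x y] by simp

lemma vadd_idem_zero:
  assumes "x \<in> carrier V" and "vadd V x x = x"
  shows "x = vzero V"
proof -
  obtain y where y: "y \<in> carrier V" "vadd V x y = vzero V" using vadd_inverse[OF assms(1)] by blast
  then have "vadd V (vadd V x x) y = x"
    by (metis assms(1) vadd_assoc vadd_comm vadd_zero vzero_closed)
  with assms y show ?thesis by simp
qed

lemma vscale_zero_left: "x \<in> carrier V \<Longrightarrow> vscale V 0 x = vzero V"
  by (rule vadd_idem_zero) (simp_all add: vscale_closed flip: vscale_add_left)

lemma vscale_zero_right: "vscale V c (vzero V) = vzero V"
  by (rule vadd_idem_zero) (simp_all add: vscale_closed vzero_closed vadd_zero flip: vscale_add_right)

lemma vdiff_closed: "\<lbrakk>x \<in> carrier V; y \<in> carrier V\<rbrakk> \<Longrightarrow> vdiff V x y \<in> carrier V"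
  by (simp add: vdiff_def vadd_closed vscale_closed)

lemma vdiff_self: "x \<in> carrier V \<Longrightarrow> vdiff V x x = vzero V"
  using vscale_add_left[of x 1 "-1"] by (simp add: vdiff_def vscale_one vscale_zero_left)

lemma vdiff_vdiff_cancel:
  assumes "t \<in> carrier V" and "r \<in> carrier V" and "s \<in> carrier V"
  shows "vdiff V (vdiff V t r) (vdiff V s r) = vdiff V t s"
proof -
  have "vdiff V (vdiff V t r) (vdiff V s r) =
      vadd V (vadd V t (vscale V (-1) r)) (vadd V (vscale V (-1) s) r)"
    using assms by (simp add: vdiff_def vscale_add_right vscale_closed vscale_vscale vscale_one)
  also have "\<dots> = vadd V (vadd V t (vscale V (-1) s)) (vadd V r (vscale V (-1) r))"
    using assms by (simp add: vadd_assoc vadd_comm vadd_left_comm vscale_closed vadd_closed)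
  also have "\<dots> = vdiff V t s"
    using assms vdiff_self[OF assms(2)]
    by (metis vadd_comm vadd_zero vdiff_closed vdiff_def vzero_closed)
  finally show ?thesis .
qed

lemma vspan_closed:
  assumes "S \<subseteq> carrier V" and "x \<in> vspan V S"
  shows "x \<in> carrier V"
  using assms(2)
  by (induction rule: vspan.induct) (use assms(1) in \<open>auto intro: vzero_closed vadd_closed vscale_closed\<close>)

lemma vspan_superset:
  assumes "S \<subseteq> carrier V" and "x \<in> S"
  shows "x \<in> vspan V S"
proof -
  have "vadd V (vscale V 1 x) (vzero V) = x"
    using assms by (metis subsetD vadd_comm vadd_zero vscale_one vzero_closed)
  then show ?thesis using vspan.add[OF assms(2) vspan.zero, of V 1] by simp
qed

lemma vspan_vadd:
  assumes S: "S \<subseteq> carrier V" and "x \<in> vspan V S" and y: "y \<in> vspan V S"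
  shows "vadd V x y \<in> vspan V S"
  using assms(2)
proof (induction rule: vspan.induct)
  case zero
  then show ?case using y vspan_closed[OF S y] by (simp add: vadd_zero)
next
  case (add x z c)
  then have "vadd V (vscale V c x) (vadd V z y) \<in> vspan V S" by (intro vspan.add) auto
  then show ?case
    using add S vspan_closed[OF S y] vspan_closed[OF S, of z] by (simp add: vadd_assoc vscale_closed subsetD)
qed

lemma vspan_vscale:
  assumes S: "S \<subseteq> carrier V" and "x \<in> vspan V S"
  shows "vscale V c x \<in> vspan V S"
  using assms(2)
proof (induction rule: vspan.induct)
  case zero
  then show ?case by (simp add: vscale_zero_right vspan.zero)
next
  case (add x z d)
  then have "vadd V (vscale V (c * d) x) (vscale V c z) \<in> vspan V S" by (intro vspan.add) auto
  then show ?case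
    using add S vspan_closed[OF S, of z] by (simp add: vscale_add_right vscale_closed vscale_vscale subsetD)
qed

lemma vspan_vdiff:
  "\<lbrakk>S \<subseteq> carrier V; x \<in> vspan V S; y \<in> vspan V S\<rbrakk> \<Longrightarrow> vdiff V x y \<in> vspan V S"
  by (simp add: vdiff_def vspan_vadd vspan_vscale)

end

lemma linear_map_vzero:
  assumes "complex_vec V" and "complex_vec W" and "linear_map V W f"
  shows "f (vzero V) = vzero W"
proof -
  interpret V: complex_vec V by fact
  interpret W: complex_vec W by fact
  have "f (vscale V 0 (vzero V)) = vscale W 0 (f (vzero V))" "f (vzero V) \<in> carrier W"
    using assms(3) V.vzero_closed by (auto simp: linear_map_def)
  then show ?thesis by (simp add: V.vscale_zero_left V.vzero_closed W.vscale_zero_left)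
qed

lemma linear_map_vspan:
  assumes "complex_vec V" and "complex_vec W" and f: "linear_map V W f"
    and S: "S \<subseteq> carrier V" and x: "x \<in> vspan V S"
  shows "f x \<in> vspan W (f ` S)"
  using x
proof (induction rule: vspan.induct)
  case zero
  then show ?case using linear_map_vzero[OF assms(1-3)] by (simp add: vspan.zero)
next
  case (add x y c)
  interpret V: complex_vec V by fact
  have "f (vadd V (vscale V c x) y) = vadd W (vscale W c (f x)) (f y)"
    using f add S V.vspan_closed[OF S, of y] by (auto simp: linear_map_def V.vscale_closed subsetD)
  then show ?case using add by (auto intro: vspan.add)
qed

lemma complex_vec_cstar_of_type: "complex_vec (cstar_of_type :: 'c::cstar_algebra cstar_struct)"
  using cstar_alg_cstar_of_type by (rule cstar_alg.axioms)

interpretation cstar_type: complex_vec "cstar_of_type :: 'c::cstar_algebra cstar_struct"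
  by (rule complex_vec_cstar_of_type)

section \<open>Closed complex subspaces and closed spans\<close>

definition closed_csubspace :: "'c::cstar_algebra set \<Rightarrow> bool" where
  "closed_csubspace M \<longleftrightarrow>
     closed M \<and> 0 \<in> M \<and> (\<forall>x\<in>M. \<forall>y\<in>M. x + y \<in> M) \<and> (\<forall>c. \<forall>x\<in>M. c *\<^sub>C x \<in> M)"

definition closed_cspan :: "'c::cstar_algebra set \<Rightarrow> 'c set" where
  "closed_cspan S = closure (vspan cstar_of_type S)"

lemma closed_csubspace_closed_cspan: "closed_csubspace (closed_cspan S)"
  unfolding closed_csubspace_def
proof (intro conjI ballI allI)
  let ?V = "vspan (cstar_of_type :: 'a cstar_struct) S"
  show "closed (closed_cspan S)" by (simp add: closed_cspan_def)
  have "0 \<in> ?V" using vspan.zero[of "cstar_of_type :: 'a cstar_struct" S] by simp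
  then show "0 \<in> closed_cspan S" using closure_subset by (auto simp: closed_cspan_def)
  fix x assume x: "x \<in> closed_cspan S"
  show "c *\<^sub>C x \<in> closed_cspan S" for c
  proof -
    have "(*\<^sub>C) c ` closure ?V \<subseteq> closure ((*\<^sub>C) c ` ?V)"
      by (rule closure_bounded_linear_image_subset[OF bounded_linear_scaleC])
    also have "\<dots> \<subseteq> closure ?V"
      using cstar_type.vspan_vscale[of S _ c] by (intro closure_mono) auto
    finally show ?thesis using x by (auto simp: closed_cspan_def)
  qed
  fix y assume y: "y \<in> closed_cspan S"
  from x y obtain f g where "\<And>n. f n \<in> ?V" "f \<longlonglongrightarrow> x" "\<And>n. g n \<in> ?V" "g \<longlonglongrightarrow> y"
    unfolding closed_cspan_def closure_sequential by blast
  then show "x + y \<in> closed_cspan S"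
    unfolding closed_cspan_def closure_sequential using cstar_type.vspan_vadd[of S]
    by (intro exI[of _ "\<lambda>n. f n + g n"]) (auto intro: tendsto_add)
qed

lemma closed_cspan_superset: "x \<in> S \<Longrightarrow> x \<in> closed_cspan S"
  using cstar_type.vspan_superset[of S x] closure_subset by (auto simp: closed_cspan_def)

text \<open>Acts as the induction rule for closed spans: a property that cuts out a closed subspace
  need only be checked on generators. Multiplications and adjoints produce such subspaces as
  preimages.\<close>

lemma closed_cspan_minimal:
  assumes M: "closed_csubspace M" and "S \<subseteq> M"
  shows "closed_cspan S \<subseteq> M"
proof -
  have "x \<in> M" if "x \<in> vspan cstar_of_type S" for x
    using that by (induction rule: vspan.induct) (use assms in \<open>auto simp: closed_csubspace_def\<close>)
  then show ?thesis
    unfolding closed_cspan_def using M by (intro closure_minimal) (auto simp: closed_csubspace_def)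
qed

text \<open>The scalar \<open>d\<close> may differ from \<open>c\<close>, which admits
  conjugate-linear maps such as \<open>adj\<close>.\<close>

lemma closed_csubspace_vimage:
  assumes M: "closed_csubspace M" and f: "bounded_linear f"
    and scale: "\<And>c. \<exists>d. \<forall>x. f (c *\<^sub>C x) = d *\<^sub>C f x"
  shows "closed_csubspace {x. f x \<in> M}"
  unfolding closed_csubspace_def
proof (intro conjI ballI allI)
  have "closed (f -` M)"
    using M by (intro continuous_closed_vimage linear_continuous_at f) (auto simp: closed_csubspace_def)
  then show "closed {x. f x \<in> M}" by (simp add: vimage_def)
  show "c *\<^sub>C x \<in> {x. f x \<in> M}" if "x \<in> {x. f x \<in> M}" for c x
    using M scale[of c] that by (auto simp: closed_csubspace_def)
qed (use M in \<open>auto simp: closed_csubspace_def bounded_linear.linear[OF f] linear_0 linear_add\<close>)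

lemma closed_csubspaceD:
  assumes "closed_csubspace M"
  shows "closed M" "0 \<in> M" "x \<in> M \<Longrightarrow> y \<in> M \<Longrightarrow> x + y \<in> M" "x \<in> M \<Longrightarrow> c *\<^sub>C x \<in> M"
  using assms by (auto simp: closed_csubspace_def)

lemma closed_csubspace_mult_left:
  "closed_csubspace M \<Longrightarrow> closed_csubspace {x. a * x \<in> M}"
  by (rule closed_csubspace_vimage[OF _ bounded_linear_mult_right]) (auto simp: mult_scaleC_right)

lemma closed_csubspace_mult_right:
  "closed_csubspace M \<Longrightarrow> closed_csubspace {x. x * a \<in> M}"
  by (rule closed_csubspace_vimage[OF _ bounded_linear_mult_left]) (auto simp: mult_scaleC_left)

lemma closed_csubspace_adj:
  "closed_csubspace M \<Longrightarrow> closed_csubspace {x. adj x \<in> M}"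
  by (rule closed_csubspace_vimage[OF _ bounded_linear_adj]) (auto simp: adj_scaleC)

lemma in_closed_approx:
  fixes x :: "'c::real_normed_vector"
  assumes "closed M" and "\<And>\<epsilon>. 0 < \<epsilon> \<Longrightarrow> \<exists>y\<in>M. norm (x - y) < \<epsilon>"
  shows "x \<in> M"
proof -
  have "x \<in> closure M"
    unfolding closure_approachable using assms(2) by (auto simp: dist_norm norm_minus_commute)
  with assms(1) show ?thesis by simp
qed


section \<open>Hilbert modules\<close>

context hilbert_module
begin

lemma hinner_add_left:
  "\<lbrakk>\<xi> \<in> carrier X; \<eta> \<in> carrier X; \<zeta> \<in> carrier X\<rbrakk>
    \<Longrightarrow> hinner X (vadd X \<xi> \<eta>) \<zeta> = hinner X \<xi> \<zeta> + hinner X \<eta> \<zeta>"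
  using arg_cong[OF hinner_add_right[of \<zeta> \<xi> \<eta>], of adj] by (simp add: adj_add hinner_adj vadd_closed)

lemma hinner_scale_left:
  "\<lbrakk>\<xi> \<in> carrier X; \<eta> \<in> carrier X\<rbrakk> \<Longrightarrow> hinner X (vscale X c \<xi>) \<eta> = cnj c *\<^sub>C hinner X \<xi> \<eta>"
  using arg_cong[OF hinner_scale_right[of \<eta> \<xi> c], of adj]
  by (simp add: adj_scaleC hinner_adj vscale_closed)

lemma hinner_ract_left:
  "\<lbrakk>\<xi> \<in> carrier X; \<eta> \<in> carrier X\<rbrakk> \<Longrightarrow> hinner X (ract X \<xi> a) \<eta> = adj a * hinner X \<xi> \<eta>"
  using arg_cong[OF hinner_ract[of \<eta> \<xi> a], of adj] by (simp add: adj_mult hinner_adj ract_closed)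

lemma hinner_zero_right: "\<xi> \<in> carrier X \<Longrightarrow> hinner X \<xi> (vzero X) = 0"
  using hinner_scale_right[of \<xi> "vzero X" 0] by (simp add: vzero_closed vscale_zero_left)

lemma hinner_zero_left: "\<xi> \<in> carrier X \<Longrightarrow> hinner X (vzero X) \<xi> = 0"
  using hinner_adj[of \<xi> "vzero X"] by (simp add: vzero_closed hinner_zero_right)

lemmas hinner_simps = hinner_add_left hinner_add_right hinner_scale_left hinner_scale_right
  hinner_ract hinner_ract_left vadd_closed vscale_closed ract_closed

lemma hinner_eqI:
  assumes "\<xi> \<in> carrier X" and "\<eta> \<in> carrier X"
    and "\<And>\<zeta>. \<zeta> \<in> carrier X \<Longrightarrow> hinner X \<zeta> \<xi> = hinner X \<zeta> \<eta>"
  shows "\<xi> = \<eta>"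
proof -
  have "hinner X (vdiff X \<xi> \<eta>) (vdiff X \<xi> \<eta>) = 0"
    using assms(1,2) assms(3)[OF vdiff_closed[OF assms(1,2)]]
    unfolding vdiff_def[of X \<xi> \<eta>, THEN arg_cong[where f = "hinner X (vdiff X \<xi> \<eta>)"]]
    by (simp add: hinner_add_right hinner_scale_right vdiff_closed vscale_closed scaleC_minus_one)
  then have eq: "vdiff X \<xi> \<eta> = vzero X" using assms(1,2) by (intro hinner_definite vdiff_closed)
  have "\<xi> = vadd X (vdiff X \<xi> \<eta>) \<eta>"
    unfolding vdiff_def using assms(1,2) vdiff_self[OF assms(2)]
    by (metis vadd_assoc vadd_comm vadd_zero vdiff_def vscale_closed)
  then show ?thesis using assms(2) by (simp add: eq vadd_zero)
qed

lemma hnorm_nonneg [simp]: "0 \<le> hnorm X \<xi>"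
  by (simp add: hnorm_def)

lemma hnorm_power2: "(hnorm X \<xi>)\<^sup>2 = norm (hinner X \<xi> \<xi>)"
  by (simp add: hnorm_def)

lemma hnorm_vzero: "hnorm X (vzero X) = 0"
  by (simp add: hnorm_def hinner_zero_right vzero_closed)

lemma hnorm_eq_zero: "\<xi> \<in> carrier X \<Longrightarrow> hnorm X \<xi> = 0 \<Longrightarrow> \<xi> = vzero X"
  by (simp add: hnorm_def hinner_definite)

lemma hnorm_vscale: "\<xi> \<in> carrier X \<Longrightarrow> hnorm X (vscale X c \<xi>) = cmod c * hnorm X \<xi>"
  by (simp add: hnorm_def hinner_simps norm_scaleC real_sqrt_mult scaleC_scaleC norm_mult)

lemma hnorm_ract:
  assumes "\<xi> \<in> carrier X"
  shows "hnorm X (ract X \<xi> a) \<le> hnorm X \<xi> * norm a"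
proof (rule power2_le_imp_le)
  have "(hnorm X (ract X \<xi> a))\<^sup>2 = norm (adj a * hinner X \<xi> \<xi> * a)"
    using assms by (simp add: hnorm_power2 hinner_simps mult.assoc)
  also have "\<dots> \<le> norm a * norm (hinner X \<xi> \<xi>) * norm a"
    using order_trans[OF norm_mult_ineq mult_right_mono[OF norm_mult_ineq norm_ge_zero]] norm_adj
    by metis
  also have "\<dots> = (hnorm X \<xi> * norm a)\<^sup>2"
    by (simp add: power_mult_distrib hnorm_power2) (simp add: power2_eq_square)
  finally show "(hnorm X (ract X \<xi> a))\<^sup>2 \<le> (hnorm X \<xi> * norm a)\<^sup>2" .
qed simp

text \<open>
  By the parallelogram law and monotonicity of the norm on positive elements. The constants here and
  in \<open>norm_hinner_le\<close> are not optimal, but suffice for boundedness of operators.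
\<close>

lemma hnorm_vadd_power2:
  assumes "\<xi> \<in> carrier X" and "\<eta> \<in> carrier X"
  shows "(hnorm X (vadd X \<xi> \<eta>))\<^sup>2 \<le> 2 * ((hnorm X \<xi>)\<^sup>2 + (hnorm X \<eta>)\<^sup>2)"
proof -
  let ?p = "vadd X \<xi> \<eta>" and ?q = "vadd X \<xi> (vscale X (-1) \<eta>)"
  have c: "?p \<in> carrier X" "?q \<in> carrier X" using assms by (simp_all add: vadd_closed vscale_closed)
  obtain a b where ab: "hinner X ?p ?p = adj a * a" "hinner X ?q ?q = adj b * b"
    using hinner_positive c by blast
  have "hinner X ?p ?p + hinner X ?q ?q = 2 *\<^sub>R (hinner X \<xi> \<xi> + hinner X \<eta> \<eta>)"
    using assms by (simp add: hinner_simps scaleC_minus_one scaleC_scaleC scaleR_2)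
  then have "norm (hinner X ?p ?p) \<le> 2 * norm (hinner X \<xi> \<xi> + hinner X \<eta> \<eta>)"
    using norm_adj_mult_self_mono[of a b] by (simp add: ab)
  also have "\<dots> \<le> 2 * (norm (hinner X \<xi> \<xi>) + norm (hinner X \<eta> \<eta>))"
    by (intro mult_left_mono norm_triangle_ineq) simp
  finally show ?thesis by (simp add: hnorm_power2)
qed

lemma hnorm_vadd_le:
  assumes "\<xi> \<in> carrier X" and "\<eta> \<in> carrier X"
  shows "hnorm X (vadd X \<xi> \<eta>) \<le> 2 * (hnorm X \<xi> + hnorm X \<eta>)"
proof (rule power2_le_imp_le)
  have "2 * ((hnorm X \<xi>)\<^sup>2 + (hnorm X \<eta>)\<^sup>2) \<le> (2 * (hnorm X \<xi> + hnorm X \<eta>))\<^sup>2"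
    by (simp add: power2_eq_square algebra_simps)
  with hnorm_vadd_power2[OF assms]
  show "(hnorm X (vadd X \<xi> \<eta>))\<^sup>2 \<le> (2 * (hnorm X \<xi> + hnorm X \<eta>))\<^sup>2" by linarith
qed simp

lemma norm_hinner_le:
  assumes "\<xi> \<in> carrier X" and "\<eta> \<in> carrier X"
  shows "norm (hinner X \<xi> \<eta>) \<le> 4 * hnorm X \<xi> * hnorm X \<eta>"
proof -
  have bound: "norm (hinner X \<xi> \<eta>) \<le> 2 * ((hnorm X \<xi>)\<^sup>2 + (hnorm X \<eta>)\<^sup>2)"
    if c: "\<xi> \<in> carrier X" "\<eta> \<in> carrier X" for \<xi> \<eta>
  proof -
    \<comment> \<open>Polarisation: the values of \<open>q\<close> at the four fourth roots of unity
      add up to \<open>4 *\<^sub>R hinner X \<xi> \<eta>\<close>.\<close>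
    define q where "q u = cnj u *\<^sub>C hinner X (vadd X \<xi> (vscale X u \<eta>)) (vadd X \<xi> (vscale X u \<eta>))" for u
    define d where "d = hinner X \<xi> \<xi> + hinner X \<eta> \<eta>"
    have q: "norm (q u) \<le> 2 * ((hnorm X \<xi>)\<^sup>2 + (hnorm X \<eta>)\<^sup>2)" if "cmod u = 1" for u
      using hnorm_vadd_power2[of \<xi> "vscale X u \<eta>"] c that
      by (simp add: q_def norm_scaleC vscale_closed hnorm_vscale hnorm_power2)
    have expand: "q u = cnj u *\<^sub>C d + hinner X \<xi> \<eta> + (cnj u * cnj u) *\<^sub>C hinner X \<eta> \<xi>"
      if "cnj u * u = 1" for u
      using c that by (simp add: q_def d_def hinner_simps scaleC_simps algebra_simps)
    have "q 1 = d + hinner X \<xi> \<eta> + hinner X \<eta> \<xi>" "q (- 1) = - d + hinner X \<xi> \<eta> + hinner X \<eta> \<xi>"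
      "q \<i> = - (\<i> *\<^sub>C d) + hinner X \<xi> \<eta> - hinner X \<eta> \<xi>"
      "q (- \<i>) = \<i> *\<^sub>C d + hinner X \<xi> \<eta> - hinner X \<eta> \<xi>"
      by (simp_all add: expand scaleC_minus_left)
    moreover have "4 *\<^sub>R hinner X \<xi> \<eta> = (hinner X \<xi> \<eta> + hinner X \<xi> \<eta>) + (hinner X \<xi> \<eta> + hinner X \<xi> \<eta>)"
      using scaleR_add_left[of 2 2 "hinner X \<xi> \<eta>"] by (simp add: scaleR_2)
    ultimately have "4 *\<^sub>R hinner X \<xi> \<eta> = (q 1 + q (- 1)) + (q \<i> + q (- \<i>))" by simp
    then have "norm (4 *\<^sub>R hinner X \<xi> \<eta>) \<le> (norm (q 1) + norm (q (- 1))) + (norm (q \<i>) + norm (q (- \<i>)))"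
      by (simp only: norm_triangle_mono[OF norm_triangle_ineq norm_triangle_ineq])
    then show ?thesis using q[of 1] q[of "- 1"] q[of \<i>] q[of "- \<i>"] by simp
  qed
  show ?thesis
  proof (cases "hnorm X \<xi> = 0 \<or> hnorm X \<eta> = 0")
    case True
    then have "\<xi> = vzero X \<or> \<eta> = vzero X" using hnorm_eq_zero assms by blast
    then have "hinner X \<xi> \<eta> = 0" using hinner_zero_left hinner_zero_right assms by blast
    then show ?thesis by simp
  next
    case False
    \<comment> \<open>Scaling both vectors to norm 1 turns the bound by a sum of squares into one by
      a product, with constant \<open>2 * (1 + 1) = 4\<close>.\<close>
    define a b where "a = hnorm X \<xi>" and "b = hnorm X \<eta>"
    have ab: "0 < a" "0 < b" using False by (auto simp: a_def b_def order_less_le)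
    let ?x = "vscale X (of_real (1 / a)) \<xi>" and ?y = "vscale X (of_real (1 / b)) \<eta>"
    have "norm (hinner X ?x ?y) \<le> 4"
      using bound[of ?x ?y] assms ab
      by (simp add: vscale_closed hnorm_vscale norm_divide flip: a_def b_def)
    then have "norm (hinner X \<xi> \<eta>) / (a * b) \<le> 4"
      using assms ab by (simp add: hinner_simps norm_scaleC norm_divide mult.commute)
    then show ?thesis using ab by (simp add: field_simps flip: a_def b_def)
  qed
qed


subsection \<open>Compact operators\<close>

lemma adjointablesI:
  assumes "T \<in> carrier X \<rightarrow>\<^sub>E carrier X" and "is_adjoint X T S"
    and "\<And>\<xi>. \<xi> \<in> carrier X \<Longrightarrow> hnorm X (T \<xi>) \<le> M * hnorm X \<xi>"
  shows "T \<in> adjointables X"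
  using assms by (auto simp: adjointables_def)

lemma adjointables_apply: "T \<in> adjointables X \<Longrightarrow> \<xi> \<in> carrier X \<Longrightarrow> T \<xi> \<in> carrier X"
  by (auto simp: adjointables_def)

lemma adjointables_eqI:
  "\<lbrakk>S \<in> adjointables X; T \<in> adjointables X; \<And>\<xi>. \<xi> \<in> carrier X \<Longrightarrow> S \<xi> = T \<xi>\<rbrakk> \<Longrightarrow> S = T"
  by (rule extensionalityI[of _ "carrier X"]) (auto simp: adjointables_def PiE_def)

lemma L_alg_simps [simp]:
  "carrier (L_alg X) = adjointables X" "vzero (L_alg X) = (\<lambda>\<xi>\<in>carrier X. vzero X)"
  "vadd (L_alg X) S T = (\<lambda>\<xi>\<in>carrier X. vadd X (S \<xi>) (T \<xi>))"
  "vscale (L_alg X) c T = (\<lambda>\<xi>\<in>carrier X. vscale X c (T \<xi>))"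
  by (simp_all add: L_alg_def)

lemma adjointables_vadd:
  assumes "S \<in> adjointables X" and "T \<in> adjointables X"
  shows "vadd (L_alg X) S T \<in> adjointables X"
proof -
  obtain S' MS where S: "is_adjoint X S S'" "\<And>\<xi>. \<xi> \<in> carrier X \<Longrightarrow> hnorm X (S \<xi>) \<le> MS * hnorm X \<xi>"
    using assms(1) by (auto simp: adjointables_def)
  obtain T' MT where T: "is_adjoint X T T'" "\<And>\<xi>. \<xi> \<in> carrier X \<Longrightarrow> hnorm X (T \<xi>) \<le> MT * hnorm X \<xi>"
    using assms(2) by (auto simp: adjointables_def)
  have S'T': "S' \<xi> \<in> carrier X" "T' \<xi> \<in> carrier X" if "\<xi> \<in> carrier X" for \<xi>
    using S(1) T(1) that by (auto simp: is_adjoint_def)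
  show ?thesis
  proof (rule adjointablesI)
    show "is_adjoint X (vadd (L_alg X) S T) (vadd (L_alg X) S' T')"
      using S(1) T(1) S'T' adjointables_apply assms by (auto simp: is_adjoint_def hinner_simps)
    show "hnorm X (vadd (L_alg X) S T \<xi>) \<le> (2 * (MS + MT)) * hnorm X \<xi>" if "\<xi> \<in> carrier X" for \<xi>
      using hnorm_vadd_le[of "S \<xi>" "T \<xi>"] S(2)[OF that] T(2)[OF that] adjointables_apply assms that
      by (simp add: algebra_simps)
  qed (use adjointables_apply assms in \<open>auto intro: vadd_closed\<close>)
qed

lemma adjointables_vscale:
  assumes "T \<in> adjointables X"
  shows "vscale (L_alg X) c T \<in> adjointables X"
proof -
  obtain T' M where T: "is_adjoint X T T'" "\<And>\<xi>. \<xi> \<in> carrier X \<Longrightarrow> hnorm X (T \<xi>) \<le> M * hnorm X \<xi>"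
    using assms by (auto simp: adjointables_def)
  have T': "T' \<xi> \<in> carrier X" if "\<xi> \<in> carrier X" for \<xi>
    using T(1) that by (auto simp: is_adjoint_def)
  show ?thesis
  proof (rule adjointablesI)
    show "is_adjoint X (vscale (L_alg X) c T) (vscale (L_alg X) (cnj c) T')"
      using T(1) T' adjointables_apply assms by (auto simp: is_adjoint_def hinner_simps)
    show "hnorm X (vscale (L_alg X) c T \<xi>) \<le> (cmod c * M) * hnorm X \<xi>" if "\<xi> \<in> carrier X" for \<xi>
      using mult_left_mono[OF T(2)[OF that], of "cmod c"] adjointables_apply assms that
      by (simp add: hnorm_vscale mult.assoc)
  qed (use adjointables_apply assms in \<open>auto intro: vscale_closed\<close>)
qed

lemma adjointables_vzero: "vzero (L_alg X) \<in> adjointables X"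
  by (rule adjointablesI[where S = "vzero (L_alg X)" and M = 0])
    (auto simp: is_adjoint_def vzero_closed hinner_zero_left hinner_zero_right hnorm_vzero)

lemma complex_vec_L_alg: "complex_vec (L_alg X)"
proof
  show "\<exists>y\<in>carrier (L_alg X). vadd (L_alg X) T y = vzero (L_alg X)" if "T \<in> carrier (L_alg X)" for T
  proof
    show "vscale (L_alg X) (-1) T \<in> carrier (L_alg X)" using that adjointables_vscale by simp
    show "vadd (L_alg X) T (vscale (L_alg X) (-1) T) = vzero (L_alg X)"
      using that vdiff_self adjointables_apply by (auto simp: vdiff_def)
  qed
  show "vadd (L_alg X) (vzero (L_alg X)) T = T" "vscale (L_alg X) 1 T = T"
    if "T \<in> carrier (L_alg X)" for T
    using that adjointables_vzero adjointables_vadd adjointables_vscale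
    by (auto intro!: adjointables_eqI simp del: L_alg_simps(2-4)) 
      (auto simp: vadd_zero vscale_one adjointables_apply)
qed (use adjointables_vzero adjointables_vadd adjointables_vscale in
    \<open>auto intro!: restrict_ext simp: adjointables_apply vadd_assoc vadd_closed vscale_closed
      vscale_add_right vscale_add_left vscale_vscale intro: vadd_comm\<close>)

sublocale L: complex_vec "L_alg X"
  by (rule complex_vec_L_alg)

lemma rank_one_adjointable:
  assumes "\<xi> \<in> carrier X" and "\<eta> \<in> carrier X"
  shows "rank_one X \<xi> \<eta> \<in> adjointables X"
proof (rule adjointablesI)
  show "is_adjoint X (rank_one X \<xi> \<eta>) (rank_one X \<eta> \<xi>)"
    using assms by (auto simp: is_adjoint_def rank_one_def hinner_simps hinner_adj)
  show "hnorm X (rank_one X \<xi> \<eta> \<zeta>) \<le> (4 * hnorm X \<xi> * hnorm X \<eta>) * hnorm X \<zeta>" if "\<zeta> \<in> carrier X" for \<zeta>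
  proof -
    have "hnorm X (rank_one X \<xi> \<eta> \<zeta>) \<le> hnorm X \<xi> * norm (hinner X \<eta> \<zeta>)"
      using that hnorm_ract[OF assms(1)] by (simp add: rank_one_def)
    also have "\<dots> \<le> hnorm X \<xi> * (4 * hnorm X \<eta> * hnorm X \<zeta>)"
      by (intro mult_left_mono norm_hinner_le assms that) simp
    finally show ?thesis by (simp add: mult_ac)
  qed
qed (use assms in \<open>auto simp: rank_one_def ract_closed\<close>)

abbreviation rank_ones :: "('x \<Rightarrow> 'x) set" where
  "rank_ones \<equiv> {rank_one X \<xi> \<eta> |\<xi> \<eta>. \<xi> \<in> carrier X \<and> \<eta> \<in> carrier X}"

lemma rank_ones_subset: "rank_ones \<subseteq> carrier (L_alg X)"
  using rank_one_adjointable by auto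

lemma opnorm_vzero: "opnorm X (vzero (L_alg X)) = 0"
proof -
  have "{\<xi> \<in> carrier X. hnorm X \<xi> \<le> 1} \<noteq> {}" using vzero_closed hnorm_vzero by fastforce
  then have "(\<lambda>\<xi>. hnorm X (vzero (L_alg X) \<xi>)) ` {\<xi> \<in> carrier X. hnorm X \<xi> \<le> 1} = {0}"
    by (auto simp: hnorm_vzero)
  then show ?thesis unfolding opnorm_def by simp
qed

lemma vspan_rank_ones_compact:
  assumes "R \<in> vspan (L_alg X) rank_ones"
  shows "R \<in> compacts X"
proof -
  have R: "R \<in> adjointables X" using L.vspan_closed[OF rank_ones_subset assms] by simp
  then have "opnorm X (vdiff (L_alg X) R R) = 0"
    using L.vdiff_self[of R] opnorm_vzero by simp
  then show ?thesis using R assms by (auto simp: compacts_def intro!: bexI[of _ R])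
qed

lemma rank_one_compact:
  assumes "\<xi> \<in> carrier X" and "\<eta> \<in> carrier X"
  shows "rank_one X \<xi> \<eta> \<in> compacts X"
proof (rule vspan_rank_ones_compact, rule L.vspan_superset[OF rank_ones_subset])
  show "rank_one X \<xi> \<eta> \<in> rank_ones" using assms by blast
qed

text \<open>Contractivity of the induced homomorphisms is stated for compact operators only; this
  makes it applicable to the error of an approximation.\<close>

lemma compacts_vdiff:
  assumes T: "T \<in> compacts X" and R: "R \<in> vspan (L_alg X) rank_ones"
  shows "vdiff (L_alg X) T R \<in> compacts X"
proof -
  have c: "T \<in> carrier (L_alg X)" "R \<in> carrier (L_alg X)"
    using T L.vspan_closed[OF rank_ones_subset R] by (auto simp: compacts_def)
  have "\<exists>R'\<in>vspan (L_alg X) rank_ones.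
      opnorm X (vdiff (L_alg X) (vdiff (L_alg X) T R) R') < \<epsilon>" if eps: "0 < \<epsilon>" for \<epsilon>
  proof -
    obtain R' where R': "R' \<in> vspan (L_alg X) rank_ones" "opnorm X (vdiff (L_alg X) T R') < \<epsilon>"
      using T eps unfolding compacts_def by blast
    then show ?thesis
      using L.vspan_vdiff[OF rank_ones_subset R'(1) R]
        L.vdiff_vdiff_cancel[OF c L.vspan_closed[OF rank_ones_subset R'(1)]]
      by (intro bexI[of _ "vdiff (L_alg X) R' R"]) simp_all
  qed
  then show ?thesis using L.vdiff_closed[OF c] by (simp add: compacts_def)
qed

lemma K_alg_simps [simp]:
  "carrier (K_alg X) = compacts X" "vzero (K_alg X) = vzero (L_alg X)"
  "vadd (K_alg X) = vadd (L_alg X)" "vscale (K_alg X) = vscale (L_alg X)"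
  by (simp_all add: K_alg_def)

text \<open>Reduces assertions about all of \<open>core_fibre X i s\<close> to the products
  \<open>i s \<xi> * adj (i s \<eta>)\<close>.\<close>

lemma compact_image_closed_cspan:
  fixes f :: "('x \<Rightarrow> 'x) \<Rightarrow> 'c::cstar_algebra"
  assumes f: "linear_map (K_alg X) cstar_of_type f"
    and contr: "\<And>T. T \<in> compacts X \<Longrightarrow> norm (f T) \<le> opnorm X T"
    and T: "T \<in> compacts X"
  shows "f T \<in> closed_cspan (f ` rank_ones)"
proof (rule in_closed_approx)
  show "closed (closed_cspan (f ` rank_ones))"
    using closed_csubspace_closed_cspan by (rule closed_csubspaceD)
  have flin: "f (vadd (L_alg X) S T) = f S + f T" "f (vscale (L_alg X) c S) = c *\<^sub>C f S"
    if "S \<in> compacts X" "T \<in> compacts X" for S T c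
    using f that by (simp_all add: linear_map_def del: L_alg_simps(2-4))
  fix \<epsilon> :: real assume "0 < \<epsilon>"
  then obtain R where R: "R \<in> vspan (L_alg X) rank_ones" "opnorm X (vdiff (L_alg X) T R) < \<epsilon>"
    using T by (auto simp: compacts_def)
  note Rc = vspan_rank_ones_compact[OF R(1)]
  have mR: "vscale (L_alg X) (-1) R \<in> compacts X"
    by (rule vspan_rank_ones_compact[OF L.vspan_vscale[OF rank_ones_subset R(1)]])
  have "f (vdiff (L_alg X) T R) = f T - f R"
    using flin(1)[OF T mR] flin(2)[OF Rc Rc, of "-1"] by (simp only: vdiff_def scaleC_minus_one) simp
  then have "norm (f T - f R) < \<epsilon>"
    using contr[OF compacts_vdiff[OF T R(1)]] R(2) by simp
  moreover have "f R \<in> closed_cspan (f ` rank_ones)"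
    using R(1)
  proof (induction rule: vspan.induct)
    case zero
    have "vzero (L_alg X) \<in> compacts X" by (rule vspan_rank_ones_compact[OF vspan.zero])
    from flin(2)[OF this this, of 0] have "f (vzero (L_alg X)) = 0"
      by (simp only: L.vscale_zero_right scaleC_zero_left)
    then show ?case by (simp only: closed_csubspaceD(2)[OF closed_csubspace_closed_cspan])
  next
    case (add S S' c)
    have S: "S \<in> vspan (L_alg X) rank_ones"
      using add(1) by (rule L.vspan_superset[OF rank_ones_subset])
    have "S \<in> compacts X" "S' \<in> compacts X" "vscale (L_alg X) c S \<in> compacts X"
      using add(2) by (auto simp only: intro!: vspan_rank_ones_compact S L.vspan_vscale[OF rank_ones_subset])
    then have "f (vadd (L_alg X) (vscale (L_alg X) c S) S') = c *\<^sub>C f S + f S'"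
      by (simp only: flin)
    have "f S \<in> closed_cspan (f ` rank_ones)"
      using add by (intro closed_cspan_superset imageI)
    with add.IH have "c *\<^sub>C f S + f S' \<in> closed_cspan (f ` rank_ones)"
      by (intro closed_csubspaceD(3,4)[OF closed_csubspace_closed_cspan])
    with \<open>f (vadd (L_alg X) (vscale (L_alg X) c S) S') = c *\<^sub>C f S + f S'\<close> show ?case
      by (simp only:)
  qed
  ultimately show "\<exists>y\<in>closed_cspan (f ` rank_ones). norm (f T - y) < \<epsilon>" by blast
qed

end


section \<open>The Nica-Toeplitz algebra\<close>

text \<open>If \<open>h\<close> is the inner square of \<open>\<eta>\<close>, the element estimated
  is the inner square of \<open>\<eta> - \<eta> (h a)\<close>. With \<open>N = norm h\<close> and
  \<open>h' = h / N\<close>, choosing \<open>1 - h a = (1 - h')^n\<close> turns it into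
  \<open>N h' (1 - h')^(2n)\<close>, of norm at most \<open>N / (2n)\<close>.\<close>

lemma cstar_approximation:
  fixes b :: "'a::{cstar_algebra, monoid_mult}"
  defines "h \<equiv> adj b * b"
  assumes "0 < \<epsilon>"
  shows "\<exists>a. norm (adj (1 - h * a) * h * (1 - h * a)) < \<epsilon>"
proof (cases "h = 0")
  case True
  with assms(2) show ?thesis by simp
next
  case False
  define N where "N = norm h"
  have N: "0 < N" using False by (simp add: N_def)
  define b' where "b' = (1 / sqrt N) *\<^sub>R b"
  define h' where "h' = adj b' * b'"
  have h': "h' = (1 / N) *\<^sub>R h" using N by (simp add: h'_def b'_def adj_scaleR h_def)
  have nh': "norm h' \<le> 1" using N by (simp add: h' N_def)
  have hh': "h = N *\<^sub>R h'" using N by (simp add: h')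
  let ?k = "1 - h'"
  have comm: "h' * ?k = ?k * h'" by (simp add: algebra_simps)
  have commn: "h' * ?k ^ n = ?k ^ n * h'" for n
    by (rule power_commuting_commutes[OF comm[symmetric], symmetric])
  have one: "adj (1 :: 'a) = 1" by (metis adj_adj adj_mult mult_1_left mult_1_right)
  have "adj h' = h'" by (simp add: h'_def adj_mult adj_adj)
  then have sak: "adj (?k ^ n) = ?k ^ n" for n
    by (induction n) (simp_all add: one adj_mult adj_diff power_commutes)
  \<comment> \<open>By the geometric sum, \<open>1 - (1 - h')^n\<close> is divisible by
    \<open>h'\<close>, so a suitable \<open>a\<close> exists.\<close>
  have ex: "\<exists>c. h' * c = 1 - ?k ^ n" for n
  proof (induction n)
    case 0
    show ?case by (intro exI[of _ 0]) simp
  next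
    case (Suc n)
    then obtain c where "h' * c = 1 - ?k ^ n" by blast
    then have "h' * (c + ?k ^ n) = 1 - ?k ^ Suc n"
      unfolding power_Suc2 by (simp add: distrib_left commn right_diff_distrib)
    then show ?case by blast
  qed
  obtain n where n: "N / \<epsilon> < real n" using reals_Archimedean2 by blast
  with N assms(2) have n0: "0 < real n" by (meson divide_pos_pos less_trans)
  obtain c where c: "h' * c = 1 - ?k ^ n" using ex by blast
  have "1 - h * ((1 / N) *\<^sub>R c) = ?k ^ n" using c N by (simp add: hh')
  moreover have "norm (?k ^ n * h * ?k ^ n) < \<epsilon>"
  proof -
    have "?k ^ n * h * ?k ^ n = N *\<^sub>R (h' * ?k ^ (n + n))"
    proof -
      have "?k ^ n * h * ?k ^ n = N *\<^sub>R (?k ^ n * h' * ?k ^ n)" by (simp add: hh')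
      also have "?k ^ n * h' * ?k ^ n = h' * ?k ^ (n + n)"
        unfolding power_add commn[of n, symmetric] by (rule mult.assoc)
      finally show ?thesis .
    qed
    then have "real (n + n) * norm (?k ^ n * h * ?k ^ n) \<le> N * 1"
      using adj_mult_self_power_bound[of b' "n + n", folded h'_def, OF nh'] N
      by (simp add: mult.left_commute)
    then have "norm (?k ^ n * h * ?k ^ n) \<le> N / real (n + n)"
      using n0 by (simp add: field_simps)
    also have "\<dots> < \<epsilon>" using n n0 assms(2) N by (simp add: field_simps)
    finally show ?thesis .
  qed
  ultimately show ?thesis by (intro exI[of _ "(1 / N) *\<^sub>R c"]) (simp only: sak)
qed

locale nica_toeplitz_generators = compactly_aligned_product_system G P X
  for G :: "'g monoid" (structure) and P :: "'g set"
    and X :: "('g, 'x, 'a::{cstar_algebra, monoid_mult}) prodsys" +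
  fixes i :: "'g \<Rightarrow> 'x \<Rightarrow> 'c::cstar_algebra"
  assumes toeplitz: "toeplitz_rep G P X cstar_of_type i"
    and nica: "nica_covariant G P X cstar_of_type i"
    and generating: "\<lbrakk>closed_star_subalgebra B;
      \<And>s \<xi>. s \<in> P \<Longrightarrow> \<xi> \<in> carrier (fib X s) \<Longrightarrow> i s \<xi> \<in> B\<rbrakk> \<Longrightarrow> B = UNIV"
begin

section \<open>Relations among the generators\<close>

definition ie :: "'a \<Rightarrow> 'c" where
  "ie a = i \<one> (emb X a)"

lemma one_in_P: "\<one> \<in> P"
  using P_inv by blast

lemma P_carrier: "s \<in> P \<Longrightarrow> s \<in> carrier G"
  using P_subset by blast

lemma fib_hilbert_module: "s \<in> P \<Longrightarrow> hilbert_module (fib X s)"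
  using fib_bimodule by (rule hilbert_bimodule.axioms)

lemma fib_complex_vec: "s \<in> P \<Longrightarrow> complex_vec (fib X s)"
  using fib_hilbert_module by (rule hilbert_module.axioms)

lemma emb_closed: "emb X a \<in> carrier (fib X \<one>)"
  using emb_bij by (auto simp: bij_betw_def)

lemma i_linear_map: "s \<in> P \<Longrightarrow> linear_map (fib X s) cstar_of_type (i s)"
  using toeplitz by (simp add: toeplitz_rep_def)

lemma i_vadd: "\<lbrakk>s \<in> P; \<xi> \<in> carrier (fib X s); \<eta> \<in> carrier (fib X s)\<rbrakk>
    \<Longrightarrow> i s (vadd (fib X s) \<xi> \<eta>) = i s \<xi> + i s \<eta>"
  using i_linear_map by (simp add: linear_map_def)

lemma i_vscale: "\<lbrakk>s \<in> P; \<xi> \<in> carrier (fib X s)\<rbrakk> \<Longrightarrow> i s (vscale (fib X s) c \<xi>) = c *\<^sub>C i s \<xi>"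
  using i_linear_map by (simp add: linear_map_def)

lemma ie_star_hom: "star_hom cstar_of_type cstar_of_type ie"
  using toeplitz by (simp add: toeplitz_rep_def ie_def[abs_def])

lemmas ie_simps = star_hom_cstarD[OF ie_star_hom]

lemma i_mult: "\<lbrakk>s \<in> P; r \<in> P; \<xi> \<in> carrier (fib X s); \<eta> \<in> carrier (fib X r)\<rbrakk>
    \<Longrightarrow> i s \<xi> * i r \<eta> = i (s \<otimes> r) (pmul X s r \<xi> \<eta>)"
  using toeplitz by (simp add: toeplitz_rep_def)

lemma i_inner: "\<lbrakk>s \<in> P; \<xi> \<in> carrier (fib X s); \<eta> \<in> carrier (fib X s)\<rbrakk>
    \<Longrightarrow> adj (i s \<xi>) * i s \<eta> = ie (hinner (fib X s) \<xi> \<eta>)"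
  using toeplitz by (simp add: toeplitz_rep_def ie_def)

lemma i_ract: "\<lbrakk>s \<in> P; \<xi> \<in> carrier (fib X s)\<rbrakk> \<Longrightarrow> i s \<xi> * ie a = i s (ract (fib X s) \<xi> a)"
  using i_mult[of s \<one> \<xi> "emb X a"]
  by (simp add: ie_def one_in_P emb_closed pmul_emb_right P_carrier)

lemma i_lact: "\<lbrakk>s \<in> P; \<xi> \<in> carrier (fib X s)\<rbrakk> \<Longrightarrow> ie a * i s \<xi> = i s (lact (fib X s) a \<xi>)"
  using i_mult[of \<one> s "emb X a" \<xi>]
  by (simp add: ie_def one_in_P emb_closed pmul_emb_left P_carrier)

lemma lact_closed: "\<lbrakk>s \<in> P; \<xi> \<in> carrier (fib X s)\<rbrakk> \<Longrightarrow> lact (fib X s) a \<xi> \<in> carrier (fib X s)"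
  using hilbert_bimodule.lact_star_hom[OF fib_bimodule, of s]
    hilbert_module.adjointables_apply[OF fib_hilbert_module, of s "lact (fib X s) a" \<xi>]
  by (auto simp: star_hom_def linear_map_def L_alg_def)

lemma fib_ract_closed: "\<lbrakk>s \<in> P; \<xi> \<in> carrier (fib X s)\<rbrakk> \<Longrightarrow> ract (fib X s) \<xi> a \<in> carrier (fib X s)"
  by (rule hilbert_module.ract_closed[OF fib_hilbert_module])

text \<open>Inner products show that \<open>1\<close> acts trivially from the right. The left action
  may be degenerate, so there is no left analogue.\<close>

lemma i_mult_ie_one:
  assumes "s \<in> P" and "\<xi> \<in> carrier (fib X s)"
  shows "i s \<xi> * ie 1 = i s \<xi>"
proof -
  interpret hilbert_module "fib X s" using assms(1) by (rule fib_hilbert_module)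
  have "ract (fib X s) \<xi> 1 = \<xi>"
    by (rule hinner_eqI) (simp_all add: assms(2) ract_closed hinner_ract)
  then show ?thesis using i_ract[OF assms, of 1] by simp
qed

lemma norm_i_le:
  assumes "s \<in> P" and "\<xi> \<in> carrier (fib X s)"
  shows "norm (i s \<xi>) \<le> hnorm (fib X s) \<xi>"
proof -
  interpret hilbert_module "fib X s" using assms(1) by (rule fib_hilbert_module)
  have "(norm (i s \<xi>))\<^sup>2 \<le> (hnorm (fib X s) \<xi>)\<^sup>2"
    using star_hom_contractive[OF ie_star_hom, of "hinner (fib X s) \<xi> \<xi>"] i_inner[OF assms(1,2,2)]
    by (simp add: hnorm_power2 flip: cstar_identity)
  then show ?thesis by (rule power2_le_imp_le) simp
qed

text \<open>Nica covariance speaks of products of elements such as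
  \<open>i r \<eta> * adj (i r \<eta>)\<close>. This inserts one next to a single generator; the
  vectors \<open>\<zeta>\<close> that occur are \<open>\<eta> a\<close> with \<open>a\<close> from
  \<open>cstar_approximation\<close>.\<close>

lemma i_approximation:
  assumes r: "r \<in> P" and \<eta>: "\<eta> \<in> carrier (fib X r)" and M: "closed M"
    and mem: "\<And>\<zeta>. \<zeta> \<in> carrier (fib X r) \<Longrightarrow> i r \<eta> * adj (i r \<eta>) * i r \<zeta> \<in> M"
  shows "i r \<eta> \<in> M"
proof (rule in_closed_approx[OF M])
  interpret hilbert_module "fib X r" using r by (rule fib_hilbert_module)
  fix \<epsilon> :: real assume "0 < \<epsilon>"
  obtain b where b: "hinner (fib X r) \<eta> \<eta> = adj b * b" using hinner_positive[OF \<eta>] by blast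
  let ?h = "adj b * b"
  obtain a where a: "norm (adj (1 - ?h * a) * ?h * (1 - ?h * a)) < \<epsilon>\<^sup>2"
    using cstar_approximation[of "\<epsilon>\<^sup>2" b] \<open>0 < \<epsilon>\<close> by auto
  let ?x = "i r \<eta>" and ?u = "ie (1 - ?h * a)"
  have xx: "adj ?x * ?x = ie ?h" using i_inner[OF r \<eta> \<eta>] by (simp add: b)
  have "?x * adj ?x * i r (ract (fib X r) \<eta> a) = ?x * (adj ?x * ?x) * ie a"
    using r \<eta> by (simp add: mult.assoc flip: i_ract)
  also have "\<dots> = ?x * ie (?h * a)" unfolding xx by (simp only: ie_simps mult.assoc)
  finally have diff: "?x - ?x * adj ?x * i r (ract (fib X r) \<eta> a) = ?x * ?u"
    using i_mult_ie_one[OF r \<eta>] by (simp add: ie_simps(7) right_diff_distrib)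
  have "(norm (?x * ?u))\<^sup>2 = norm (ie (adj (1 - ?h * a) * ?h * (1 - ?h * a)))"
  proof -
    have "adj (?x * ?u) * (?x * ?u) = adj ?u * (adj ?x * ?x) * ?u" by (simp add: adj_mult mult.assoc)
    also have "\<dots> = ie (adj (1 - ?h * a) * ?h * (1 - ?h * a))"
      unfolding xx by (simp only: flip: ie_simps(4) ie_simps(3))
    finally show ?thesis using cstar_identity[of "?x * ?u"] by simp
  qed
  also have "\<dots> < \<epsilon>\<^sup>2" using star_hom_contractive[OF ie_star_hom] a by (rule le_less_trans)
  finally have "norm (?x * ?u) < \<epsilon>" using \<open>0 < \<epsilon>\<close> by (simp add: power_less_imp_less_base)
  then show "\<exists>y\<in>M. norm (?x - y) < \<epsilon>"
    using mem[OF ract_closed[OF \<eta>, of a]] by (intro bexI[of _ "?x * adj ?x * i r (ract (fib X r) \<eta> a)"]) (simp_all add: diff)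
qed


subsection \<open>The fibres of the core\<close>

lemma induced_hom_is_induced:
  assumes "s \<in> P"
  shows "is_induced X cstar_of_type i s (induced_hom X cstar_of_type i s)"
proof -
  from nica assms have "\<exists>f. is_induced X cstar_of_type i s f" unfolding nica_covariant_def by blast
  then show ?thesis unfolding induced_hom_def by (rule someI_ex)
qed

lemma induced_hom_rank_one:
  "\<lbrakk>s \<in> P; \<xi> \<in> carrier (fib X s); \<eta> \<in> carrier (fib X s)\<rbrakk>
    \<Longrightarrow> induced_hom X cstar_of_type i s (rank_one (fib X s) \<xi> \<eta>) = i s \<xi> * adj (i s \<eta>)"
  using induced_hom_is_induced by (simp add: is_induced_def)

lemma rank_one_in_core_fibre:
  assumes "s \<in> P" and "\<xi> \<in> carrier (fib X s)" and "\<eta> \<in> carrier (fib X s)"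
  shows "i s \<xi> * adj (i s \<eta>) \<in> core_fibre X i s"
  unfolding core_fibre_def induced_hom_rank_one[OF assms, symmetric]
  by (intro imageI hilbert_module.rank_one_compact[OF fib_hilbert_module] assms)

lemma core_fibre_subset:
  assumes s: "s \<in> P"
  shows "core_fibre X i s \<subseteq>
    closed_cspan {i s \<xi> * adj (i s \<eta>) |\<xi> \<eta>. \<xi> \<in> carrier (fib X s) \<and> \<eta> \<in> carrier (fib X s)}"
proof -
  interpret hilbert_module "fib X s" using s by (rule fib_hilbert_module)
  let ?f = "induced_hom X cstar_of_type i s"
  have "?f T \<in> closed_cspan (?f ` rank_ones)" if "T \<in> compacts (fib X s)" for T
    using induced_hom_is_induced[OF s] that
    by (intro compact_image_closed_cspan) (simp_all add: is_induced_def star_hom_def)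
  moreover have "?f ` rank_ones =
      {i s \<xi> * adj (i s \<eta>) |\<xi> \<eta>. \<xi> \<in> carrier (fib X s) \<and> \<eta> \<in> carrier (fib X s)}"
    using induced_hom_rank_one[OF s] by (auto simp: image_iff) metis
  ultimately show ?thesis by (auto simp: core_fibre_def)
qed

text \<open>Two joins lie below each other, and \<open>P_inv\<close> is antisymmetry of the order;
  so the definite description in \<open>join\<close> denotes.\<close>

lemma is_join_join:
  assumes "s \<in> P" and "r \<in> P" and "joinable G P s r"
  shows "is_join G P s r (join G P s r)"
  unfolding join_def
proof (rule theI')
  obtain t where t: "is_join G P s r t"
    using join_exists assms P_carrier by blast
  have "u = t" if u: "is_join G P s r u" for u
  proof -
    have c: "t \<in> carrier G" "u \<in> carrier G" using t u by (auto simp: is_join_def P_carrier)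
    have "inv t \<otimes> u \<in> P" "inv u \<otimes> t \<in> P" using t u by (auto simp: is_join_def ple_def)
    moreover have "inv (inv u \<otimes> t) = inv t \<otimes> u" using c by (simp add: inv_mult_group)
    ultimately have "inv t \<otimes> u \<in> P \<inter> {inv s |s. s \<in> P}" by force
    then have "inv t \<otimes> u = \<one>" using P_inv by blast
    then show ?thesis using c by (metis inv_closed inv_equality inv_inv)
  qed
  with t show "\<exists>!t. is_join G P s r t" by blast
qed

text \<open>\<open>M\<close> is kept general so that it can be a preimage under multiplications on
  both sides. The complements \<open>u\<close> and \<open>v\<close> of \<open>s\<close> and
  \<open>r\<close> in their join enter through \<open>s \<otimes> u = r \<otimes> v\<close>; without
  a join the product is 0, which lies in \<open>M\<close>.\<close>

lemma nica_product:
  assumes s: "s \<in> P" "\<xi> \<in> carrier (fib X s)" and r: "r \<in> P" "\<eta> \<in> carrier (fib X r)"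
    and M: "closed_csubspace M"
    and mem: "\<And>u v \<alpha> \<beta>. \<lbrakk>u \<in> P; v \<in> P; s \<otimes> u = r \<otimes> v; \<alpha> \<in> carrier (fib X (s \<otimes> u));
      \<beta> \<in> carrier (fib X (s \<otimes> u))\<rbrakk> \<Longrightarrow> i (s \<otimes> u) \<alpha> * adj (i (s \<otimes> u) \<beta>) \<in> M"
  shows "(i s \<xi> * adj (i s \<xi>)) * (i r \<eta> * adj (i r \<eta>)) \<in> M"
proof -
  let ?S = "rank_one (fib X s) \<xi> \<xi>" and ?T = "rank_one (fib X r) \<eta> \<eta>" and ?w = "join G P s r"
  have ST: "?S \<in> compacts (fib X s)" "?T \<in> compacts (fib X r)"
    using s r by (auto intro: hilbert_module.rank_one_compact[OF fib_hilbert_module])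
  have eq: "(i s \<xi> * adj (i s \<xi>)) * (i r \<eta> * adj (i r \<eta>)) =
    (if joinable G P s r then induced_hom X cstar_of_type i ?w (iota_prod G P X s r ?S ?T) else 0)"
    using nica s r ST by (simp add: nica_covariant_def flip: induced_hom_rank_one)
  show ?thesis
  proof (cases "joinable G P s r")
    case True
    have w: "?w \<in> P" "inv s \<otimes> ?w \<in> P" "inv r \<otimes> ?w \<in> P"
      using is_join_join[OF s(1) r(1) True] by (auto simp: is_join_def ple_def)
    have sw: "s \<otimes> (inv s \<otimes> ?w) = ?w" "r \<otimes> (inv r \<otimes> ?w) = ?w"
      using w(1) s(1) r(1) P_carrier by (simp_all flip: m_assoc)
    have "induced_hom X cstar_of_type i ?w (iota_prod G P X s r ?S ?T) \<in> core_fibre X i ?w"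
      unfolding core_fibre_def by (intro imageI compactly_aligned s r True ST)
    also have "\<dots> \<subseteq> M"
      using mem[OF w(2,3)] sw
      by (intro order_trans[OF core_fibre_subset[OF w(1)] closed_cspan_minimal[OF M]]) auto
    finally show ?thesis using True eq by simp
  next
    case False
    then show ?thesis using eq closed_csubspaceD(2)[OF M] by simp
  qed
qed


subsection \<open>Products of the spanning elements\<close>

text \<open>On elementary tensors, \<open>adj (i r \<eta>) * i r \<xi>\<close> is the coefficient
  \<open>ie (hinner (fib X r) \<eta> \<xi>)\<close>, which acts on the fibre over \<open>u\<close>.
  The tensor product condition is imposed only away from the unit, hence the cases; at the unit the
  left action or the inner product gives the result.\<close>

lemma adj_i_mult_i_factor:
  assumes r: "r \<in> P" "\<eta> \<in> carrier (fib X r)" and u: "u \<in> P"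
    and \<alpha>: "\<alpha> \<in> carrier (fib X (r \<otimes> u))"
  shows "adj (i r \<eta>) * i (r \<otimes> u) \<alpha> \<in> closed_cspan (i u ` carrier (fib X u))"
proof -
  let ?R = "closed_cspan (i u ` carrier (fib X u))"
  have R: "closed_csubspace ?R" by (rule closed_csubspace_closed_cspan)
  consider "r = \<one>" | "u = \<one>" | "r \<noteq> \<one>" "u \<noteq> \<one>" by blast
  then show ?thesis
  proof cases
    case 1
    obtain a where "\<eta> = emb X a" using r 1 emb_bij by (auto simp: bij_betw_def)
    then have "adj (i r \<eta>) = ie (adj a)" using 1 by (simp add: ie_def ie_simps(4)[symmetric, unfolded ie_def])
    then show ?thesis
      using 1 u \<alpha> by (auto simp: P_carrier i_lact lact_closed intro!: closed_cspan_superset)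
  next
    case 2
    then show ?thesis
      using r \<alpha> by (auto simp: P_carrier i_inner ie_def emb_closed intro!: closed_cspan_superset)
  next
    case 3
    let ?Z = "fib X (r \<otimes> u)" and ?T = "{pmul X r u \<xi> \<zeta> |\<xi> \<zeta>. \<xi> \<in> carrier (fib X r) \<and> \<zeta> \<in> carrier (fib X u)}"
    have ru: "r \<otimes> u \<in> P" using r(1) u by (rule P_mult)
    interpret Z: hilbert_module ?Z using ru by (rule fib_hilbert_module)
    have T: "?T \<subseteq> carrier ?Z" using r(1) u pmul_closed by auto
    have M: "closed_csubspace {y. adj (i r \<eta>) * y \<in> ?R}" by (rule closed_csubspace_mult_left[OF R])
    have "i (r \<otimes> u) \<alpha> \<in> {y. adj (i r \<eta>) * y \<in> ?R}"
    proof (rule in_closed_approx[OF closed_csubspaceD(1)[OF M]])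
      fix \<epsilon> :: real assume "0 < \<epsilon>"
      then obtain \<omega> where \<omega>: "\<omega> \<in> vspan ?Z ?T" "hnorm ?Z (vdiff ?Z \<alpha> \<omega>) < \<epsilon>"
        using pmul_tensor[OF r(1) u 3] \<alpha> unfolding is_tensor_product_def by blast
      have \<omega>c: "\<omega> \<in> carrier ?Z" using T \<omega>(1) by (rule Z.vspan_closed)
      have "i (r \<otimes> u) (vdiff ?Z \<alpha> \<omega>) = i (r \<otimes> u) \<alpha> - i (r \<otimes> u) \<omega>"
        using ru \<alpha> \<omega>c by (simp add: vdiff_def i_vadd i_vscale Z.vscale_closed scaleC_minus_one)
      then have "norm (i (r \<otimes> u) \<alpha> - i (r \<otimes> u) \<omega>) < \<epsilon>"
        using norm_i_le[OF ru Z.vdiff_closed[OF \<alpha> \<omega>c]] \<omega>(2) by simp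
      moreover have "i (r \<otimes> u) ` ?T \<subseteq> {y. adj (i r \<eta>) * y \<in> ?R}"
      proof clarify
        fix \<xi> \<zeta> assume c: "\<xi> \<in> carrier (fib X r)" "\<zeta> \<in> carrier (fib X u)"
        have "adj (i r \<eta>) * i (r \<otimes> u) (pmul X r u \<xi> \<zeta>) = i u (lact (fib X u) (hinner (fib X r) \<eta> \<xi>) \<zeta>)"
          using r u c by (simp add: i_inner i_lact flip: i_mult mult.assoc)
        then show "adj (i r \<eta>) * i (r \<otimes> u) (pmul X r u \<xi> \<zeta>) \<in> ?R"
          using u c by (auto simp: lact_closed intro!: closed_cspan_superset)
      qed
      then have "i (r \<otimes> u) \<omega> \<in> {y. adj (i r \<eta>) * y \<in> ?R}"
        using linear_map_vspan[OF fib_complex_vec[OF ru] complex_vec_cstar_of_type i_linear_map[OF ru] T \<omega>(1)]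
          closed_cspan_minimal[OF M] closure_subset unfolding closed_cspan_def by blast
      ultimately show "\<exists>y\<in>{y. adj (i r \<eta>) * y \<in> ?R}. norm (i (r \<otimes> u) \<alpha> - y) < \<epsilon>" by blast
    qed
    then show ?thesis by simp
  qed
qed

text \<open>Approximating both generators puts a product as in \<open>nica_product\<close> in the
  middle, which moves to the fibre over \<open>r \<otimes> u = t \<otimes> v\<close>. The outer
  factors then strip \<open>r\<close> on the left and \<open>t\<close> on the right, leaving the
  indices \<open>u\<close> and \<open>v\<close>.\<close>

lemma adj_i_mult_i:
  assumes r: "r \<in> P" "\<eta> \<in> carrier (fib X r)" and t: "t \<in> P" "\<zeta> \<in> carrier (fib X t)"
  shows "adj (i r \<eta>) * i t \<zeta> \<in> closed_cspan {i u \<alpha> * adj (i v \<beta>) |u v \<alpha> \<beta>.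
    u \<in> P \<and> v \<in> P \<and> r \<otimes> u = t \<otimes> v \<and> \<alpha> \<in> carrier (fib X u) \<and> \<beta> \<in> carrier (fib X v)}"
    (is "_ \<in> closed_cspan ?S")
proof -
  let ?M = "closed_cspan ?S"
  note M = closed_csubspace_closed_cspan[of ?S]
  \<comment> \<open>Extends from generators to closed spans in one variable at a time, first in
    \<open>q\<close>, conjugate-linearly, then in \<open>p\<close>.\<close>
  have factor: "p * adj q \<in> ?M"
    if uv: "u \<in> P" "v \<in> P" "r \<otimes> u = t \<otimes> v"
      and p: "p \<in> closed_cspan (i u ` carrier (fib X u))" and q: "q \<in> closed_cspan (i v ` carrier (fib X v))"
    for u v p q
  proof -
    have 1: "i u \<alpha> * adj q \<in> ?M" if "\<alpha> \<in> carrier (fib X u)" for \<alpha>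
    proof -
      have "closed_csubspace {y. i u \<alpha> * adj y \<in> ?M}"
        using closed_csubspace_adj[OF closed_csubspace_mult_left[OF M]] by simp
      moreover have "i v ` carrier (fib X v) \<subseteq> {y. i u \<alpha> * adj y \<in> ?M}"
      proof clarify
        fix \<beta> assume "\<beta> \<in> carrier (fib X v)"
        with that uv have "i u \<alpha> * adj (i v \<beta>) \<in> ?S" by blast
        then show "i u \<alpha> * adj (i v \<beta>) \<in> ?M" by (rule closed_cspan_superset)
      qed
      ultimately have "closed_cspan (i v ` carrier (fib X v)) \<subseteq> {y. i u \<alpha> * adj y \<in> ?M}"
        by (rule closed_cspan_minimal)
      with q show ?thesis by blast
    qed
    from closed_cspan_minimal[OF closed_csubspace_mult_right[OF M], of "i u ` carrier (fib X u)" "adj q"] p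
    show ?thesis using 1 by auto
  qed
  have main: "adj (i r \<eta>') * ((i r \<eta> * adj (i r \<eta>)) * (i t \<zeta> * adj (i t \<zeta>))) * i t \<zeta>' \<in> ?M"
    if c: "\<eta>' \<in> carrier (fib X r)" "\<zeta>' \<in> carrier (fib X t)" for \<eta>' \<zeta>'
  proof -
    have "(i r \<eta> * adj (i r \<eta>)) * (i t \<zeta> * adj (i t \<zeta>)) \<in> {y. adj (i r \<eta>') * y \<in> {y. y * i t \<zeta>' \<in> ?M}}"
    proof (rule nica_product[OF r t closed_csubspace_mult_left[OF closed_csubspace_mult_right[OF M]]])
      fix u v \<alpha> \<beta>
      assume uv: "u \<in> P" "v \<in> P" "r \<otimes> u = t \<otimes> v"
        and ab: "\<alpha> \<in> carrier (fib X (r \<otimes> u))" "\<beta> \<in> carrier (fib X (r \<otimes> u))"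
      have "(adj (i r \<eta>') * i (r \<otimes> u) \<alpha>) * adj (adj (i t \<zeta>') * i (t \<otimes> v) \<beta>) \<in> ?M"
        using r t c uv ab by (intro factor[OF uv] adj_i_mult_i_factor) auto
      then show "i (r \<otimes> u) \<alpha> * adj (i (r \<otimes> u) \<beta>) \<in> {y. adj (i r \<eta>') * y \<in> {y. y * i t \<zeta>' \<in> ?M}}"
        by (simp add: uv(3) adj_mult adj_adj mult.assoc)
    qed
    then show ?thesis by simp
  qed
  \<comment> \<open>Removes the auxiliary vector \<open>\<eta>'\<close>, after taking adjoints
    because \<open>\<eta>\<close> occurs starred; \<open>\<zeta>'\<close> goes afterwards on the
    other side.\<close>
  have 1: "adj (i r \<eta>) * (i t \<zeta> * adj (i t \<zeta>) * i t \<zeta>') \<in> ?M" if "\<zeta>' \<in> carrier (fib X t)" for \<zeta>'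
  proof -
    have "closed_csubspace {y. adj y \<in> {y. y * (i t \<zeta> * adj (i t \<zeta>) * i t \<zeta>') \<in> ?M}}"
      by (intro closed_csubspace_adj closed_csubspace_mult_right M)
    from i_approximation[OF r closed_csubspaceD(1)[OF this]] show ?thesis
      using main[OF _ that] by (simp add: adj_mult adj_adj mult.assoc)
  qed
  from i_approximation[OF t closed_csubspaceD(1)[OF closed_csubspace_mult_left[OF M]]] 1
  show ?thesis by blast
qed

text \<open>
  The closed spans of the elements \<open>i\<^sub>s(\<xi>)i\<^sub>r(\<eta>)\<^sup>*\<close> with \<open>Q s r\<close> cover both the whole algebra
  and the core.
\<close>

definition spanning :: "('g \<Rightarrow> 'g \<Rightarrow> bool) \<Rightarrow> 'c set" where
  "spanning Q = {i s \<xi> * adj (i r \<eta>) |s r \<xi> \<eta>.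
     s \<in> P \<and> r \<in> P \<and> Q s r \<and> \<xi> \<in> carrier (fib X s) \<and> \<eta> \<in> carrier (fib X r)}"

lemma spanning_adj:
  assumes "\<And>s r. Q s r \<Longrightarrow> Q r s" and "x \<in> closed_cspan (spanning Q)"
  shows "adj x \<in> closed_cspan (spanning Q)"
proof -
  have "spanning Q \<subseteq> {x. adj x \<in> closed_cspan (spanning Q)}"
  proof
    fix z assume "z \<in> spanning Q"
    then obtain s r \<xi> \<eta> where z: "z = i s \<xi> * adj (i r \<eta>)" "s \<in> P" "r \<in> P" "Q s r"
        "\<xi> \<in> carrier (fib X s)" "\<eta> \<in> carrier (fib X r)"
      unfolding spanning_def by blast
    then have "i r \<eta> * adj (i s \<xi>) \<in> spanning Q" unfolding spanning_def using assms(1) by blast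
    then show "z \<in> {x. adj x \<in> closed_cspan (spanning Q)}"
      by (simp add: z(1) adj_mult adj_adj closed_cspan_superset)
  qed
  from closed_cspan_minimal[OF closed_csubspace_adj[OF closed_csubspace_closed_cspan] this] assms(2)
  show ?thesis by blast
qed

text \<open>If the inner factor \<open>adj (i r \<eta>) * i t \<zeta>\<close> contributes indices
  \<open>u, v\<close> with \<open>r u = t v\<close>, the product has indices \<open>s u\<close> and
  \<open>q v\<close>. For equality as \<open>Q\<close> one has \<open>s u = r u = t v = q v\<close>,
  so the core is closed under products.\<close>

lemma spanning_mult:
  assumes Q: "\<And>s r t q u v. \<lbrakk>s \<in> P; r \<in> P; t \<in> P; q \<in> P; u \<in> P; v \<in> P; Q s r; Q t q; r \<otimes> u = t \<otimes> v\<rbrakk>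
      \<Longrightarrow> Q (s \<otimes> u) (q \<otimes> v)"
    and x: "x \<in> closed_cspan (spanning Q)" and y: "y \<in> closed_cspan (spanning Q)"
  shows "x * y \<in> closed_cspan (spanning Q)"
proof -
  let ?M = "closed_cspan (spanning Q)"
  note M = closed_csubspace_closed_cspan[of "spanning Q"]
  have gen: "(i s \<xi> * adj (i r \<eta>)) * (i t \<zeta> * adj (i q \<kappa>)) \<in> ?M"
    if s: "s \<in> P" "\<xi> \<in> carrier (fib X s)" and r: "r \<in> P" "\<eta> \<in> carrier (fib X r)"
      and t: "t \<in> P" "\<zeta> \<in> carrier (fib X t)" and q: "q \<in> P" "\<kappa> \<in> carrier (fib X q)"
      and sr: "Q s r" and tq: "Q t q" for s r t q \<xi> \<eta> \<zeta> \<kappa>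
  proof -
    have "adj (i r \<eta>) * i t \<zeta> \<in> {y. i s \<xi> * y \<in> {y. y * adj (i q \<kappa>) \<in> ?M}}"
    proof (rule subsetD[OF closed_cspan_minimal adj_i_mult_i[OF r t]])
      show "closed_csubspace {y. i s \<xi> * y \<in> {y. y * adj (i q \<kappa>) \<in> ?M}}"
        by (intro closed_csubspace_mult_left closed_csubspace_mult_right M)
      show "{i u \<alpha> * adj (i v \<beta>) |u v \<alpha> \<beta>.
        u \<in> P \<and> v \<in> P \<and> r \<otimes> u = t \<otimes> v \<and> \<alpha> \<in> carrier (fib X u) \<and> \<beta> \<in> carrier (fib X v)}
        \<subseteq> {y. i s \<xi> * y \<in> {y. y * adj (i q \<kappa>) \<in> ?M}}"
      proof clarify
        fix u v \<alpha> \<beta>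
        assume c: "u \<in> P" "v \<in> P" "r \<otimes> u = t \<otimes> v" "\<alpha> \<in> carrier (fib X u)" "\<beta> \<in> carrier (fib X v)"
        have "i s \<xi> * (i u \<alpha> * adj (i v \<beta>)) * adj (i q \<kappa>) = (i s \<xi> * i u \<alpha>) * adj (i q \<kappa> * i v \<beta>)"
          by (simp add: adj_mult mult.assoc)
        also have "\<dots> = i (s \<otimes> u) (pmul X s u \<xi> \<alpha>) * adj (i (q \<otimes> v) (pmul X q v \<kappa> \<beta>))"
          using s q c by (simp add: i_mult)
        also have "\<dots> \<in> spanning Q"
          unfolding spanning_def using s q c P_mult pmul_closed Q[OF s(1) r(1) t(1) q(1) c(1,2) sr tq c(3)] by blast
        finally show "i s \<xi> * (i u \<alpha> * adj (i v \<beta>)) * adj (i q \<kappa>) \<in> ?M" by (rule closed_cspan_superset)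
      qed
    qed
    then show ?thesis by (simp add: mult.assoc)
  qed
  have 1: "z * y \<in> ?M" if z: "z \<in> spanning Q" for z
  proof -
    have "spanning Q \<subseteq> {y. z * y \<in> ?M}"
    proof
      fix w assume w: "w \<in> spanning Q"
      show "w \<in> {y. z * y \<in> ?M}" using z w gen unfolding spanning_def by blast
    qed
    from closed_cspan_minimal[OF closed_csubspace_mult_left[OF M] this] y show ?thesis by blast
  qed
  have "spanning Q \<subseteq> {x. x * y \<in> ?M}" using 1 by blast
  from closed_cspan_minimal[OF closed_csubspace_mult_right[OF M] this] x show ?thesis by blast
qed

section \<open>Density of the spanning elements, and the core as an algebra\<close>

lemma ie_one_selfadjoint: "adj (ie 1) = ie 1"
  by (metis adj_adj adj_mult ie_simps(4) mult_1_left mult_1_right)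

lemma closed_cspan_spanning_UNIV: "closed_cspan (spanning (\<lambda>s r. True)) = UNIV"
proof (rule generating)
  show "closed_star_subalgebra (closed_cspan (spanning (\<lambda>s r. True)))"
    unfolding closed_star_subalgebra_def
    using closed_csubspaceD[OF closed_csubspace_closed_cspan[of "spanning (\<lambda>s r. True)"]]
      spanning_mult[of "\<lambda>s r. True"]
      spanning_adj[of "\<lambda>s r. True"] by simp
  fix s \<xi> assume s: "s \<in> P" "\<xi> \<in> carrier (fib X s)"
  \<comment> \<open>The right unit \<open>ie 1\<close> exhibits each generator as a spanning
    element.\<close>
  have "i s \<xi> = i s \<xi> * adj (i \<one> (emb X 1))"
    using i_mult_ie_one[OF s] ie_one_selfadjoint by (simp add: ie_def)
  also have "\<dots> \<in> spanning (\<lambda>s r. True)"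
    unfolding spanning_def using s one_in_P emb_closed by blast
  finally show "i s \<xi> \<in> closed_cspan (spanning (\<lambda>s r. True))" by (rule closed_cspan_superset)
qed

lemma core_eq: "core P X i = closed_cspan (spanning (=))"
  unfolding core_def closed_cspan_def spanning_def
  by (rule arg_cong[where f = "\<lambda>S. closure (vspan cstar_of_type S)"]) blast

lemma core_closed_csubspace: "closed_csubspace (core P X i)"
  unfolding core_eq by (rule closed_csubspace_closed_cspan)

lemma core_mult: "x \<in> core P X i \<Longrightarrow> y \<in> core P X i \<Longrightarrow> x * y \<in> core P X i"
  unfolding core_eq by (rule spanning_mult) auto

lemma core_adj: "x \<in> core P X i \<Longrightarrow> adj x \<in> core P X i"
  unfolding core_eq by (rule spanning_adj) auto

lemma core_generator:
  "\<lbrakk>s \<in> P; \<xi> \<in> carrier (fib X s); \<eta> \<in> carrier (fib X s)\<rbrakk> \<Longrightarrow> i s \<xi> * adj (i s \<eta>) \<in> core P X i"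
  unfolding core_eq by (rule closed_cspan_superset) (auto simp: spanning_def)

lemma core_fibre_subset_core:
  assumes "s \<in> P"
  shows "core_fibre X i s \<subseteq> core P X i"
  using core_generator[OF assms]
  by (intro order_trans[OF core_fibre_subset[OF assms] closed_cspan_minimal[OF core_closed_csubspace]]) blast

end


section \<open>States\<close>

lemma states_UNIV_D:
  assumes "\<omega> \<in> states UNIV"
  shows "\<omega> (x + y) = \<omega> x + \<omega> y" "\<omega> (c *\<^sub>C x) = c * \<omega> x" "\<omega> (adj x * x) \<in> \<real>\<^sub>\<ge>\<^sub>0"
    "cmod (\<omega> x) \<le> norm x" "k < 1 \<Longrightarrow> \<exists>x. norm x \<le> 1 \<and> k < cmod (\<omega> x)"
  using assms by (simp_all add: states_def)

lemma states_UNIV_diff: "\<omega> \<in> states UNIV \<Longrightarrow> \<omega> (x - y) = \<omega> x - \<omega> y"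
  using states_UNIV_D(1)[of \<omega> "x - y" y] by simp

lemma state_quadratic:
  assumes "\<omega> \<in> states UNIV"
  shows "\<omega> (adj (x + c *\<^sub>C y) * (x + c *\<^sub>C y)) =
    \<omega> (adj x * x) + c * \<omega> (adj x * y) + cnj c * \<omega> (adj y * x) + (cnj c * c) * \<omega> (adj y * y)"
proof -
  have "adj (x + c *\<^sub>C y) * (x + c *\<^sub>C y) =
      adj x * x + c *\<^sub>C (adj x * y) + cnj c *\<^sub>C (adj y * x) + (cnj c * c) *\<^sub>C (adj y * y)"
    by (simp add: adj_add adj_scaleC distrib_left distrib_right scaleC_simps mult.commute)
  then show ?thesis by (simp only: states_UNIV_D[OF assms])
qed

text \<open>The imaginary part of the form at \<open>x + c *\<^sub>C y\<close> vanishes;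
  \<open>c = 1\<close> compares imaginary parts, \<open>c = \<i>\<close> real parts.\<close>

lemma state_hermitian:
  assumes "\<omega> \<in> states UNIV"
  shows "\<omega> (adj y * x) = cnj (\<omega> (adj x * y))"
proof -
  have Im: "Im (\<omega> (adj z * z)) = 0" for z
    using states_UNIV_D(3)[OF assms, of z] by (auto simp: complex_nonneg_Reals_iff)
  have "Im (\<omega> (adj x * y) + \<omega> (adj y * x)) = 0"
    using Im[of "x + 1 *\<^sub>C y"] Im[of x] Im[of y] state_quadratic[OF assms, of x 1 y] by simp
  moreover have "Im (\<i> * \<omega> (adj x * y) - \<i> * \<omega> (adj y * x)) = 0"
    using Im[of "x + \<i> *\<^sub>C y"] Im[of x] Im[of y] state_quadratic[OF assms, of x \<i> y] by simp
  ultimately show ?thesis by (simp add: complex_eq_iff)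
qed

lemma state_Cauchy_Schwarz:
  assumes "\<omega> \<in> states UNIV"
  shows "(cmod (\<omega> (adj y * x)))\<^sup>2 \<le> Re (\<omega> (adj y * y)) * Re (\<omega> (adj x * x))"
proof -
  define a b d where "a = Re (\<omega> (adj x * x))" and "b = Re (\<omega> (adj y * y))" and "d = \<omega> (adj y * x)"
  have pos: "0 \<le> Re (\<omega> (adj z * z))" for z
    using states_UNIV_D(3)[OF assms, of z] by (auto simp: complex_nonneg_Reals_iff)
  have b0: "0 \<le> b" and a0: "0 \<le> a" using pos by (simp_all add: a_def b_def)
  have dd: "Re (d * cnj d) = (cmod d)\<^sup>2" "Re (cnj d * d) = (cmod d)\<^sup>2"
    using cmod_power2[of d] by (simp_all add: power2_eq_square)
  \<comment> \<open>Positivity at \<open>x - t d y\<close>; the factor \<open>d\<close> makes both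
    mixed terms equal to \<open>- t * (cmod d)\<^sup>2\<close>.\<close>
  have key: "0 \<le> a - 2 * t * (cmod d)\<^sup>2 + t\<^sup>2 * (cmod d)\<^sup>2 * b" for t :: real
  proof -
    let ?c = "- (of_real t * d)"
    have "0 \<le> Re (\<omega> (adj x * x) + ?c * cnj d + cnj ?c * d + (cnj ?c * ?c) * \<omega> (adj y * y))"
      using pos[of "x + ?c *\<^sub>C y"] unfolding state_quadratic[OF assms]
      by (simp only: d_def state_hermitian[OF assms, of x y])
    also have "cnj ?c * ?c = of_real (t\<^sup>2 * (cmod d)\<^sup>2)"
      using complex_norm_square[of d] by (simp add: power2_eq_square mult_ac)
    also have "Re (\<omega> (adj x * x) + ?c * cnj d + cnj ?c * d + of_real (t\<^sup>2 * (cmod d)\<^sup>2) * \<omega> (adj y * y)) =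
        a - t * Re (d * cnj d) - t * Re (cnj d * d) + t\<^sup>2 * (cmod d)\<^sup>2 * b"
      by (simp add: a_def b_def algebra_simps)
    finally show ?thesis unfolding dd by (simp add: algebra_simps)
  qed
  show ?thesis
  proof (cases "b = 0")
    case True
    have "d = 0"
    proof (rule ccontr)
      assume "d \<noteq> 0"
      \<comment> \<open>For \<open>b = 0\<close> the bound is affine in \<open>t\<close>, and this
        \<open>t\<close> makes it \<open>-1\<close>.\<close>
      then have "0 \<le> a - (a + 1)" using key[of "(a + 1) / (2 * (cmod d)\<^sup>2)"] True by simp
      then show False by simp
    qed
    then show ?thesis using a0 b0 by (simp add: d_def[symmetric] a_def b_def)
  next
    case False
    with b0 have "0 < b" by simp
    have "0 \<le> a - (cmod d)\<^sup>2 / b"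
      using key[of "1 / b"] \<open>0 < b\<close> by (simp add: power2_eq_square field_simps)
    then have "(cmod d)\<^sup>2 \<le> b * a" using \<open>0 < b\<close> by (simp add: field_simps)
    then show ?thesis by (simp only: a_def b_def d_def)
  qed
qed

lemma closed_csubspace_kernel:
  fixes L :: "'c::cstar_algebra \<Rightarrow> complex"
  assumes add: "\<And>x y. L (x + y) = L x + L y" and scale: "\<And>c x. L (c *\<^sub>C x) = c * L x"
    and bd: "\<And>x. cmod (L x) \<le> norm x * K"
  shows "closed_csubspace {x. L x = 0}"
proof -
  have bl: "bounded_linear L"
    by (rule bounded_linear_intro[where K = K])
      (simp_all add: add bd scaleR_conv_of_real scale flip: scaleC_of_real)
  have "closed (L -` {0})"
    by (intro continuous_closed_vimage linear_continuous_at bl) simp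
  then have "closed {x. L x = 0}" by (simp add: vimage_def)
  moreover have "L 0 = 0" using scale[of 0 0] by simp
  ultimately show ?thesis by (simp add: closed_csubspace_def add scale)
qed

text \<open>In a nonunital algebra the norm of a convex combination is controlled through \<open>p\<close>.\<close>

lemma convex_comb_states:
  assumes F: "closed_csubspace F" "\<And>x y. x \<in> F \<Longrightarrow> y \<in> F \<Longrightarrow> x * y \<in> F" "\<And>x. x \<in> F \<Longrightarrow> adj x \<in> F"
    and \<phi>: "\<phi> \<in> states F" "\<phi>' \<in> states F" and t: "t \<in> {0..1}"
    and p: "p \<in> F" "norm p \<le> 1" "\<phi> p = 1" "\<phi>' p = 1"
  shows "convex_comb F t \<phi> \<phi>' \<in> states F"
proof -
  have F': "x + y \<in> F" "c *\<^sub>C x \<in> F" "adj x * x \<in> F" if "x \<in> F" "y \<in> F" for x y c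
    using F that by (auto simp: closed_csubspace_def)
  have lin: "\<phi> (x + y) = \<phi> x + \<phi> y" "\<phi> (c *\<^sub>C x) = c * \<phi> x" "\<phi>' (x + y) = \<phi>' x + \<phi>' y"
    "\<phi>' (c *\<^sub>C x) = c * \<phi>' x" if "x \<in> F" "y \<in> F" for x y c
    using \<phi> that by (auto simp: states_def)
  have pos: "\<phi> (adj x * x) \<in> \<real>\<^sub>\<ge>\<^sub>0" "\<phi>' (adj x * x) \<in> \<real>\<^sub>\<ge>\<^sub>0" if "x \<in> F" for x
    using \<phi> that by (auto simp: states_def)
  have bd: "cmod (\<phi> x) \<le> norm x" "cmod (\<phi>' x) \<le> norm x" if "x \<in> F" for x
    using \<phi> that by (auto simp: states_def)
  have "cmod (complex_of_real t * \<phi> x + complex_of_real (1 - t) * \<phi>' x) \<le> norm x" if x: "x \<in> F" for x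
  proof -
    have "cmod (complex_of_real t * \<phi> x + complex_of_real (1 - t) * \<phi>' x) \<le>
        t * cmod (\<phi> x) + (1 - t) * cmod (\<phi>' x)"
      using t norm_triangle_ineq[of "complex_of_real t * \<phi> x" "complex_of_real (1 - t) * \<phi>' x"]
      by (simp only: norm_mult norm_of_real) simp
    also have "\<dots> \<le> t * norm x + (1 - t) * norm x"
      using t bd[OF x] by (intro add_mono mult_left_mono) auto
    finally show ?thesis by (simp add: algebra_simps)
  qed
  moreover have "\<exists>x\<in>F. norm x \<le> 1 \<and> k < cmod (convex_comb F t \<phi> \<phi>' x)" if "k < 1" for k
    using p that by (intro bexI[of _ p]) (simp_all add: convex_comb_def)
  moreover have "complex_of_real t * \<phi> (adj x * x) + complex_of_real (1 - t) * \<phi>' (adj x * x) \<in> \<real>\<^sub>\<ge>\<^sub>0"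
    if "x \<in> F" for x
  proof -
    have "complex_of_real t \<in> \<real>\<^sub>\<ge>\<^sub>0" "complex_of_real (1 - t) \<in> \<real>\<^sub>\<ge>\<^sub>0"
      using t by (simp_all only: nonneg_Reals_of_real_iff) auto
    then show ?thesis using pos[OF that] by (intro nonneg_Reals_add_I nonneg_Reals_mult_I)
  qed
  ultimately show ?thesis
    by (simp add: states_def convex_comb_def F' lin algebra_simps)
qed


section \<open>Ground states\<close>

lemma bounded_linear_scaleC_left: "bounded_linear (\<lambda>c. c *\<^sub>C (x :: 'c::cstar_algebra))"
  by (rule bounded_linear_intro[where K = "norm x"]) (simp_all add: scaleC_simps norm_scaleC)

lemma entire_fun_exp_scaleC: "entire_fun (\<lambda>z. exp (a * z) *\<^sub>C (x :: 'c::cstar_algebra))"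
  unfolding entire_fun_def
proof
  fix z
  have "((\<lambda>z. exp (a * z)) has_field_derivative exp (a * z) * a) (at z)"
    by (auto intro!: derivative_eq_intros)
  then have "((\<lambda>h. (exp (a * (z + h)) - exp (a * z)) / h) \<longlongrightarrow> exp (a * z) * a) (at 0)"
    by (simp add: DERIV_def)
  from bounded_linear.tendsto[OF bounded_linear_scaleC_left[of x] this]
  show "\<exists>l. ((\<lambda>h. inverse h *\<^sub>C (exp (a * (z + h)) *\<^sub>C x - exp (a * z) *\<^sub>C x)) \<longlongrightarrow> l) (at 0)"
    by (auto simp: scaleC_diff_left scaleC_diff_right scaleC_scaleC diff_divide_distrib field_simps)
qed

lemma dynamicsD:
  assumes "dynamics \<sigma>"
  shows "star_hom cstar_of_type cstar_of_type (\<sigma> t)" "\<sigma> (s + t) x = \<sigma> s (\<sigma> t x)"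
  using assms by (auto simp: dynamics_def)

lemma dynamics_contractive: "dynamics \<sigma> \<Longrightarrow> norm (\<sigma> t x) \<le> norm x"
  by (rule star_hom_contractive[OF dynamicsD(1)])

lemma zero_islimpt_Reals: "(0 :: complex) islimpt \<real>"
  unfolding islimpt_approachable
proof (intro allI impI)
  fix e :: real assume "0 < e"
  then show "\<exists>x'\<in>\<real>. x' \<noteq> 0 \<and> dist x' (0 :: complex) < e"
    by (intro bexI[of _ "of_real (e / 2)"]) (auto simp del: of_real_divide)
qed

text \<open>After \<open>\<omega>\<close> is applied, both sides are entire in \<open>w\<close>; on
  the real line they agree by the group law of \<open>\<sigma>\<close>, so the identity theorem
  applies.\<close>

lemma state_entire_extension_shift:
  assumes dyn: "dynamics \<sigma>" and \<omega>: "\<omega> \<in> states UNIV" and f: "is_entire_extension \<sigma> d f"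
  shows "\<omega> (c * f (complex_of_real x + w)) = \<omega> (c * \<sigma> x (f w))"
proof -
  note \<sigma> = star_hom_cstarD[OF dynamicsD(1)[OF dyn]]
  have f': "entire_fun f" "\<And>t. f (complex_of_real t) = \<sigma> t d"
    using f by (auto simp: is_entire_extension_def)
  have bd: "cmod (\<omega> (c * y)) \<le> norm c * norm y" for y
    using states_UNIV_D(4)[OF \<omega>, of "c * y"] norm_mult_ineq[of c y] by linarith
  have hol1: "(\<lambda>z. \<omega> (c * f z)) holomorphic_on UNIV"
    using bd by (intro entire_fun_linear_functional[OF f'(1), where K = "norm c"])
      (simp_all add: distrib_left mult_scaleC_right states_UNIV_D[OF \<omega>] mult.commute)
  have hol2: "(\<lambda>z. \<omega> (c * \<sigma> x (f z))) holomorphic_on UNIV"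
  proof (rule entire_fun_linear_functional[OF f'(1), where K = "norm c"])
    show "cmod (\<omega> (c * \<sigma> x y)) \<le> norm y * norm c" for y
      using bd[of "\<sigma> x y"] mult_left_mono[OF dynamics_contractive[OF dyn, of x y] norm_ge_zero[of c]]
      by (simp add: mult.commute)
  qed (simp_all add: \<sigma> distrib_left mult_scaleC_right states_UNIV_D[OF \<omega>])
  have hol3: "(\<lambda>z. \<omega> (c * f (complex_of_real x + z))) holomorphic_on UNIV"
    using holomorphic_on_compose[of "\<lambda>z. complex_of_real x + z" UNIV "\<lambda>z. \<omega> (c * f z)"] hol1
    by (simp add: o_def holomorphic_on_subset[OF hol1] holomorphic_intros)
  have "\<omega> (c * f (complex_of_real x + w)) - \<omega> (c * \<sigma> x (f w)) = 0"
  proof (rule analytic_continuation[where S = UNIV and U = \<real> and \<xi> = 0 and w = w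
        and f = "\<lambda>w. \<omega> (c * f (complex_of_real x + w)) - \<omega> (c * \<sigma> x (f w))"])
    show "(\<lambda>w. \<omega> (c * f (complex_of_real x + w)) - \<omega> (c * \<sigma> x (f w))) holomorphic_on UNIV"
      by (intro holomorphic_on_diff hol2 hol3)
    fix z :: complex assume "z \<in> \<real>"
    then obtain t where "z = complex_of_real t" by (auto elim: Reals_cases)
    moreover have "f (complex_of_real (x + t)) = \<sigma> x (\<sigma> t d)"
      unfolding f'(2) by (rule dynamicsD(2)[OF dyn])
    ultimately show "\<omega> (c * f (complex_of_real x + z)) - \<omega> (c * \<sigma> x (f z)) = 0"
      by (simp add: f'(2))
  qed (auto simp: zero_islimpt_Reals)
  then show ?thesis by simp
qed

text \<open>
  \<open>g\<close> takes the place of \<open>z \<mapsto> \<omega>(c\<sigma>\<^sub>z(d))\<close>. For an arbitrary analytic \<open>d\<close> this function is bounded on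
  horizontal strips, because translation by a real number acts through the contraction \<open>\<sigma>\<^sub>x\<close>.
\<close>

lemma ground_states_of_spanning_set:
  assumes dyn: "dynamics \<sigma>" and \<omega>: "\<omega> \<in> states UNIV" and S: "closed_cspan S = UNIV"
    and gen: "\<And>c d. d \<in> S \<Longrightarrow> \<exists>g K. g holomorphic_on UNIV \<and>
      (\<forall>w. 0 \<le> Im w \<longrightarrow> cmod (g w) \<le> K) \<and> (\<forall>t. g (complex_of_real t) = \<omega> (c * \<sigma> t d))"
  shows "\<omega> \<in> ground_states \<sigma>"
proof -
  note \<sigma> = star_hom_cstarD[OF dynamicsD(1)[OF dyn]]
  have bd: "cmod (\<omega> (c * y)) \<le> norm c * norm y" for c y
    using states_UNIV_D(4)[OF \<omega>, of "c * y"] norm_mult_ineq[of c y] by linarith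
  have sbd: "cmod (\<omega> (c * \<sigma> t y)) \<le> norm c * norm y" for c t y
    using bd[of c "\<sigma> t y"] mult_left_mono[OF dynamics_contractive[OF dyn, of t y] norm_ge_zero[of c]]
    by linarith
  have lin: "\<omega> (c * \<sigma> t (x + y)) = \<omega> (c * \<sigma> t x) + \<omega> (c * \<sigma> t y)"
    "\<omega> (c * \<sigma> t (a *\<^sub>C x)) = a * \<omega> (c * \<sigma> t x)" for c t x y a
    by (simp_all add: \<sigma> distrib_left mult_scaleC_right states_UNIV_D[OF \<omega>])
  \<comment> \<open>The function \<open>g\<close> is tied to the orbit on the real line only, which
    is where the approximation compares the two.\<close>
  have ext: "\<exists>g K. g holomorphic_on UNIV \<and> (\<forall>w. 0 \<le> Im w \<longrightarrow> cmod (g w) \<le> K) \<and>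
      (\<forall>t. g (complex_of_real t) = \<omega> (c * \<sigma> t d))" if "d \<in> vspan cstar_of_type S" for c d
    using that
  proof (induction rule: vspan.induct)
    case zero
    have "\<omega> (c * \<sigma> t 0) = 0" for t using lin(2)[of c t 0 0] by simp
    then show ?case by (intro exI[of _ "\<lambda>_. 0"] exI[of _ 0]) simp
  next
    case (add x y a)
    obtain g K where g: "g holomorphic_on UNIV" "\<And>w. 0 \<le> Im w \<Longrightarrow> cmod (g w) \<le> K"
        "\<And>t. g (complex_of_real t) = \<omega> (c * \<sigma> t x)"
      using gen[OF add(1)] by blast
    obtain g' K' where g': "g' holomorphic_on UNIV" "\<And>w. 0 \<le> Im w \<Longrightarrow> cmod (g' w) \<le> K'"
        "\<And>t. g' (complex_of_real t) = \<omega> (c * \<sigma> t y)"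
      using add.IH by blast
    have "(\<lambda>w. a * g w + g' w) holomorphic_on UNIV" by (intro holomorphic_intros g g')
    moreover have "cmod (a * g w + g' w) \<le> cmod a * K + K'" if "0 \<le> Im w" for w
      using g(2)[OF that] g'(2)[OF that]
      by (intro norm_triangle_le add_mono) (simp_all add: norm_mult mult_left_mono)
    ultimately show ?case
      by (intro exI[of _ "\<lambda>w. a * g w + g' w"] exI[of _ "cmod a * K + K'"]) (simp add: g(3) g'(3) lin)
  qed
  have "cmod (\<omega> (c * f z)) \<le> norm c * norm d + 2"
    if f: "is_entire_extension \<sigma> d f" and z: "0 \<le> Im z" for c d f z
  proof -
    have f': "entire_fun f" "\<And>t. f (complex_of_real t) = \<sigma> t d"
      using f by (auto simp: is_entire_extension_def)
    have real: "f w = \<sigma> (Re w) d" if "Im w = 0" for w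
      using f'(2)[of "Re w"] that by (simp add: complex_eq_iff flip: complex_is_Real_iff)
    show ?thesis
    proof (rule bounded_upper_half_plane_of_approximation[where F = "\<lambda>z. \<omega> (c * f z)", OF _ _ _ _ z])
      show "(\<lambda>z. \<omega> (c * f z)) holomorphic_on UNIV"
        by (intro entire_fun_linear_functional[OF f'(1), where K = "norm c"])
          (simp_all add: distrib_left mult_scaleC_right states_UNIV_D[OF \<omega>]
            bd[of c, unfolded mult.commute[of "norm c"]])
      show "cmod (\<omega> (c * f w)) \<le> norm c * norm d" if "Im w = 0" for w
        unfolding real[OF that] by (rule sbd)
      show "\<exists>K. \<forall>w. 0 \<le> Im w \<and> Im w \<le> Y \<longrightarrow> cmod (\<omega> (c * f w)) \<le> K" for Y
      proof -
        \<comment> \<open>A bound on the compact segment from 0 to \<open>\<i> * Y\<close> spreads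
          over the whole strip by the real shift.\<close>
        have "continuous_on {0..Y} (\<lambda>y. f (\<i> * complex_of_real y))"
          by (rule continuous_on_compose2[of UNIV f])
            (auto intro!: continuous_at_imp_continuous_on entire_fun_isCont f' continuous_intros)
        then have "bounded ((\<lambda>y. f (\<i> * complex_of_real y)) ` {0..Y})"
          by (intro compact_imp_bounded compact_continuous_image) auto
        then obtain B where B: "\<And>y. y \<in> {0..Y} \<Longrightarrow> norm (f (\<i> * complex_of_real y)) \<le> B"
          unfolding bounded_iff by blast
        have "cmod (\<omega> (c * f w)) \<le> norm c * B" if "0 \<le> Im w" "Im w \<le> Y" for w
        proof -
          have "\<omega> (c * f w) = \<omega> (c * \<sigma> (Re w) (f (\<i> * complex_of_real (Im w))))"
            using state_entire_extension_shift[OF dyn \<omega> f, of c "Re w" "\<i> * complex_of_real (Im w)"]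
            by (simp flip: complex_eq)
          then show ?thesis
            using sbd[of c "Re w" "f (\<i> * complex_of_real (Im w))"] B[of "Im w"] that
              mult_left_mono[OF B[of "Im w"] norm_ge_zero[of c]] by simp
        qed
        then show ?thesis by blast
      qed
      show "\<exists>g K. g holomorphic_on UNIV \<and> (\<forall>w. 0 \<le> Im w \<longrightarrow> cmod (g w) \<le> K) \<and>
          (\<forall>w. Im w = 0 \<longrightarrow> cmod (\<omega> (c * f w) - g w) \<le> \<epsilon>)" if eps: "0 < \<epsilon>" for \<epsilon>
      proof -
        have "d \<in> closure (vspan cstar_of_type S)" using S by (simp add: closed_cspan_def)
        \<comment> \<open>The summand 1 guards against \<open>norm c = 0\<close>.\<close>
        moreover have "0 < \<epsilon> / (norm c + 1)" using eps by (simp add: add_nonneg_pos)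
        ultimately obtain d' where d': "d' \<in> vspan cstar_of_type S" "norm (d - d') < \<epsilon> / (norm c + 1)"
          unfolding closure_approachable dist_norm by (metis norm_minus_commute)
        obtain g K where g: "g holomorphic_on UNIV" "\<And>w. 0 \<le> Im w \<Longrightarrow> cmod (g w) \<le> K"
            "\<And>t. g (complex_of_real t) = \<omega> (c * \<sigma> t d')"
          using ext[OF d'(1), of c] by blast
        have "cmod (\<omega> (c * f w) - g w) \<le> \<epsilon>" if "Im w = 0" for w
        proof -
          have w: "w = complex_of_real (Re w)" using that by (simp add: complex_eq_iff)
          have "\<omega> (c * f w) - g w = \<omega> (c * \<sigma> (Re w) (d - d'))"
            using g(3)[of "Re w"] w
            by (simp add: real[OF that] \<sigma> right_diff_distrib states_UNIV_diff[OF \<omega>])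
          also have "cmod \<dots> \<le> norm c * norm (d - d')" by (rule sbd)
          also have "\<dots> \<le> (norm c + 1) * (\<epsilon> / (norm c + 1))"
            using d'(2) by (intro mult_mono) auto
          also have "\<dots> = \<epsilon>" using norm_ge_zero[of c] by (simp add: add_nonneg_eq_0_iff)
          finally show ?thesis .
        qed
        with g(1,2) show ?thesis by blast
      qed
    qed
  qed
  then show ?thesis using \<omega> unfolding ground_states_def by (blast intro: less_imp_le)
qed

locale nica_toeplitz_dynamics = nica_toeplitz_generators G P X i
  for G :: "'g monoid" (structure) and P :: "'g set"
    and X :: "('g, 'x, 'a::{cstar_algebra, monoid_mult}) prodsys" and i :: "'g \<Rightarrow> 'x \<Rightarrow> 'c::cstar_algebra" +
  fixes \<Phi> :: "'c \<Rightarrow> 'c" and N :: "'g \<Rightarrow> real" and \<sigma> :: "real \<Rightarrow> 'c \<Rightarrow> 'c"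
  assumes expectation: "core_expectation P X i \<Phi>"
    and N_pos: "g \<in> carrier G \<Longrightarrow> N g > 0"
    and N_mult: "g \<in> carrier G \<Longrightarrow> h \<in> carrier G \<Longrightarrow> N (g \<otimes> h) = N g * N h"
    and N_ge_one: "r \<in> P \<Longrightarrow> N r \<ge> 1" and N_eq_one: "r \<in> P \<Longrightarrow> N r = 1 \<Longrightarrow> r = \<one>"
    and gauge: "gauge_dynamics G P X i N \<sigma>"
begin

section \<open>The dynamics and the expectation on generators\<close>

lemma dynamics: "dynamics \<sigma>"
  using gauge by (simp add: gauge_dynamics_def)

lemmas \<sigma>_simps = star_hom_cstarD[OF dynamicsD(1)[OF dynamics]]

lemma N_one: "N \<one> = 1"
  using N_mult[of \<one> \<one>] N_pos[of \<one>] by simp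

lemma \<sigma>_i:
  assumes "s \<in> P" and "\<xi> \<in> carrier (fib X s)"
  shows "\<sigma> t (i s \<xi>) = exp ((\<i> * ln (N s)) * complex_of_real t) *\<^sub>C i s \<xi>"
proof -
  have "complex_of_real (N s) powr (\<i> * complex_of_real t) = exp ((\<i> * ln (N s)) * complex_of_real t)"
    using N_pos[OF P_carrier[OF assms(1)]] by (simp add: powr_def Ln_of_real mult_ac)
  then show ?thesis using gauge assms by (simp add: gauge_dynamics_def)
qed

lemma \<sigma>_adj_i:
  assumes "s \<in> P" and "\<xi> \<in> carrier (fib X s)"
  shows "\<sigma> t (adj (i s \<xi>)) = exp (- (\<i> * ln (N s)) * complex_of_real t) *\<^sub>C adj (i s \<xi>)"
  by (simp add: \<sigma>_simps(4) \<sigma>_i[OF assms] adj_scaleC exp_cnj)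

lemma expectationD:
  "\<Phi> (x + y) = \<Phi> x + \<Phi> y" "\<Phi> (c *\<^sub>C x) = c *\<^sub>C \<Phi> x" "\<Phi> x \<in> core P X i"
  "norm (\<Phi> x) \<le> norm x" "\<exists>b\<in>core P X i. \<Phi> (adj x * x) = adj b * b"
  "x \<in> core P X i \<Longrightarrow> \<Phi> x = x"
  using expectation by (auto simp: core_expectation_def conditional_expectation_def linear_map_def)

lemma expectation_generator:
  "\<lbrakk>s \<in> P; r \<in> P; \<xi> \<in> carrier (fib X s); \<eta> \<in> carrier (fib X r)\<rbrakk>
    \<Longrightarrow> \<Phi> (i s \<xi> * adj (i r \<eta>)) = (if s = r then i s \<xi> * adj (i r \<eta>) else 0)"
  using expectation by (simp add: core_expectation_def)

definition vacuum_states :: "('c \<Rightarrow> complex) set" where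
  "vacuum_states = {\<phi> \<in> states (core P X i). \<forall>s\<in>P - {\<one>}. \<forall>b\<in>core_fibre X i s. \<phi> b = 0}"

lemma comp_expectation_state:
  assumes "\<phi> \<in> states (core P X i)"
  shows "\<phi> \<circ> \<Phi> \<in> states UNIV"
proof -
  have "\<phi> (\<Phi> (adj x * x)) \<in> \<real>\<^sub>\<ge>\<^sub>0" for x
    using expectationD(5)[of x] assms by (auto simp: states_def)
  moreover have "cmod (\<phi> (\<Phi> x)) \<le> norm x" for x
    using assms expectationD(3,4)[of x] by (auto simp: states_def intro: order_trans)
  moreover have "\<exists>x. norm x \<le> 1 \<and> k < cmod (\<phi> (\<Phi> x))" if "k < 1" for k
    using assms that expectationD(6) by (auto simp: states_def) metis
  ultimately show ?thesis
    using assms expectationD(3) by (auto simp: states_def expectationD(1,2))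
qed

lemma comp_expectation_ground_state:
  assumes "\<phi> \<in> vacuum_states"
  shows "\<phi> \<circ> \<Phi> \<in> ground_states \<sigma>"
proof (rule ground_states_of_spanning_set[OF dynamics _ closed_cspan_spanning_UNIV])
  let ?\<omega> = "\<phi> \<circ> \<Phi>"
  have \<phi>: "\<phi> \<in> states (core P X i)"
    "\<And>s b. s \<in> P \<Longrightarrow> s \<noteq> \<one> \<Longrightarrow> b \<in> core_fibre X i s \<Longrightarrow> \<phi> b = 0"
    using assms by (auto simp: vacuum_states_def)
  show \<omega>: "?\<omega> \<in> states UNIV" by (rule comp_expectation_state[OF \<phi>(1)])
  fix c d assume "d \<in> spanning (\<lambda>s r. True)"
  then obtain s r \<xi> \<eta> where s: "s \<in> P" "\<xi> \<in> carrier (fib X s)" and r: "r \<in> P" "\<eta> \<in> carrier (fib X r)"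
    and d: "d = i s \<xi> * adj (i r \<eta>)" unfolding spanning_def by blast
  \<comment> \<open>Thus \<open>exp l = N s / N r\<close>, and the analytic continuation of the
    orbit multiplies \<open>d\<close> by \<open>exp (\<i> * l * z)\<close>, of modulus
    \<open>exp (- l * Im z)\<close>.\<close>
  define l where "l = ln (N s) - ln (N r)"
  have "\<sigma> t d = (exp ((\<i> * ln (N s)) * complex_of_real t) * exp (- (\<i> * ln (N r)) * complex_of_real t)) *\<^sub>C d" for t
    by (simp only: d \<sigma>_simps(3) \<sigma>_i[OF s] \<sigma>_adj_i[OF r] mult_scaleC_left mult_scaleC_right scaleC_scaleC)
      (simp only: mult.commute)
  then have \<sigma>d: "\<sigma> t d = exp (\<i> * complex_of_real l * complex_of_real t) *\<^sub>C d" for t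
    by (simp add: l_def algebra_simps flip: exp_add)
  let ?g = "\<lambda>w. exp (\<i> * complex_of_real l * w) * ?\<omega> (c * d)"
  have "cmod (?g w) \<le> cmod (?\<omega> (c * d))" if w: "0 \<le> Im w" for w
  proof (cases "r = \<one>")
    case True
    then have "0 \<le> l" using N_ge_one[OF s(1)] by (simp add: l_def N_one)
    then have "exp (- l * Im w) \<le> 1" using w by simp
    then show ?thesis by (simp only: norm_mult norm_exp_ii_times mult_left_le_one_le norm_ge_zero exp_ge_zero)
  next
    case False
    \<comment> \<open>The middle factor is absorbed into \<open>\<eta>\<close> by the right action,
      so \<open>adj d * d\<close> lies in \<open>core_fibre X i r\<close>, where
      \<open>\<phi>\<close> vanishes.\<close>
    have "adj d * d = (i r \<eta> * (adj (i s \<xi>) * i s \<xi>)) * adj (i r \<eta>)"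
      by (simp add: d adj_mult adj_adj mult.assoc)
    also have "\<dots> = i r (ract (fib X r) \<eta> (hinner (fib X s) \<xi> \<xi>)) * adj (i r \<eta>)"
      by (simp only: i_inner[OF s s(2)] i_ract[OF r])
    finally have dd: "adj d * d = i r (ract (fib X r) \<eta> (hinner (fib X s) \<xi> \<xi>)) * adj (i r \<eta>)" .
    have "?\<omega> (adj d * d) = \<phi> (adj d * d)"
      using core_generator[OF r(1) fib_ract_closed[OF r] r(2)] by (simp add: dd expectationD(6))
    also have "\<dots> = 0"
      unfolding dd by (rule \<phi>(2)[OF r(1) False rank_one_in_core_fibre[OF r(1) fib_ract_closed[OF r] r(2)]])
    finally have "(cmod (?\<omega> (adj (adj c) * d)))\<^sup>2 \<le> 0"
      using state_Cauchy_Schwarz[OF \<omega>, of "adj c" d] by simp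
    then have "?\<omega> (c * d) = 0" by (simp add: adj_adj)
    then show ?thesis by simp
  qed
  moreover have "?g holomorphic_on UNIV" by (intro holomorphic_intros)
  moreover have "?g (complex_of_real t) = ?\<omega> (c * \<sigma> t d)" for t
    by (simp add: \<sigma>d mult_scaleC_right states_UNIV_D(2)[OF \<omega>] del: o_apply)
  ultimately show "\<exists>g K. g holomorphic_on UNIV \<and> (\<forall>w. 0 \<le> Im w \<longrightarrow> cmod (g w) \<le> K) \<and>
      (\<forall>t. g (complex_of_real t) = ?\<omega> (c * \<sigma> t d))"
    by blast
qed

section \<open>Vanishing of ground states outside the unit fibre\<close>

lemma ground_state_vanishes_right:
  assumes \<omega>: "\<omega> \<in> ground_states \<sigma>" and s: "s \<in> P" "\<xi> \<in> carrier (fib X s)"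
    and r: "r \<in> P" "\<eta> \<in> carrier (fib X r)" and "r \<noteq> \<one>"
  shows "\<omega> (i s \<xi> * adj (i r \<eta>)) = 0"
proof (rule ccontr)
  assume nz: "\<omega> (i s \<xi> * adj (i r \<eta>)) \<noteq> 0"
  have st: "\<omega> \<in> states UNIV" using \<omega> by (simp add: ground_states_def)
  have l: "0 < ln (N r)"
    using N_ge_one[OF r(1)] N_eq_one[OF r(1)] \<open>r \<noteq> \<one>\<close> by (intro ln_gt_zero) linarith
  let ?f = "\<lambda>z. exp (- (\<i> * ln (N r)) * z) *\<^sub>C adj (i r \<eta>)"
  have "analytic_element \<sigma> (i s \<xi>)"
    unfolding analytic_element_def is_entire_extension_def
    by (intro exI[of _ "\<lambda>z. exp ((\<i> * ln (N s)) * z) *\<^sub>C i s \<xi>"] conjI entire_fun_exp_scaleC)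
      (simp add: \<sigma>_i[OF s])
  moreover have "is_entire_extension \<sigma> (adj (i r \<eta>)) ?f"
    unfolding is_entire_extension_def
    by (intro conjI entire_fun_exp_scaleC) (simp add: \<sigma>_adj_i[OF r])
  ultimately obtain M where M: "\<And>z. 0 < Im z \<Longrightarrow> cmod (\<omega> (i s \<xi> * ?f z)) \<le> M"
    using \<omega> unfolding ground_states_def by blast
  let ?w = "cmod (\<omega> (i s \<xi> * adj (i r \<eta>)))"
  \<comment> \<open>On the imaginary axis the starred generator is scaled by \<open>N r\<close> to
    the power \<open>y\<close>, which is unbounded because \<open>N r > 1\<close>.\<close>
  have key: "exp (ln (N r) * y) * ?w \<le> M" if "0 < y" for y
  proof -
    have "cmod (\<omega> (i s \<xi> * ?f (\<i> * complex_of_real y))) = cmod (exp (- (\<i> * ln (N r)) * (\<i> * complex_of_real y))) * ?w"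
      by (simp only: mult_scaleC_right states_UNIV_D(2)[OF st] norm_mult)
    also have "cmod (exp (- (\<i> * ln (N r)) * (\<i> * complex_of_real y))) = exp (ln (N r) * y)"
      by (simp add: norm_exp_eq_Re)
    finally show ?thesis using M[of "\<i> * complex_of_real y"] that by simp
  qed
  have M0: "0 \<le> M" using key[of 1] by (meson exp_ge_zero mult_nonneg_nonneg norm_ge_zero order_trans zero_less_one)
  \<comment> \<open>At this value of \<open>y\<close> the exponent is \<open>M / ?w + 1\<close>,
    large enough to violate the bound \<open>M\<close>.\<close>
  have "(1 + M / ?w) * ?w \<le> exp (ln (N r) * ((M / ?w + 1) / ln (N r))) * ?w"
    using exp_ge_add_one_self[of "M / ?w + 1"] l by (intro mult_right_mono) auto
  also have "\<dots> \<le> M" using M0 l nz by (intro key divide_pos_pos) (auto simp: add_nonneg_pos)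
  finally have "(1 + M / ?w) * ?w \<le> M" .
  moreover have "(1 + M / ?w) * ?w = ?w + M" using nz by (simp add: field_simps)
  moreover have "0 < ?w" using nz by simp
  ultimately show False by linarith
qed

lemma ground_state_vanishes:
  assumes \<omega>: "\<omega> \<in> ground_states \<sigma>" and s: "s \<in> P" "\<xi> \<in> carrier (fib X s)"
    and r: "r \<in> P" "\<eta> \<in> carrier (fib X r)" and "\<not> (s = \<one> \<and> r = \<one>)"
  shows "\<omega> (i s \<xi> * adj (i r \<eta>)) = 0"
proof (cases "r = \<one>")
  case True
  have st: "\<omega> \<in> states UNIV" using \<omega> by (simp add: ground_states_def)
  have "s \<noteq> \<one>" using assms(6) True by simp
  then have "\<omega> (i r \<eta> * adj (i s \<xi>)) = 0" by (rule ground_state_vanishes_right[OF \<omega> r s])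
  then show ?thesis using state_hermitian[OF st, of "adj (i s \<xi>)" "adj (i r \<eta>)"] by (simp add: adj_adj)
next
  case False
  then show ?thesis by (rule ground_state_vanishes_right[OF \<omega> s r])
qed

lemma functional_eqI:
  fixes L L' :: "'c \<Rightarrow> complex"
  assumes "\<And>x y. L (x + y) = L x + L y" "\<And>c x. L (c *\<^sub>C x) = c * L x" "\<And>x. cmod (L x) \<le> norm x"
    and "\<And>x y. L' (x + y) = L' x + L' y" "\<And>c x. L' (c *\<^sub>C x) = c * L' x" "\<And>x. cmod (L' x) \<le> norm x"
    and eq: "\<And>s r \<xi> \<eta>. \<lbrakk>s \<in> P; \<xi> \<in> carrier (fib X s); r \<in> P; \<eta> \<in> carrier (fib X r)\<rbrakk>
      \<Longrightarrow> L (i s \<xi> * adj (i r \<eta>)) = L' (i s \<xi> * adj (i r \<eta>))"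
  shows "L x = L' x"
proof -
  have "cmod (L x - L' x) \<le> norm x * 2" for x
    using norm_triangle_ineq4[of "L x" "L' x"] assms(3,6)[of x] by linarith
  then have "closed_csubspace {x. L x - L' x = 0}"
    by (intro closed_csubspace_kernel[where K = 2]) (simp_all add: assms algebra_simps)
  moreover have "spanning (\<lambda>s r. True) \<subseteq> {x. L x - L' x = 0}"
    using eq unfolding spanning_def by fastforce
  ultimately have "closed_cspan (spanning (\<lambda>s r. True)) \<subseteq> {x. L x - L' x = 0}"
    by (rule closed_cspan_minimal)
  then show ?thesis unfolding closed_cspan_spanning_UNIV by auto
qed

lemma ground_state_comp_expectation:
  assumes \<omega>: "\<omega> \<in> ground_states \<sigma>"
  shows "\<omega> (\<Phi> x) = \<omega> x"
proof -
  have st: "\<omega> \<in> states UNIV" using \<omega> by (simp add: ground_states_def)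
  have zero: "\<omega> 0 = 0" using states_UNIV_D(2)[OF st, of 0 0] by simp
  show ?thesis
  proof (rule functional_eqI[where L = "\<lambda>x. \<omega> (\<Phi> x)" and L' = \<omega>])
    show "cmod (\<omega> (\<Phi> x)) \<le> norm x" for x
      using states_UNIV_D(4)[OF st] expectationD(4) by (rule order_trans)
    fix s r \<xi> \<eta> assume s: "s \<in> P" "\<xi> \<in> carrier (fib X s)" and r: "r \<in> P" "\<eta> \<in> carrier (fib X r)"
    show "\<omega> (\<Phi> (i s \<xi> * adj (i r \<eta>))) = \<omega> (i s \<xi> * adj (i r \<eta>))"
      using ground_state_vanishes[OF \<omega> s r] expectation_generator[OF s(1) r(1) s(2) r(2)] zero
      by (cases "s = r") auto
  qed (simp_all add: expectationD(1,2) states_UNIV_D[OF st])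
qed

section \<open>The value of ground states at the projection \<open>ie 1\<close>\<close>

lemma norm_ie_one: "norm (ie 1) \<le> 1"
proof -
  have "(norm (ie 1))\<^sup>2 = norm (ie 1)"
    using cstar_identity[of "ie 1"] by (simp add: ie_one_selfadjoint flip: ie_simps(3))
  then show ?thesis by (cases "ie 1 = 0") (auto simp: power2_eq_square)
qed

lemma ie_one_in_core: "ie 1 \<in> core P X i"
  using core_generator[OF one_in_P emb_closed emb_closed, of 1 1]
  by (simp add: ie_one_selfadjoint flip: ie_def ie_simps(3))

text \<open>\<open>ie 1\<close> is a left unit on the fibre over the unit, and
  \<open>\<omega>\<close> kills the other spanning elements, so
  \<open>\<omega> (ie 1 * x) = \<omega> x\<close>. Then Cauchy-Schwarz gives
  \<open>(cmod (\<omega> x))\<^sup>2 \<le> Re (\<omega> (ie 1))\<close> on the unit ball, and norm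
  exactly one leaves only the value 1.\<close>

lemma ground_state_ie_one:
  assumes \<omega>: "\<omega> \<in> ground_states \<sigma>"
  shows "\<omega> (ie 1) = 1"
proof -
  have st: "\<omega> \<in> states UNIV" using \<omega> by (simp add: ground_states_def)
  have pp: "adj (ie 1) * ie 1 = ie 1" by (simp add: ie_one_selfadjoint flip: ie_simps(3))
  have eq: "\<omega> (ie 1 * x) = \<omega> x" for x
  proof (rule functional_eqI[where L = "\<lambda>x. \<omega> (ie 1 * x)"])
    show "cmod (\<omega> (ie 1 * x)) \<le> norm x" for x
      using states_UNIV_D(4)[OF st, of "ie 1 * x"] norm_mult_ineq[of "ie 1" x]
        mult_right_mono[OF norm_ie_one norm_ge_zero[of x]] by linarith
    fix s r \<xi> \<eta> assume s: "s \<in> P" "\<xi> \<in> carrier (fib X s)" and r: "r \<in> P" "\<eta> \<in> carrier (fib X r)"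
    show "\<omega> (ie 1 * (i s \<xi> * adj (i r \<eta>))) = \<omega> (i s \<xi> * adj (i r \<eta>))"
    proof (cases "s = \<one> \<and> r = \<one>")
      case True
      then obtain a where "\<xi> = emb X a" using s emb_bij by (auto simp: bij_betw_def)
      then have "ie 1 * i s \<xi> = i s \<xi>" using True by (simp flip: ie_def ie_simps(3))
      then show ?thesis by (simp flip: mult.assoc)
    next
      case False
      then show ?thesis
        using ground_state_vanishes[OF \<omega> s r False]
          ground_state_vanishes[OF \<omega> s(1) lact_closed[OF s] r False, of 1]
        by (simp add: i_lact[OF s, symmetric] mult.assoc)
    qed
  qed (simp_all add: states_UNIV_D[OF st] distrib_left mult_scaleC_right)
  define p where "p = Re (\<omega> (ie 1))"
  have real: "\<omega> (ie 1) \<in> \<real>\<^sub>\<ge>\<^sub>0" using states_UNIV_D(3)[OF st, of "ie 1"] by (simp add: pp)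
  then have p: "\<omega> (ie 1) = of_real p" "0 \<le> p"
    by (auto simp: p_def complex_nonneg_Reals_iff complex_eq_iff)
  have "p \<le> 1" using states_UNIV_D(4)[OF st, of "ie 1"] norm_ie_one p by simp
  moreover have "\<not> p < 1"
  proof
    assume "p < 1"
    then have "sqrt p < 1" by simp
    then obtain x where x: "norm x \<le> 1" "sqrt p < cmod (\<omega> x)"
      using states_UNIV_D(5)[OF st] by blast
    have "(cmod (\<omega> x))\<^sup>2 \<le> p * Re (\<omega> (adj x * x))"
      using state_Cauchy_Schwarz[OF st, of "ie 1" x] by (simp add: ie_one_selfadjoint pp[unfolded ie_one_selfadjoint] eq p_def)
    also have "\<dots> \<le> p * 1"
    proof (intro mult_left_mono p(2))
      have "Re (\<omega> (adj x * x)) \<le> norm (adj x * x)"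
        using complex_Re_le_cmod states_UNIV_D(4)[OF st] by (rule order_trans)
      also have "\<dots> \<le> 1" using x(1) by (simp add: cstar_identity power_le_one)
      finally show "Re (\<omega> (adj x * x)) \<le> 1" .
    qed
    finally have "cmod (\<omega> x) \<le> sqrt p" by (intro real_le_rsqrt) simp
    with x(2) show False by simp
  qed
  ultimately show ?thesis using p by simp
qed

lemma restrict_ground_state:
  assumes \<omega>: "\<omega> \<in> ground_states \<sigma>"
  shows "restrict \<omega> (core P X i) \<in> vacuum_states"
proof -
  have st: "\<omega> \<in> states UNIV" using \<omega> by (simp add: ground_states_def)
  note core = closed_csubspaceD[OF core_closed_csubspace]
  have "restrict \<omega> (core P X i) \<in> states (core P X i)"
  proof -
    \<comment> \<open>Passing from \<open>x\<close> to \<open>\<Phi> x\<close> does not change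
      \<open>\<omega>\<close> and does not increase the norm, so the restriction still has norm
      one.\<close>
    have "\<exists>x\<in>core P X i. norm x \<le> 1 \<and> k < cmod (\<omega> x)" if k: "k < 1" for k
    proof -
      obtain x where "norm x \<le> 1" "k < cmod (\<omega> x)" using states_UNIV_D(5)[OF st k] by blast
      then show ?thesis
        using expectationD(3,4)[of x] ground_state_comp_expectation[OF \<omega>, of x]
        by (intro bexI[of _ "\<Phi> x"]) auto
    qed
    then show ?thesis
      by (simp add: states_def core core_mult core_adj states_UNIV_D[OF st])
  qed
  moreover have "\<omega> b = 0" "b \<in> core P X i" if s: "s \<in> P" "s \<noteq> \<one>" and b: "b \<in> core_fibre X i s" for s b
  proof -
    have "closed_csubspace {x. \<omega> x = 0}"
      by (rule closed_csubspace_kernel[where K = 1]) (simp_all add: states_UNIV_D[OF st])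
    moreover have "{i s \<xi> * adj (i s \<eta>) |\<xi> \<eta>. \<xi> \<in> carrier (fib X s) \<and> \<eta> \<in> carrier (fib X s)} \<subseteq> {x. \<omega> x = 0}"
      using ground_state_vanishes[OF \<omega> s(1) _ s(1)] s(2) by blast
    ultimately show "\<omega> b = 0"
      using core_fibre_subset[OF s(1)] b closed_cspan_minimal by blast
    show "b \<in> core P X i" using core_fibre_subset_core[OF s(1)] b by blast
  qed
  ultimately show ?thesis by (auto simp: vacuum_states_def)
qed

section \<open>Convexity and the affine bijection\<close>

lemma ground_states_convex:
  assumes "\<omega> \<in> ground_states \<sigma>" and "\<omega>' \<in> ground_states \<sigma>" and t: "t \<in> {0..1}"
  shows "convex_comb UNIV t \<omega> \<omega>' \<in> ground_states \<sigma>"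
proof -
  have "convex_comb UNIV t \<omega> \<omega>' \<in> states UNIV"
    using assms norm_ie_one ground_state_ie_one
    by (intro convex_comb_states[where p = "ie 1"]) (auto simp: ground_states_def closed_csubspace_def)
  moreover have "\<exists>M. \<forall>z. 0 < Im z \<longrightarrow> cmod (convex_comb UNIV t \<omega> \<omega>' (c * f z)) \<le> M"
    if cf: "analytic_element \<sigma> c \<and> is_entire_extension \<sigma> d f" for c d f
  proof -
    obtain M where M: "\<And>z. 0 < Im z \<Longrightarrow> cmod (\<omega> (c * f z)) \<le> M"
      using assms(1) cf unfolding ground_states_def by blast
    obtain M' where M': "\<And>z. 0 < Im z \<Longrightarrow> cmod (\<omega>' (c * f z)) \<le> M'"
      using assms(2) cf unfolding ground_states_def by blast
    have "cmod (convex_comb UNIV t \<omega> \<omega>' (c * f z)) \<le> t * M + (1 - t) * M'" if "0 < Im z" for z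
      using t M[OF that] M'[OF that] unfolding convex_comb_def restrict_UNIV
      by (intro norm_triangle_le add_mono) (simp_all only: norm_mult norm_of_real, auto intro: mult_left_mono)
    then show ?thesis by blast
  qed
  ultimately show ?thesis unfolding ground_states_def by blast
qed

text \<open>The value is read off from the ground state \<open>\<phi> \<circ> \<Phi>\<close>,
  because \<open>\<Phi>\<close> fixes \<open>ie 1\<close>.\<close>

lemma vacuum_state_ie_one:
  assumes "\<phi> \<in> vacuum_states"
  shows "\<phi> (ie 1) = 1"
  using ground_state_ie_one[OF comp_expectation_ground_state[OF assms]]
  by (simp add: expectationD(6) ie_one_in_core)

lemma vacuum_states_convex:
  assumes "\<phi> \<in> vacuum_states" and "\<phi>' \<in> vacuum_states" and t: "t \<in> {0..1}"
  shows "convex_comb (core P X i) t \<phi> \<phi>' \<in> vacuum_states"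
proof -
  have "convex_comb (core P X i) t \<phi> \<phi>' \<in> states (core P X i)"
    using assms vacuum_state_ie_one
    by (intro convex_comb_states[where p = "ie 1"] core_closed_csubspace core_mult core_adj
        ie_one_in_core norm_ie_one) (auto simp: vacuum_states_def)
  moreover have "b \<in> core P X i" if "s \<in> P" "b \<in> core_fibre X i s" for s b
    using core_fibre_subset_core that by blast
  ultimately show ?thesis using assms by (auto simp: vacuum_states_def convex_comb_def)
qed

lemma affine_isomorphism_ground_states:
  "affine_isomorphism (core P X i) vacuum_states UNIV (ground_states \<sigma>) (\<lambda>\<phi>. \<phi> \<circ> \<Phi>)"
  unfolding affine_isomorphism_def
proof (intro conjI ballI)
  show "bij_betw (\<lambda>\<phi>. \<phi> \<circ> \<Phi>) vacuum_states (ground_states \<sigma>)"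
  proof (rule bij_betw_byWitness[where f' = "\<lambda>\<omega>. restrict \<omega> (core P X i)"])
    have "restrict (\<phi> \<circ> \<Phi>) (core P X i) = \<phi>" if "\<phi> \<in> vacuum_states" for \<phi>
      using that by (intro extensionalityI[of _ "core P X i"])
        (auto simp: vacuum_states_def states_def expectationD(6))
    then show "\<forall>\<phi>\<in>vacuum_states. restrict (\<phi> \<circ> \<Phi>) (core P X i) = \<phi>" by blast
    show "\<forall>\<omega>\<in>ground_states \<sigma>. restrict \<omega> (core P X i) \<circ> \<Phi> = \<omega>"
      by (auto simp: fun_eq_iff expectationD(3) ground_state_comp_expectation)
  qed (auto intro: comp_expectation_ground_state restrict_ground_state)
  fix t :: real and \<phi> \<phi>'
  show "convex_comb (core P X i) t \<phi> \<phi>' \<circ> \<Phi> = convex_comb UNIV t (\<phi> \<circ> \<Phi>) (\<phi>' \<circ> \<Phi>)"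
    by (simp add: fun_eq_iff convex_comb_def expectationD(3))
qed (auto intro: vacuum_states_convex ground_states_convex)

end

theorem theorem3p4:
  fixes G :: "'g monoid"
    and P :: "'g set"
    and X :: "('g, 'x, 'a::{cstar_algebra, monoid_mult}) prodsys"
    and i :: "'g \<Rightarrow> 'x \<Rightarrow> 'c::cstar_algebra"
    and \<Phi> :: "'c \<Rightarrow> 'c"
    and N :: "'g \<Rightarrow> real"
    and \<sigma> :: "real \<Rightarrow> 'c \<Rightarrow> 'c"
  assumes "compactly_aligned_product_system G P X"
    and "is_nica_toeplitz_algebra G P X i"
    and "core_expectation P X i \<Phi>"
    and "\<forall>g\<in>carrier G. N g > 0"
    and "\<forall>g\<in>carrier G. \<forall>h\<in>carrier G. N (g \<otimes>\<^bsub>G\<^esub> h) = N g * N h"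
    and "\<forall>r\<in>P. N r \<ge> 1 \<and> (N r = 1 \<longrightarrow> r = \<one>\<^bsub>G\<^esub>)"
    and "gauge_dynamics G P X i N \<sigma>"
  shows "affine_isomorphism
     (core P X i)
     {\<phi> \<in> states (core P X i). \<forall>s\<in>P - {\<one>\<^bsub>G\<^esub>}. \<forall>b\<in>core_fibre X i s. \<phi> b = 0}
     UNIV
     (ground_states \<sigma>)
     (\<lambda>\<phi>. \<phi> \<circ> \<Phi>)"
proof -
  interpret compactly_aligned_product_system G P X by fact
  interpret nica_toeplitz_dynamics G P X i \<Phi> N \<sigma>
    using assms(2-7) by unfold_locales (auto simp: is_nica_toeplitz_algebra_def)
  show ?thesis using affine_isomorphism_ground_states unfolding vacuum_states_def .
qed

end
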